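(* Let $p$ be a prime, and let $a$ and $r$ be positive integers such that $r\ge 3$. Let $n=ar$. Then there exists a finite $p$-group $G$ with properties (P1), (P2) and (P3) such that $|G/Z(G)|=p^{2n}$ and the Chermak-Delgado lattice $\mathcal{CD}(G)$ is a quasi-antichain of width $w=p^a+1$, in which the number of abelian atoms is $1$ if $p=2$ and is $2$ if $p\ne 2$.
   Context: For a finite group $G$ and $H\le G$, the Chermak-Delgado measure of $H$ in $G$ is $m_G(H)=|H|\,|C_G(H)|$. Put $m^*(G)=\max\{m_G(H)\mid H\le G\}$ and $\mathcal{CD}(G)=\{H\le G\mid m_G(H)=m^*(G)\}$. It is known that $\mathcal{CD}(G)$, ordered by inclusion, is a lattice of subgroups of $G$, called the Chermak-Delgado lattice of $G$. A quasi-antichain is a lattice consisting of a maximum, a minimum, and the atoms of the lattice; its width $w$ is the number of atoms, and $w\ge 3$ is assumed. An abelian atom is an atom of $\mathcal{CD}(G)$ that is an abelian group. Let $M_1,\dots,M_w$ be all the atoms of $\mathcal{CD}(G)$. Properties (P1)-(P3) are: (P1) Both $G/Z(G)$ and $G'$ are elementary abelian. (P2) $M_i/Z(G)\cong M_j/Z(G)$ and $G/Z(G)=M_i/Z(G)\times M_j/Z(G)$ for $i\ne j$. (P3) Let $M_1=\langle x_1,\dots,x_n\rangle Z(G)$ and $M_2=\langle y_1,\dots,y_n\rangle Z(G)$, where $M_1/Z(G)$ and $M_2/Z(G)$ are elementary abelian of order $p^n$. Then for each $k\ge 3$ one has $M_k=\langle x_1y_1',\dots,x_ny_n'\rangle Z(G)$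 for some $y_1',\dots,y_n'$ with $M_2=\langle y_1',\dots,y_n'\rangle Z(G)$; moreover there is an invertible $n\times n$ matrix $(c^{(k)}_{ij})$ over $\mathbb{F}_p$ with $y_j'\equiv\prod_{i=1}^n y_i^{c^{(k)}_{ij}} \pmod{Z(G)}$ for $j=1,\dots,n$. *)

theory Defs
  imports
    "HOL-Algebra.Algebra"
    "HOL-Number_Theory.Number_Theory"
begin

definition finite_p_group :: "nat \<Rightarrow> ('a, 'b) monoid_scheme \<Rightarrow> bool"
  where "finite_p_group p G \<longleftrightarrow> group G \<and> finite (carrier G) \<and> (\<exists>m. order G = p ^ m)"

definition centralizer :: "('a, 'b) monoid_scheme \<Rightarrow> 'a set \<Rightarrow> 'a set"
  where "centralizer G H =
    {g \<in> carrier G. \<forall>h\<in>H. g \<otimes>\<^bsub>G\<^esub> h = h \<otimes>\<^bsub>G\<^esub> g}"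

definition center :: "('a, 'b) monoid_scheme \<Rightarrow> 'a set"
  where "center G = centralizer G (carrier G)"

definition elementary_abelian :: "nat \<Rightarrow> ('a, 'b) monoid_scheme \<Rightarrow> bool"
  where "elementary_abelian p G \<longleftrightarrow>
    comm_group G \<and> (\<forall>x\<in>carrier G. x [^]\<^bsub>G\<^esub> p = \<one>\<^bsub>G\<^esub>)"

definition internal_direct_product :: "('a, 'b) monoid_scheme \<Rightarrow> 'a set \<Rightarrow> 'a set \<Rightarrow> bool"
  where "internal_direct_product G A B \<longleftrightarrow>
    A \<lhd> G \<and> B \<lhd> G \<and> A \<inter> B = {\<one>\<^bsub>G\<^esub>} \<and> A <#>\<^bsub>G\<^esub> B = carrier G"

text \<open>The quotient \<open>M/Z(G)\<close> as a group in its own right, for \<open>Z(G) \<le> M \<le> G\<close>; its carrier is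
  a subset of the carrier of \<open>G Mod center G\<close>.\<close>

definition mod_center :: "('a, 'b) monoid_scheme \<Rightarrow> 'a set \<Rightarrow> 'a set monoid"
  where "mod_center G M = (G\<lparr>carrier := M\<rparr>) Mod (center G)"

definition cd_measure :: "('a, 'b) monoid_scheme \<Rightarrow> 'a set \<Rightarrow> nat"
  where "cd_measure G H = card H * card (centralizer G H)"

definition max_cd_measure :: "('a, 'b) monoid_scheme \<Rightarrow> nat"
  where "max_cd_measure G = Max {cd_measure G H | H. subgroup H G}"

definition cd_lattice :: "('a, 'b) monoid_scheme \<Rightarrow> 'a set gorder"
  where "cd_lattice G =
    \<lparr>carrier = {H. subgroup H G \<and> cd_measure G H = max_cd_measure G},
     eq = (=), le = (\<subseteq>)\<rparr>"

definition atoms :: "('a, 'b) gorder_scheme \<Rightarrow> 'a set"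
  where "atoms L =
    {x \<in> carrier L. \<bottom>\<^bsub>L\<^esub> \<sqsubset>\<^bsub>L\<^esub> x \<and>
      \<not> (\<exists>y\<in>carrier L. \<bottom>\<^bsub>L\<^esub> \<sqsubset>\<^bsub>L\<^esub> y \<and> y \<sqsubset>\<^bsub>L\<^esub> x)}"

definition quasi_antichain :: "('a, 'b) gorder_scheme \<Rightarrow> nat \<Rightarrow> bool"
  where "quasi_antichain L w \<longleftrightarrow>
    bounded_lattice L \<and>
    carrier L = {\<bottom>\<^bsub>L\<^esub>, \<top>\<^bsub>L\<^esub>} \<union> atoms L \<and>
    card (atoms L) = w \<and> w \<ge> 3"

definition cd_atoms :: "('a, 'b) monoid_scheme \<Rightarrow> 'a set set"
  where "cd_atoms G = atoms (cd_lattice G)"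

definition abelian_cd_atoms :: "('a, 'b) monoid_scheme \<Rightarrow> 'a set set"
  where "abelian_cd_atoms G = {M \<in> cd_atoms G. comm_group (G\<lparr>carrier := M\<rparr>)}"

definition property_P1 :: "nat \<Rightarrow> ('a, 'b) monoid_scheme \<Rightarrow> bool"
  where "property_P1 p G \<longleftrightarrow>
    elementary_abelian p (G Mod center G) \<and>
    elementary_abelian p (G\<lparr>carrier := derived G (carrier G)\<rparr>)"

definition property_P2 :: "('a, 'b) monoid_scheme \<Rightarrow> bool"
  where "property_P2 G \<longleftrightarrow>
    (\<forall>A\<in>cd_atoms G. \<forall>B\<in>cd_atoms G. A \<noteq> B \<longrightarrow>
      mod_center G A \<cong> mod_center G B \<and>
      internal_direct_product (G Mod center G)
        (carrier (mod_center G A)) (carrier (mod_center G B)))"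

text \<open>Square matrices of size \<open>n\<close> over a ring \<open>R\<close> are functions on index pairs; only the values
  at indices in \<open>{1..n}\<close> matter.\<close>

definition is_inverse_matrix ::
    "('a, 'b) ring_scheme \<Rightarrow> nat \<Rightarrow> (nat \<Rightarrow> nat \<Rightarrow> 'a) \<Rightarrow> (nat \<Rightarrow> nat \<Rightarrow> 'a) \<Rightarrow> bool"
  where "is_inverse_matrix R n c d \<longleftrightarrow>
    (\<forall>i\<in>{1..n}. \<forall>k\<in>{1..n}.
      (\<Oplus>\<^bsub>R\<^esub>j\<in>{1..n}. c i j \<otimes>\<^bsub>R\<^esub> d j k) = (if i = k then \<one>\<^bsub>R\<^esub> else \<zero>\<^bsub>R\<^esub>) \<and>
      (\<Oplus>\<^bsub>R\<^esub>j\<in>{1..n}. d i j \<otimes>\<^bsub>R\<^esub> c j k) = (if i = k then \<one>\<^bsub>R\<^esub> else \<zero>\<^bsub>R\<^esub>))"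

definition invertible_matrix :: "('a, 'b) ring_scheme \<Rightarrow> nat \<Rightarrow> (nat \<Rightarrow> nat \<Rightarrow> 'a) \<Rightarrow> bool"
  where "invertible_matrix R n c \<longleftrightarrow>
    (\<forall>i\<in>{1..n}. \<forall>j\<in>{1..n}. c i j \<in> carrier R) \<and>
    (\<exists>d. (\<forall>i\<in>{1..n}. \<forall>j\<in>{1..n}. d i j \<in> carrier R) \<and> is_inverse_matrix R n c d)"

definition generates_mod_center ::
    "('a, 'b) monoid_scheme \<Rightarrow> nat \<Rightarrow> (nat \<Rightarrow> 'a) \<Rightarrow> 'a set \<Rightarrow> bool"
  where "generates_mod_center G n x M \<longleftrightarrow>
    x ` {1..n} \<subseteq> carrier G \<and> M = generate G (x ` {1..n}) <#>\<^bsub>G\<^esub> center G"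

text \<open>The product \<open>f 1 \<otimes> \<dots> \<otimes> f n\<close>, taken in this order since \<open>G\<close> need not be commutative.\<close>

definition ordered_prod :: "('a, 'b) monoid_scheme \<Rightarrow> nat \<Rightarrow> (nat \<Rightarrow> 'a) \<Rightarrow> 'a"
  where "ordered_prod G n f = foldr (\<otimes>\<^bsub>G\<^esub>) (map f [1..<Suc n]) \<one>\<^bsub>G\<^esub>"

text \<open>The enumeration \<open>M\<close> of the atoms and the generators \<open>x\<close>, \<open>y\<close> are arbitrary.  The entries
  of \<open>c\<close> lie in the prime field, represented by \<open>{0..p - 1}\<close>; congruence modulo \<open>Z(G)\<close> is
  equality of cosets.\<close>

definition property_P3 :: "nat \<Rightarrow> nat \<Rightarrow> ('a, 'b) monoid_scheme \<Rightarrow> bool"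
  where "property_P3 p n G \<longleftrightarrow>
    (\<forall>M. bij_betw M {1..card (cd_atoms G)} (cd_atoms G) \<longrightarrow>
      (\<forall>i\<in>{1, 2::nat}. elementary_abelian p (mod_center G (M i)) \<and>
                        order (mod_center G (M i)) = p ^ n) \<and>
      (\<forall>x y. generates_mod_center G n x (M 1) \<and> generates_mod_center G n y (M 2) \<longrightarrow>
        (\<forall>k\<in>{3..card (cd_atoms G)}. \<exists>y'.
          generates_mod_center G n y' (M 2) \<and>
          generates_mod_center G n (\<lambda>i. x i \<otimes>\<^bsub>G\<^esub> y' i) (M k) \<and>
          (\<exists>c. invertible_matrix (residue_ring (int p)) n c \<and>
            (\<forall>j\<in>{1..n}. center G #>\<^bsub>G\<^esub> y' j =
              center G #>\<^bsub>G\<^esub> ordered_prod G n (\<lambda>i. y i [^]\<^bsub>G\<^esub> (c i j :: int)))))))"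

end

theory Submission
  imports Defs "HOL-Library.Function_Algebras"
begin

text \<open>Let \<open>q = p ^ a\<close>, let \<open>F\<close> be the field of order \<open>q\<close>, and let \<open>G\<close> be the central extension of
  \<open>V = F\<^sup>2 \<otimes> F\<^sup>r\<close> whose commutator form is \<open>\<beta>(s \<otimes> u, t \<otimes> v) = S(s, t) (u \<and> v)\<close>, where \<open>S\<close> is a
  nondegenerate symmetric form on \<open>F\<^sup>2\<close>. Subgroups of \<open>G\<close> containing the center correspond to additive
  subgroups \<open>U\<close> of \<open>V\<close>, and \<open>U\<close> has measure proportional to \<open>|U| |U\<^sup>\<bottom>|\<close>. The \<open>q + 1\<close> atoms are the
  subspaces \<open>\<ell> \<otimes> F\<^sup>r\<close> for the lines \<open>\<ell>\<close> of \<open>F\<^sup>2\<close>; the orthogonal space of \<open>\<ell> \<otimes> F\<^sup>r\<close> is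
  \<open>\<ell>\<^sup>\<bottom> \<otimes> F\<^sup>r\<close>, so the abelian atoms correspond to the \<open>S\<close>-isotropic lines. For odd \<open>p\<close> the form \<open>S\<close> is
  hyperbolic, with two isotropic lines; for \<open>p = 2\<close> it is chosen to have just one.

  That \<open>|U| |U\<^sup>\<bottom>| \<le> |V|\<close>, with equality only for \<open>0\<close>, \<open>V\<close> and the subspaces above, is seen by the rank of
  the elements of \<open>V\<close>, viewed as \<open>2 \<times> r\<close> matrices. An element of rank 2 is orthogonal to only \<open>q ^ 3\<close>
  elements, which together with \<open>r \<ge> 3\<close> settles the case that both \<open>U\<close> and \<open>U\<^sup>\<bottom>\<close> contain one. Otherwise
  one of them consists of elements of rank at most 1, and so lies in \<open>\<ell> \<otimes> F\<^sup>r\<close> or in \<open>F\<^sup>2 \<otimes> \<langle>u\<rangle>\<close>.\<close>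

text \<open>The commutator form takes values in the exterior square of \<open>F\<^sup>r\<close>,
  which has dimension greater than one, and \<open>U\<close> ranges over all additive subgroups, not
  only over \<open>F\<close>-subspaces. So no dimension formula relates the orders of
  \<open>U\<close> and \<open>U\<^sup>\<bottom>\<close>, and the bound has to be read off from the
  shape of the elements of \<open>U\<close>. Once the extremal subgroups are known, (P2) and (P3)
  are formal: they use only that the atoms correspond to pairwise complementary subgroups of
  \<open>V\<close> of order \<open>p ^ n\<close>.

  The extension is given by a bilinear cocycle that is not alternating, so no division by 2 occurs
  and both parities of \<open>p\<close> are treated at once.

  The field of order \<open>q\<close> arises as a subset of the carrier of an algebraic closure,
  whereas the polynomial identities are computed with the operations of a type class. Embedding the
  field into a ring of that class reconciles the two, at the price of a unit \<open>e\<close> that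
  differs from \<open>1\<close>.\<close>

section \<open>Commutative rings inside a type class\<close>

text \<open>The product of all commutative rings whose carrier is a set of elements of \<open>'a\<close>. The integer
  component only serves to make \<open>0 \<noteq> 1\<close> obvious.\<close>

typedef 'a cring_prod =
  "{(n :: int, f :: 'a ring \<Rightarrow> 'a). \<forall>R. if cring R then f R \<in> carrier R else f R = undefined}"
proof -
  have "(0, \<lambda>R. if cring R then \<zero>\<^bsub>R\<^esub> else undefined) \<in>
    {(n :: int, f :: 'a ring \<Rightarrow> 'a). \<forall>R. if cring R then f R \<in> carrier R else f R = undefined}"
    by (auto intro: cring.cring_simprules(2))
  then show ?thesis by (rule exI)
qed

setup_lifting type_definition_cring_prod

instantiation cring_prod :: (type) comm_ring_1
begin

lift_definition zero_cring_prod :: "'a cring_prod"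
  is "(0, \<lambda>R. if cring R then \<zero>\<^bsub>R\<^esub> else undefined)"
  by (auto intro: cring.cring_simprules(2))

lift_definition one_cring_prod :: "'a cring_prod"
  is "(1, \<lambda>R. if cring R then \<one>\<^bsub>R\<^esub> else undefined)"
  by (auto intro: cring.cring_simprules(6))

lift_definition plus_cring_prod :: "'a cring_prod \<Rightarrow> 'a cring_prod \<Rightarrow> 'a cring_prod"
  is "\<lambda>(m, f) (n, g). (m + n, \<lambda>R. if cring R then f R \<oplus>\<^bsub>R\<^esub> g R else undefined)"
  by (auto split: prod.splits if_splits intro!: cring.cring_simprules(1))

lift_definition times_cring_prod :: "'a cring_prod \<Rightarrow> 'a cring_prod \<Rightarrow> 'a cring_prod"
  is "\<lambda>(m, f) (n, g). (m * n, \<lambda>R. if cring R then f R \<otimes>\<^bsub>R\<^esub> g R else undefined)"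
  by (auto split: prod.splits if_splits intro!: cring.cring_simprules(5))

lift_definition uminus_cring_prod :: "'a cring_prod \<Rightarrow> 'a cring_prod"
  is "\<lambda>(m, f). (- m, \<lambda>R. if cring R then \<ominus>\<^bsub>R\<^esub> f R else undefined)"
  by (auto split: prod.splits if_splits intro!: cring.cring_simprules(3))

definition minus_cring_prod :: "'a cring_prod \<Rightarrow> 'a cring_prod \<Rightarrow> 'a cring_prod"
  where "minus_cring_prod x y = x + (- y)"

instance
proof
  fix a b c :: "'a cring_prod"
  show "a + b + c = a + (b + c)"
    by transfer (clarsimp simp: fun_eq_iff, metis cring.cring_simprules(7))
  show "a * b * c = a * (b * c)"
    by transfer (clarsimp simp: fun_eq_iff mult.assoc, metis cring.cring_simprules(11))
  show "(a + b) * c = a * c + b * c"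
    by transfer (clarsimp simp: fun_eq_iff distrib_right, metis cring.cring_simprules(13))
  show "a + b = b + a"
    by transfer (clarsimp simp: fun_eq_iff, metis cring.cring_simprules(10))
  show "a * b = b * a"
    by transfer (clarsimp simp: fun_eq_iff, metis cring.cring_simprules(14))
  show "0 + a = a"
    by transfer (clarsimp simp: fun_eq_iff, metis cring.cring_simprules(8))
  show "1 * a = a"
    by transfer (clarsimp simp: fun_eq_iff, metis cring.cring_simprules(12))
  show "- a + a = 0"
    by transfer (clarsimp simp: fun_eq_iff, metis cring.cring_simprules(9))
  show "a - b = a + - b"
    by (rule minus_cring_prod_def)
  show "(0 :: 'a cring_prod) \<noteq> 1"
    by transfer simp
qed

end

text \<open>The summand inclusion of a commutative ring \<open>R\<close>; it preserves sums and products, but sends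
  \<open>\<one>\<^bsub>R\<^esub>\<close> to an idempotent.\<close>

lift_definition cring_incl :: "'a ring \<Rightarrow> 'a \<Rightarrow> 'a cring_prod"
  is "\<lambda>R x. (0, \<lambda>S. if cring S then if S = R \<and> x \<in> carrier S then x else \<zero>\<^bsub>S\<^esub> else undefined)"
  by (auto intro: cring.cring_simprules(2))

context
  fixes R :: "'a ring" (structure)
  assumes R: "cring R"
begin

interpretation cring R by (rule R)

lemma cring_incl_add:
  "x \<in> carrier R \<Longrightarrow> y \<in> carrier R \<Longrightarrow> cring_incl R (x \<oplus> y) = cring_incl R x + cring_incl R y"
  by transfer (auto simp: fun_eq_iff R cring.cring_simprules)

lemma cring_incl_mult:
  "x \<in> carrier R \<Longrightarrow> y \<in> carrier R \<Longrightarrow> cring_incl R (x \<otimes> y) = cring_incl R x * cring_incl R y"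
  by transfer (auto simp: fun_eq_iff R cring.cring_simprules)

lemma cring_incl_zero: "cring_incl R \<zero> = 0"
  by transfer (auto simp: fun_eq_iff R cring.cring_simprules)

lemma inj_on_cring_incl: "inj_on (cring_incl R) (carrier R)"
proof (rule inj_onI)
  fix x y
  assume "x \<in> carrier R" "y \<in> carrier R" "cring_incl R x = cring_incl R y"
  then have "snd (Rep_cring_prod (cring_incl R x)) R = snd (Rep_cring_prod (cring_incl R y)) R"
    by simp
  then show "x = y"
    using R \<open>x \<in> carrier R\<close> \<open>y \<in> carrier R\<close> by (simp add: cring_incl.rep_eq)
qed

lemma cring_incl_minus:
  assumes "x \<in> carrier R"
  shows "cring_incl R (\<ominus> x) = - cring_incl R x"
proof -
  have "cring_incl R (\<ominus> x) + cring_incl R x = 0"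
    using assms cring_incl_add[of "\<ominus> x" x] by (simp add: cring_incl_zero l_neg)
  then show ?thesis by (simp add: eq_neg_iff_add_eq_0)
qed

text \<open>Exponent zero is excluded because the inclusion does not send the unit of
  \<open>R\<close> to \<open>1\<close>.\<close>

lemma cring_incl_pow:
  "x \<in> carrier R \<Longrightarrow> cring_incl R (x [^] Suc n) = cring_incl R x ^ Suc n"
  by (induction n) (simp_all add: cring_incl_mult mult.commute)

lemma cring_incl_nat_mult:
  "x \<in> carrier R \<Longrightarrow> cring_incl R (add_pow R n x) = of_nat n * cring_incl R x"
  by (induction n) (simp_all add: cring_incl_add cring_incl_zero algebra_simps)

end

section \<open>Powers of sums in characteristic p\<close>

lemma freshmans_dream_mult:
  fixes x y :: "'a :: comm_ring_1"
  assumes "Factorial_Ring.prime p" "of_nat p * x = 0"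
  shows "(x + y) ^ p = x ^ p + y ^ p"
proof -
  have p: "p > 0" using assms(1) by (simp add: prime_gt_0_nat)
  have "(x + y) ^ p = (\<Sum>k\<le>p. of_nat (p choose k) * x ^ k * y ^ (p - k))"
    by (rule binomial_ring)
  also have "\<dots> = (\<Sum>k\<in>{0, p}. of_nat (p choose k) * x ^ k * y ^ (p - k))"
  proof (rule sum.mono_neutral_right)
    show "\<forall>k\<in>{..p} - {0, p}. of_nat (p choose k) * x ^ k * y ^ (p - k) = 0"
    proof
      fix k assume k: "k \<in> {..p} - {0, p}"
      then have "p dvd (p choose k)"
        using assms(1) by (intro dvd_choose_prime) auto
      then obtain m where m: "p choose k = p * m" by (elim dvdE)
      from k obtain j where j: "k = Suc j" by (cases k) auto
      have "of_nat (p choose k) * x ^ k * y ^ (p - k) =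
          (of_nat p * x) * (of_nat m * x ^ j * y ^ (p - k))"
        unfolding m by (simp add: j mult_ac)
      then show "of_nat (p choose k) * x ^ k * y ^ (p - k) = 0"
        using assms(2) by simp
    qed
  qed auto
  also have "\<dots> = x ^ p + y ^ p" using p by simp
  finally show ?thesis .
qed

text \<open>Only \<open>x\<close> is required to be annihilated by \<open>p\<close>: the ambient
  ring has an integer component, hence characteristic zero, and every mixed binomial term contains
  the factor \<open>of_nat p * x\<close>.\<close>

lemma freshmans_dream_mult_pow:
  fixes x y :: "'a :: comm_ring_1"
  assumes "Factorial_Ring.prime p" "of_nat p * x = 0"
  shows "(x + y) ^ (p ^ a) = x ^ (p ^ a) + y ^ (p ^ a)"
proof (induction a)
  case (Suc a)
  have "x ^ p ^ a = x * x ^ (p ^ a - 1)"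
    using assms(1) by (metis power_minus_mult mult.commute prime_gt_0_nat zero_less_power)
  then have "of_nat p * x ^ p ^ a = 0"
    using assms(2) by (metis mult.assoc mult_zero_left)
  have "(x + y) ^ (p ^ Suc a) = ((x + y) ^ p ^ a) ^ p"
    by (simp add: power_mult mult.commute flip: power_mult)
  also have "\<dots> = (x ^ p ^ a + y ^ p ^ a) ^ p" by (simp add: Suc)
  also have "\<dots> = (x ^ p ^ a) ^ p + (y ^ p ^ a) ^ p"
    by (rule freshmans_dream_mult) fact+
  finally show ?case
    by (simp add: power_mult mult.commute flip: power_mult)
qed simp

lemma cring_freshmans_dream:
  fixes R :: "'a ring" (structure) and p a :: nat
  assumes "cring R" "Factorial_Ring.prime p" "add_pow R p x = \<zero>" "x \<in> carrier R" "y \<in> carrier R"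
  shows "(x \<oplus> y) [^] (p ^ a) = x [^] (p ^ a) \<oplus> y [^] (p ^ a)"
proof -
  interpret cring R by fact
  \<comment> \<open>\<open>cring_incl_pow\<close> needs a positive exponent.\<close>
  obtain q :: nat where q: "p ^ a = Suc q"
    using assms(2) by (metis not0_implies_Suc power_not_zero not_prime_0)
  have "of_nat p * cring_incl R x = 0"
    using assms by (simp flip: cring_incl_nat_mult add: cring_incl_zero)
  from freshmans_dream_mult_pow[OF assms(2) this, of "cring_incl R y" a]
  have "cring_incl R ((x \<oplus> y) [^] (p ^ a)) = cring_incl R (x [^] (p ^ a) \<oplus> y [^] (p ^ a))"
    using assms by (simp add: q cring_incl_pow cring_incl_add del: power_Suc nat_pow_Suc monoid.nat_pow_Suc Group.nat_pow_Suc)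
  then show ?thesis
    using inj_on_cring_incl[OF assms(1)] assms(4,5) by (auto simp: inj_on_def)
qed

section \<open>Finite fields\<close>

lemma (in ring_hom_ring) hom_add_pow:
  "x \<in> carrier R \<Longrightarrow> h (add_pow R k x) = add_pow S k (h x)" for k :: nat
  by (induction k) simp_all

context algebraically_closed
begin

text \<open>If \<open>\<alpha>\<close> were a multiple root of \<open>X ^ q - X = (X - \<alpha>) ^ q - (X - \<alpha>)\<close>, then
  \<open>(X - \<alpha>) ^ 2\<close> would divide \<open>X - \<alpha>\<close>.\<close>

lemma card_frobenius_fixed:
  assumes p: "Factorial_Ring.prime p" "add_pow L p \<one> = \<zero>" and "a > 0"
  shows "card {x \<in> carrier L. x [^] (p ^ a) = x} = p ^ a"
proof -
  define q where "q = p ^ a"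
  have q2: "q \<ge> 2"
    using prime_ge_2_nat[OF p(1)] \<open>a > 0\<close> self_le_power[of p a] unfolding q_def by linarith
  let ?U = "poly_ring L"
  interpret U: domain ?U
    by (rule univ_poly_is_domain[OF carrier_is_subring])
  define F where "F = X\<^bsub>L\<^esub> [^]\<^bsub>?U\<^esub> q \<ominus>\<^bsub>?U\<^esub> X\<^bsub>L\<^esub>"
  have X: "X\<^bsub>L\<^esub> \<in> carrier ?U"
    by (rule var_closed(1)[OF carrier_is_subring])
  have F: "F \<in> carrier ?U"
    unfolding F_def using X by simp
  have degF: "degree F = q"
  proof -
    have dX: "degree (X\<^bsub>L\<^esub> [^]\<^bsub>?U\<^esub> q) = q"
      using polynomial_pow_degree[OF X] by (simp add: var_def)
    have dX': "degree (\<ominus>\<^bsub>?U\<^esub> X\<^bsub>L\<^esub>) = 1"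
      using univ_poly_a_inv_degree[OF carrier_is_subring X] by (simp add: var_def)
    have "polynomial (carrier L) (X\<^bsub>L\<^esub> [^]\<^bsub>?U\<^esub> q)" "polynomial (carrier L) (\<ominus>\<^bsub>?U\<^esub> X\<^bsub>L\<^esub>)"
      using X by (auto simp: univ_poly_carrier)
    then show ?thesis
      unfolding F_def a_minus_def univ_poly_add
      using poly_add_degree_eq[OF carrier_is_subring] dX dX' q2 by simp
  qed
  have F0: "F \<noteq> []" using degF q2 by auto
  have ev: "eval F x = x [^] q \<ominus> x" if x: "x \<in> carrier L" for x
  proof -
    interpret E: ring_hom_cring ?U L "\<lambda>f. eval f x"
      using eval_cring_hom[OF carrier_is_subring x] .
    show ?thesis unfolding F_def a_minus_def
      using X x by (simp add: eval_var)
  qed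
  have root: "is_root F x \<longleftrightarrow> x \<in> carrier L \<and> x [^] q = x" for x
    using ev F0 unfolding is_root_def by auto
  have "count (roots F) x \<le> 1" for x
  proof (rule ccontr)
    assume "\<not> ?thesis"
    then have c: "count (roots F) x \<ge> 2" by simp
    then have "x \<in># roots F" by (metis count_eq_zero_iff not_numeral_le_zero)
    then have x: "x \<in> carrier L" "x [^] q = x"
      using root roots_mem_iff_is_root[OF F] by auto
    let ?D = "[\<one>, \<ominus> x]" and ?c = "poly_of_const x"
    have D: "?D \<in> carrier ?U"
      using x by (auto simp: univ_poly_def polynomial_def)
    interpret H: ring_hom_ring L ?U poly_of_const
      using canonical_embedding_ring_hom[OF carrier_is_subring] by simp
    have c': "?c \<in> carrier ?U" "?c [^]\<^bsub>?U\<^esub> q = ?c"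
      using x by (simp_all flip: H.hom_nat_pow)
    have XD: "X\<^bsub>L\<^esub> = ?D \<oplus>\<^bsub>?U\<^esub> ?c"
      using x by (auto simp: univ_poly_add var_def poly_of_const_def l_neg)
    have ch: "add_pow ?U p ?D = \<zero>\<^bsub>?U\<^esub>"
    proof -
      have "add_pow ?U p \<one>\<^bsub>?U\<^esub> = \<zero>\<^bsub>?U\<^esub>"
        using H.hom_add_pow[of \<one> p] p(2) H.hom_zero H.hom_one by simp
      moreover have "add_pow ?U p ?D = add_pow ?U p \<one>\<^bsub>?U\<^esub> \<otimes>\<^bsub>?U\<^esub> ?D"
        using D by (simp add: U.add_pow_ldistr)
      ultimately show ?thesis using D by simp
    qed
    have "X\<^bsub>L\<^esub> [^]\<^bsub>?U\<^esub> q = ?D [^]\<^bsub>?U\<^esub> q \<oplus>\<^bsub>?U\<^esub> ?c"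
      unfolding XD q_def using cring_freshmans_dream[OF U.is_cring p(1) ch D c'(1)] c'(2)
      by (simp add: q_def)
    then have F_eq: "F = ?D [^]\<^bsub>?U\<^esub> q \<ominus>\<^bsub>?U\<^esub> ?D"
      unfolding F_def using D c' unfolding XD
      by (simp add: a_minus_def U.minus_add U.a_ac U.r_neg1 U.r_neg2)
    let ?E = "?D [^]\<^bsub>?U\<^esub> (2::nat)"
    have E: "?E \<in> carrier ?U" using D by simp
    have "?E pdivides F"
      using le_alg_mult_imp_pdivides[OF x(1) F, of 2] c alg_mult_eq_count_roots[OF F] by simp
    then obtain g where g: "g \<in> carrier ?U" "F = ?E \<otimes>\<^bsub>?U\<^esub> g"
      unfolding pdivides_def factor_def by blast
    \<comment> \<open>Since \<open>q \<ge> 2\<close>, the square of \<open>?D\<close> splits off its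
      \<open>q\<close>-th power. Then \<open>?D\<close>, being the difference of that power and
      \<open>F\<close>, inherits the factor \<open>?E\<close>.\<close>
    define h where "h = ?D [^]\<^bsub>?U\<^esub> (q - 2)"
    have h: "h \<in> carrier ?U" "?D [^]\<^bsub>?U\<^esub> q = ?E \<otimes>\<^bsub>?U\<^esub> h"
      using U.nat_pow_mult[OF D, of 2 "q - 2"] q2 D unfolding h_def
      by (simp, metis le_add_diff_inverse)
    have "?D = ?D [^]\<^bsub>?U\<^esub> q \<ominus>\<^bsub>?U\<^esub> F"
      unfolding F_eq using D U.r_neg2[of "?D [^]\<^bsub>?U\<^esub> q" ?D]
      by (simp add: a_minus_def U.minus_add)
    also have "\<dots> = ?E \<otimes>\<^bsub>?U\<^esub> (h \<ominus>\<^bsub>?U\<^esub> g)"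
      using E g h by (simp add: a_minus_def U.r_distr U.r_minus)
    finally have "?E pdivides ?D"
      unfolding pdivides_def using g h by (metis dividesI U.minus_closed)
    then have "degree ?E \<le> degree ?D"
      using pdivides_imp_degree_le[OF carrier_is_subring E D] by simp
    moreover have "degree ?E = 2"
      using polynomial_pow_degree[OF D, of 2] by simp
    ultimately show False by simp
  qed
  then have cnt: "count (roots F) x = (if x \<in># roots F then 1 else 0)" for x
    by (metis One_nat_def count_eq_zero_iff le_SucE le_zero_eq)
  \<comment> \<open>Over an algebraically closed field \<open>F\<close> splits, so its degree counts
    the roots with multiplicity; multiplicity one turns this into a cardinality.\<close>
  have "q = size (roots F)"
    using roots_over_carrier[OF F] degF by (simp add: splitted_def)
  also have "\<dots> = card (set_mset (roots F))"
    unfolding size_multiset_overloaded_eq using cnt by simp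
  also have "set_mset (roots F) = {x \<in> carrier L. x [^] q = x}"
    using root roots_mem_iff_is_root[OF F] by auto
  finally show ?thesis by (simp add: q_def)
qed

end

text \<open>The algebraic closure of the prime field. The type of \<open>L\<close> is the one on
  which the closure of a field with integer elements is built.\<close>

lemma exists_algebraically_closed_char:
  assumes "Factorial_Ring.prime (p :: nat)"
  obtains L :: "((int list \<times> nat) multiset \<Rightarrow> int) ring"
    where "algebraically_closed L" "add_pow L p \<one>\<^bsub>L\<^esub> = \<zero>\<^bsub>L\<^esub>"
proof -
  define R where "R = residue_ring (int p)"
  interpret R: residues_prime p R
    using assms by unfold_locales (simp_all add: R_def)
  interpret R: field R by (rule R.is_field)
  define L where "L = R.alg_closure"
  have L: "algebraic_closure L (R.indexed_const ` carrier R)"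
    and h: "R.indexed_const \<in> ring_hom R L"
    unfolding L_def by (rule R.alg_closureE)+
  interpret L: algebraic_closure L "R.indexed_const ` carrier R" by (rule L)
  interpret h: ring_hom_ring R L R.indexed_const
    by (rule ring_hom_ringI2[OF R.ring_axioms L.ring_axioms h])
  have "add_pow R k \<one>\<^bsub>R\<^esub> = int k mod int p" for k :: nat
    by (induction k) (simp_all add: R.res_add_eq R.res_one_eq R.res_zero_eq mod_simps add.commute)
  then have "add_pow R p \<one>\<^bsub>R\<^esub> = \<zero>\<^bsub>R\<^esub>" by (simp add: R.res_zero_eq)
  then have "add_pow L p \<one>\<^bsub>L\<^esub> = \<zero>\<^bsub>L\<^esub>"
    using h.hom_add_pow[of "\<one>\<^bsub>R\<^esub>" p] h.hom_zero h.hom_one by simp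
  with that L.algebraically_closed_axioms show thesis by blast
qed

text \<open>A field of order \<open>q\<close> realised as a subset \<open>F\<close> of a larger commutative ring whose unit
  element \<open>e\<close> need not be the unit of that ring.\<close>

locale finite_subfield =
  fixes F :: "'k :: comm_ring_1 set" and e :: 'k and p a :: nat
  assumes prime_p: "Factorial_Ring.prime p" and a_pos: "a > 0"
    and card_F: "card F = p ^ a"
    and zero_F: "0 \<in> F" and e_F: "e \<in> F"
    and add_F: "x \<in> F \<Longrightarrow> y \<in> F \<Longrightarrow> x + y \<in> F"
    and uminus_F: "x \<in> F \<Longrightarrow> - x \<in> F"
    and mult_F: "x \<in> F \<Longrightarrow> y \<in> F \<Longrightarrow> x * y \<in> F"
    and e_mult: "x \<in> F \<Longrightarrow> e * x = x"
    and inverse_F: "x \<in> F \<Longrightarrow> x \<noteq> 0 \<Longrightarrow> \<exists>y\<in>F. x * y = e"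
    and char_F: "x \<in> F \<Longrightarrow> of_nat p * x = 0"

text \<open>The field of order \<open>q\<close> is the set of fixed points of
  \<open>x \<mapsto> x ^ q\<close> in an algebraic closure. Its image under
  \<open>cring_incl\<close> has the idempotent image of the unit as \<open>e\<close>.\<close>

lemma exists_finite_subfield:
  assumes p: "Factorial_Ring.prime p" and "a > 0"
  shows "\<exists>F (e :: ((int list \<times> nat) multiset \<Rightarrow> int) cring_prod). finite_subfield F e p a"
proof -
  obtain L :: "((int list \<times> nat) multiset \<Rightarrow> int) ring"
    where L: "algebraically_closed L" and ch: "add_pow L p \<one>\<^bsub>L\<^esub> = \<zero>\<^bsub>L\<^esub>"
    using exists_algebraically_closed_char[OF p] .
  interpret L: algebraically_closed L by (rule L)
  define q where "q = p ^ a"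
  have q: "q > 0" using p by (simp add: q_def prime_gt_0_nat)
  define K where "K = {x \<in> carrier L. x [^]\<^bsub>L\<^esub> q = x}"
  note incl = cring_incl_add[OF L.is_cring] cring_incl_mult[OF L.is_cring]
    cring_incl_minus[OF L.is_cring] cring_incl_zero[OF L.is_cring]
  have chx: "add_pow L p x = \<zero>\<^bsub>L\<^esub>" if "x \<in> carrier L" for x
    using L.add_pow_ldistr[of "\<one>\<^bsub>L\<^esub>" x p] ch that by simp
  have K0: "\<zero>\<^bsub>L\<^esub> \<in> K" "\<one>\<^bsub>L\<^esub> \<in> K"
    using q by (auto simp: K_def L.nat_pow_zero)
  have Kadd: "x \<oplus>\<^bsub>L\<^esub> y \<in> K" if "x \<in> K" "y \<in> K" for x y
    using that cring_freshmans_dream[OF L.is_cring p chx] by (auto simp: K_def q_def)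
  have Kmult: "x \<otimes>\<^bsub>L\<^esub> y \<in> K" if "x \<in> K" "y \<in> K" for x y
    using that by (auto simp: K_def L.nat_pow_distrib)
  have Kneg: "\<ominus>\<^bsub>L\<^esub> x \<in> K" if "x \<in> K" for x
  proof -
    have x: "x \<in> carrier L" "x [^]\<^bsub>L\<^esub> q = x" using that by (auto simp: K_def)
    \<comment> \<open>Additivity of the Frobenius map on \<open>x\<close> and its negative avoids a
      case distinction on the parity of \<open>q\<close>.\<close>
    have "\<zero>\<^bsub>L\<^esub> = (x \<oplus>\<^bsub>L\<^esub> \<ominus>\<^bsub>L\<^esub> x) [^]\<^bsub>L\<^esub> q"
      using x q by (simp add: L.r_neg L.nat_pow_zero)
    also have "\<dots> = x \<oplus>\<^bsub>L\<^esub> (\<ominus>\<^bsub>L\<^esub> x) [^]\<^bsub>L\<^esub> q"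
      using cring_freshmans_dream[OF L.is_cring p chx[OF x(1)] x(1), of "\<ominus>\<^bsub>L\<^esub> x" a] x by (simp add: q_def)
    finally have "(\<ominus>\<^bsub>L\<^esub> x) [^]\<^bsub>L\<^esub> q = \<ominus>\<^bsub>L\<^esub> x"
      using x by (metis L.a_inv_closed L.minus_equality L.nat_pow_closed L.a_comm)
    then show ?thesis using x by (simp add: K_def)
  qed
  have Kinv: "\<exists>y\<in>K. x \<otimes>\<^bsub>L\<^esub> y = \<one>\<^bsub>L\<^esub>" if "x \<in> K" "x \<noteq> \<zero>\<^bsub>L\<^esub>" for x
  proof -
    have x: "x \<in> carrier L" "x [^]\<^bsub>L\<^esub> q = x" "x \<in> Units L"
      using that by (auto simp: K_def L.field_Units)
    then have i: "inv\<^bsub>L\<^esub> x \<in> carrier L" "x \<otimes>\<^bsub>L\<^esub> inv\<^bsub>L\<^esub> x = \<one>\<^bsub>L\<^esub>" by auto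
    have "x \<otimes>\<^bsub>L\<^esub> (inv\<^bsub>L\<^esub> x) [^]\<^bsub>L\<^esub> q = \<one>\<^bsub>L\<^esub>"
      using L.nat_pow_distrib[OF x(1) i(1), of q] x i by simp
    then have "(inv\<^bsub>L\<^esub> x) [^]\<^bsub>L\<^esub> q = inv\<^bsub>L\<^esub> x"
      using x i by (metis L.comm_inv_char L.nat_pow_closed)
    then show ?thesis using i by (auto simp: K_def)
  qed
  have carr: "x \<in> carrier L" if "x \<in> K" for x using that by (simp add: K_def)
  have inj: "inj_on (cring_incl L) K"
    using inj_on_cring_incl[OF L.is_cring] by (rule inj_on_subset) (auto simp: K_def)
  have "finite_subfield (cring_incl L ` K) (cring_incl L \<one>\<^bsub>L\<^esub>) p a"
  proof
    show "card (cring_incl L ` K) = p ^ a"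
      using card_image[OF inj] L.card_frobenius_fixed[OF p ch \<open>a > 0\<close>] by (simp add: K_def q_def)
    show "0 \<in> cring_incl L ` K"
      using K0 incl(4) by (metis imageI)
    show "cring_incl L \<one>\<^bsub>L\<^esub> \<in> cring_incl L ` K" using K0 by simp
  next
    fix x assume "x \<in> cring_incl L ` K"
    then obtain u where u: "x = cring_incl L u" "u \<in> K" by auto
    show "- x \<in> cring_incl L ` K"
      using u Kneg carr by (auto simp flip: incl(3))
    show "cring_incl L \<one>\<^bsub>L\<^esub> * x = x"
      using u carr incl(2)[of "\<one>\<^bsub>L\<^esub>" u] by simp
    show "of_nat p * x = 0"
      using u carr[of u] chx[of u] cring_incl_nat_mult[OF L.is_cring, of u p] incl(4) by simp
    show "\<exists>y\<in>cring_incl L ` K. x * y = cring_incl L \<one>\<^bsub>L\<^esub>" if "x \<noteq> 0"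
    proof -
      have "u \<noteq> \<zero>\<^bsub>L\<^esub>" using that u incl(4) by auto
      from Kinv[OF u(2) this] obtain v where "v \<in> K" "u \<otimes>\<^bsub>L\<^esub> v = \<one>\<^bsub>L\<^esub>" by auto
      then show ?thesis using u carr incl(2)[of u v] by (metis imageI)
    qed
    fix y assume "y \<in> cring_incl L ` K"
    then obtain v where v: "y = cring_incl L v" "v \<in> K" by auto
    show "x + y \<in> cring_incl L ` K"
      using u v Kadd[of u v] carr incl(1)[of u v] by (metis imageI)
    show "x * y \<in> cring_incl L ` K"
      using u v Kmult[of u v] carr incl(2)[of u v] by (metis imageI)
  qed (use assms in auto)
  then show ?thesis by blast
qed

section \<open>Additive subgroups and bases\<close>

definition add_subgroup :: "'v :: ab_group_add set \<Rightarrow> bool"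
  where "add_subgroup U \<longleftrightarrow> 0 \<in> U \<and> (\<forall>x\<in>U. \<forall>y\<in>U. x + y \<in> U) \<and> (\<forall>x\<in>U. - x \<in> U)"

lemma add_subgroupD:
  assumes "add_subgroup U"
  shows "0 \<in> U" "x \<in> U \<Longrightarrow> y \<in> U \<Longrightarrow> x + y \<in> U" "x \<in> U \<Longrightarrow> - x \<in> U"
    "x \<in> U \<Longrightarrow> y \<in> U \<Longrightarrow> x - y \<in> U"
  using assms unfolding add_subgroup_def by (auto simp: diff_conv_add_uminus simp del: add_uminus_conv_diff)

lemma add_subgroup_sum:
  assumes "add_subgroup U" "\<And>i. i \<in> I \<Longrightarrow> f i \<in> U"
  shows "sum f I \<in> U"
  using assms(2) by (induction I rule: infinite_finite_induct) (auto intro: add_subgroupD[OF assms(1)])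

lemma add_subgroup_of_nat:
  fixes x :: "'v :: comm_ring_1"
  assumes "add_subgroup U" "x \<in> U"
  shows "of_nat k * x \<in> U"
  by (induction k) (auto simp: algebra_simps intro: add_subgroupD[OF assms(1)] assms(2))

lemma add_subgroup_of_int:
  fixes x :: "'v :: comm_ring_1"
  assumes "add_subgroup U" "x \<in> U"
  shows "of_int k * x \<in> U"
  using add_subgroup_of_nat[OF assms] add_subgroupD(3)[OF assms(1)]
  by (cases k rule: int_cases2) auto

text \<open>Vectors are functions with pointwise ring operations, so \<open>of_int\<close> acts as
  scalar multiplication; on families annihilated by \<open>p\<close> this is the span over the prime
  field. Unreduced integer coefficients match the integer exponents of powers in the group.\<close>

definition int_span :: "'i set \<Rightarrow> ('i \<Rightarrow> 'v :: comm_ring_1) \<Rightarrow> 'v set"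
  where "int_span I v = range (\<lambda>c. \<Sum>i\<in>I. of_int (c i) * v i)"

lemma int_spanI: "x = (\<Sum>i\<in>I. of_int (c i) * v i) \<Longrightarrow> x \<in> int_span I v"
  unfolding int_span_def by blast

lemma add_subgroup_int_span: "add_subgroup (int_span I v)"
  unfolding add_subgroup_def
proof (intro conjI ballI)
  show "0 \<in> int_span I v" by (rule int_spanI[where c = "\<lambda>_. 0"]) simp
next
  fix x y assume "x \<in> int_span I v" "y \<in> int_span I v"
  then obtain c d where "x = (\<Sum>i\<in>I. of_int (c i) * v i)" "y = (\<Sum>i\<in>I. of_int (d i) * v i)"
    unfolding int_span_def by auto
  then show "x + y \<in> int_span I v"
    by (intro int_spanI[where c = "\<lambda>i. c i + d i"]) (simp add: sum.distrib distrib_right)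
next
  fix x assume "x \<in> int_span I v"
  then obtain c where "x = (\<Sum>i\<in>I. of_int (c i) * v i)"
    unfolding int_span_def by auto
  then show "- x \<in> int_span I v"
    by (intro int_spanI[where c = "\<lambda>i. - c i"]) (simp add: sum_negf)
qed

lemma int_span_incl:
  assumes "finite I" "i \<in> I"
  shows "v i \<in> int_span I v"
  by (rule int_spanI[where c = "\<lambda>j. if j = i then 1 else 0"])
    (use assms in \<open>simp add: if_distrib[of of_int] if_distrib[of "\<lambda>x. x * _"] cong: if_cong\<close>)

lemma int_span_subset:
  assumes "add_subgroup U" "\<And>i. i \<in> I \<Longrightarrow> v i \<in> U"
  shows "int_span I v \<subseteq> U"
  unfolding int_span_def
  by (auto intro!: add_subgroup_sum add_subgroup_of_int assms)

lemma of_int_mod_mult: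
  fixes v :: "'v :: comm_ring_1"
  assumes "of_nat p * v = 0"
  shows "of_int (c mod int p) * v = of_int c * v"
proof -
  have "of_int c * v = of_int (c mod int p + int p * (c div int p)) * v" by (simp only: mod_mult_div_eq)
  also have "\<dots> = of_int (c mod int p) * v + of_int (c div int p) * (of_nat p * v)"
    unfolding of_int_add of_int_mult by (simp only: algebra_simps of_int_of_nat_eq)
  finally show ?thesis using assms by simp
qed

text \<open>A generating family of the right size is a basis: the \<open>p ^ card I\<close> reduced
  coefficient families map onto a set with as many elements, so this map is injective.\<close>

lemma int_span_independent:
  fixes v :: "'i \<Rightarrow> 'v :: comm_ring_1"
  assumes "finite I" "p > 0" and char: "\<And>i. i \<in> I \<Longrightarrow> of_nat p * v i = 0"
    and card: "card (int_span I v) = p ^ card I"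
    and zero: "(\<Sum>i\<in>I. of_int (c i) * v i) = 0" and "i \<in> I"
  shows "int p dvd c i"
proof -
  define P where "P = PiE I (\<lambda>_. {0..<int p})"
  define comb where "comb = (\<lambda>c. \<Sum>i\<in>I. of_int (c i) * v i)"
  have comb_mod: "comb (restrict (\<lambda>i. c i mod int p) I) = comb c" for c
    unfolding comb_def using char by (intro sum.cong) (simp_all add: of_int_mod_mult)
  have mem: "restrict (\<lambda>i. c i mod int p) I \<in> P" for c
    using \<open>p > 0\<close> by (auto simp: P_def)
  have "int_span I v = range comb"
    by (simp add: int_span_def comb_def)
  also have "\<dots> = comb ` P"
  proof (intro subset_antisym subsetI)
    fix x assume "x \<in> range comb"
    then obtain c where "x = comb c" by auto
    then have "x = comb (restrict (\<lambda>i. c i mod int p) I)" by (simp only: comb_mod)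
    then show "x \<in> comb ` P" using mem by (rule image_eqI)
  qed auto
  finally have "int_span I v = comb ` P" .
  moreover have "finite P" "card P = p ^ card I"
    unfolding P_def using assms(1) by (auto intro: finite_PiE simp: card_PiE)
  ultimately have inj: "inj_on comb P"
    using card by (intro eq_card_imp_inj_on) auto
  \<comment> \<open>The zero family is written as a reduction so that \<open>comb_mod\<close> and
    \<open>mem\<close> apply to both sides.\<close>
  have "comb (restrict (\<lambda>i. c i mod int p) I) = comb (restrict (\<lambda>i. 0 mod int p) I)"
    using zero unfolding comb_mod by (simp add: comb_def)
  then have "restrict (\<lambda>i. c i mod int p) I = restrict (\<lambda>i. 0 mod int p) I"
    by (rule inj_onD[OF inj _ mem mem])
  from fun_cong[OF this, of i] show ?thesis
    using \<open>i \<in> I\<close> by (simp add: mod_eq_0_iff_dvd)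
qed

lemma int_span_coeffs:
  fixes v :: "'i \<Rightarrow> 'v :: comm_ring_1"
  assumes "p > 0" "\<And>i. i \<in> I \<Longrightarrow> of_nat p * v i = 0" "x \<in> int_span I v"
  obtains c where "\<And>i. c i \<in> {0..int p - 1}" "x = (\<Sum>i\<in>I. of_int (c i) * v i)"
proof -
  from assms(3) obtain c where "x = (\<Sum>i\<in>I. of_int (c i) * v i)"
    unfolding int_span_def by auto
  also have "\<dots> = (\<Sum>i\<in>I. of_int (c i mod int p) * v i)"
    by (intro sum.cong refl of_int_mod_mult[symmetric] assms(2))
  finally show thesis using that[of "\<lambda>i. c i mod int p"] \<open>p > 0\<close> by simp
qed

text \<open>Each family is expanded in the other. Substituting one expansion into the other and
  comparing coefficients, which \<open>int_span_independent\<close> permits modulo \<open>p\<close>,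
  shows that the two matrices are mutually inverse.\<close>

lemma int_span_change_of_basis:
  fixes v w :: "nat \<Rightarrow> 'v :: comm_ring_1"
  assumes "Factorial_Ring.prime p"
    and char: "\<And>i. i \<in> {1..n} \<Longrightarrow> of_nat p * v i = 0" "\<And>i. i \<in> {1..n} \<Longrightarrow> of_nat p * w i = 0"
    and span: "int_span {1..n} v = int_span {1..n} w"
    and card: "card (int_span {1..n} v) = p ^ n"
  obtains c where "invertible_matrix (residue_ring (int p)) n c"
    "\<And>i j. c i j \<in> {0..int p - 1}"
    "\<And>j. j \<in> {1..n} \<Longrightarrow> w j = (\<Sum>i\<in>{1..n}. of_int (c i j) * v i)"
proof -
  define I where "I = {1..n}"
  have p: "p > 0" using assms(1) by (simp add: prime_gt_0_nat)
  interpret R: residues_prime p "residue_ring (int p)"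
    using assms(1) by unfold_locales auto
  have "\<exists>c. (\<forall>i. c i \<in> {0..int p - 1}) \<and> w j = (\<Sum>i\<in>I. of_int (c i) * v i)" if "j \<in> I" for j
  proof -
    have "w j \<in> int_span {1..n} v"
      unfolding span by (rule int_span_incl) (use that in \<open>auto simp: I_def\<close>)
    then show ?thesis
      by (rule int_span_coeffs[OF p char(1), rotated]) (auto simp: I_def)
  qed
  then obtain c' where c': "\<And>j i. j \<in> I \<Longrightarrow> c' j i \<in> {0..int p - 1}"
      "\<And>j. j \<in> I \<Longrightarrow> w j = (\<Sum>i\<in>I. of_int (c' j i) * v i)"
    by metis
  \<comment> \<open>Nothing is known about \<open>c'\<close> outside \<open>I\<close>; zero keeps
    every entry reduced.\<close>
  define c where "c = (\<lambda>i j. if j \<in> I then c' j i else 0)"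
  have c: "\<And>j i. c i j \<in> {0..int p - 1}" "\<And>j. j \<in> I \<Longrightarrow> w j = (\<Sum>i\<in>I. of_int (c i j) * v i)"
    using c' p by (auto simp: c_def)
  have "\<exists>c. (\<forall>i. c i \<in> {0..int p - 1}) \<and> v j = (\<Sum>i\<in>I. of_int (c i) * w i)" if "j \<in> I" for j
  proof -
    have "v j \<in> int_span {1..n} w"
      unfolding span[symmetric] by (rule int_span_incl) (use that in \<open>auto simp: I_def\<close>)
    then show ?thesis
      by (rule int_span_coeffs[OF p char(2), rotated]) (auto simp: I_def)
  qed
  then obtain d' where d': "\<And>j i. j \<in> I \<Longrightarrow> d' j i \<in> {0..int p - 1}"
      "\<And>j. j \<in> I \<Longrightarrow> v j = (\<Sum>i\<in>I. of_int (d' j i) * w i)"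
    by metis
  define d where "d = (\<lambda>i j. d' j i)"
  have d: "\<And>j i. j \<in> I \<Longrightarrow> d i j \<in> {0..int p - 1}"
      "\<And>j. j \<in> I \<Longrightarrow> v j = (\<Sum>i\<in>I. of_int (d i j) * w i)"
    using d' by (auto simp: d_def)
  \<comment> \<open>Stated for arbitrary families and matrices, since it serves for both products,
    with the two families exchanged.\<close>
  have key: "(\<Sum>j\<in>I. a i j * b j k) mod int p = (if i = k then 1 else 0)"
    if a: "\<And>j. j \<in> I \<Longrightarrow> y j = (\<Sum>i\<in>I. of_int (a i j) * x i)"
      and b: "\<And>j. j \<in> I \<Longrightarrow> x j = (\<Sum>i\<in>I. of_int (b i j) * y i)"
      and x: "\<And>i. i \<in> I \<Longrightarrow> of_nat p * x i = 0" "card (int_span I x) = p ^ card I"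
      and ik: "i \<in> I" "k \<in> I"
    for a b :: "nat \<Rightarrow> nat \<Rightarrow> int" and x y :: "nat \<Rightarrow> 'v" and i k
  proof -
    have "x k = (\<Sum>j\<in>I. of_int (b j k) * (\<Sum>i\<in>I. of_int (a i j) * x i))"
      using b[OF ik(2)] a by simp
    also have "\<dots> = (\<Sum>j\<in>I. \<Sum>i\<in>I. of_int (a i j * b j k) * x i)"
      by (simp add: sum_distrib_left mult_ac)
    also have "\<dots> = (\<Sum>i\<in>I. \<Sum>j\<in>I. of_int (a i j * b j k) * x i)"
      by (rule sum.swap)
    also have "\<dots> = (\<Sum>i\<in>I. of_int (\<Sum>j\<in>I. a i j * b j k) * x i)"
      by (simp add: sum_distrib_right)
    finally have Z: "(\<Sum>i\<in>I. of_int ((\<Sum>j\<in>I. a i j * b j k) - (if i = k then 1 else 0)) * x i) = 0"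
      using ik by (simp add: left_diff_distrib sum_subtractf if_distrib[of of_int]
          if_distrib[of "\<lambda>x. x * _"] I_def cong: if_cong)
    have "int p dvd (\<Sum>j\<in>I. a i j * b j k) - (if i = k then 1 else 0)"
      by (rule int_span_independent[OF _ p x(1,2) Z ik(1)]) (simp_all add: I_def)
    then have "(\<Sum>j\<in>I. a i j * b j k) mod int p = (if i = k then 1 else 0) mod int p"
      by (simp add: mod_eq_dvd_iff)
    then show ?thesis
      using prime_gt_1_nat[OF assms(1)] by simp
  qed
  have finsum: "(\<Oplus>\<^bsub>residue_ring (int p)\<^esub>j\<in>I. a i j \<otimes>\<^bsub>residue_ring (int p)\<^esub> b j k) =
    (\<Sum>j\<in>I. a i j * b j k) mod int p" for a b :: "nat \<Rightarrow> nat \<Rightarrow> int" and i k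
    using R.sum_cong[of I "\<lambda>j. a i j * b j k"] by (simp add: R.res_mult_eq I_def)
  have "invertible_matrix (residue_ring (int p)) n c"
    unfolding invertible_matrix_def is_inverse_matrix_def I_def[symmetric] finsum
  proof (intro conjI exI[of _ d] ballI)
    fix i k assume ik: "i \<in> I" "k \<in> I"
    show "(\<Sum>j\<in>I. c i j * d j k) mod int p =
      (if i = k then \<one>\<^bsub>residue_ring (int p)\<^esub> else \<zero>\<^bsub>residue_ring (int p)\<^esub>)"
      using key[of w c v d, OF c(2) d(2) _ _ ik] char card by (simp add: I_def R.res_one_eq R.res_zero_eq)
    show "(\<Sum>j\<in>I. d i j * c j k) mod int p =
      (if i = k then \<one>\<^bsub>residue_ring (int p)\<^esub> else \<zero>\<^bsub>residue_ring (int p)\<^esub>)"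
      using key[of v d w c, OF d(2) c(2) _ _ ik] char card span by (simp add: I_def R.res_one_eq R.res_zero_eq)
  qed (use c d in \<open>auto simp: R.res_carrier_eq\<close>)
  then show thesis using that[of c] c by (simp add: I_def)
qed

section \<open>Quasi-antichains of sets\<close>

lemma quasi_antichainI:
  fixes A :: "'a set set" and b t :: "'a set"
  assumes "finite A" "card A = w" "w \<ge> 3"
    and bt: "\<And>x. x \<in> A \<Longrightarrow> b \<subset> x" "\<And>x. x \<in> A \<Longrightarrow> x \<subset> t"
    and antichain: "\<And>x y. x \<in> A \<Longrightarrow> y \<in> A \<Longrightarrow> x \<subseteq> y \<Longrightarrow> x = y"
  defines "L \<equiv> \<lparr>carrier = {b, t} \<union> A, eq = (=), le = (\<subseteq>)\<rparr>"
  shows "quasi_antichain L w" "atoms L = A"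
proof -
  have "A \<noteq> {}" using assms by auto
  then have bt': "b \<subset> t" using bt by blast
  have L: "carrier L = {b, t} \<union> A" "(x \<sqsubseteq>\<^bsub>L\<^esub> y) = (x \<subseteq> y)" "(x .=\<^bsub>L\<^esub> y) = (x = y)" for x y
    by (simp_all add: L_def)
  interpret partial_order L
    by unfold_locales (auto simp: L fun_eq_iff)
  have least: "least L b (carrier L)"
    unfolding least_def L using bt bt' by auto
  have greatest: "greatest L t (carrier L)"
    unfolding greatest_def L using bt bt' by auto
  have sup: "\<exists>s. least L s (Upper L {x, y})" if xy: "x \<in> carrier L" "y \<in> carrier L" for x y
  proof -
    consider "x \<subseteq> y" | "y \<subseteq> x" | "x \<in> A" "y \<in> A" "x \<noteq> y"
      using xy bt bt' unfolding L by blast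
    then show ?thesis
    proof cases
      case 1
      then have "least L y (Upper L {x, y})"
        using xy unfolding least_def Upper_def L by auto
      then show ?thesis ..
    next
      case 2
      then have "least L x (Upper L {x, y})"
        using xy unfolding least_def Upper_def L by auto
      then show ?thesis ..
    next
      case 3
      \<comment> \<open>If \<open>z = b\<close>, then \<open>b\<close> would contain
        \<open>x\<close>; a member of \<open>A\<close> containing both \<open>x\<close> and
        \<open>y\<close> would be equal to both.\<close>
      have ext: "z = t" if z: "z \<in> {b, t} \<union> A" "x \<subseteq> z" "y \<subseteq> z" for z
        using z(1)
      proof (elim UnE insertE emptyE)
        assume "z = b"
        with bt(1)[OF 3(1)] z(2) show ?thesis by blast
      next
        assume "z \<in> A"
        with antichain[OF 3(1) this z(2)] antichain[OF 3(2) this z(3)] 3(3) show ?thesis by simp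
      qed
      have U: "Upper L {x, y} = {z. z \<in> {b, t} \<union> A \<and> x \<subseteq> z \<and> y \<subseteq> z}"
        using xy unfolding Upper_def L by auto
      have m: "t \<in> {z. z \<in> {b, t} \<union> A \<and> x \<subseteq> z \<and> y \<subseteq> z}"
        using bt(2)[OF 3(1)] bt(2)[OF 3(2)] by auto
      have "Upper L {x, y} = {t}"
        unfolding U
      proof (intro subset_antisym subsetI)
        fix z assume "z \<in> {z. z \<in> {b, t} \<union> A \<and> x \<subseteq> z \<and> y \<subseteq> z}"
        then have "z = t" by (intro ext) auto
        then show "z \<in> {t}" by simp
      qed (use m in simp)
      then have "least L t (Upper L {x, y})"
        unfolding least_def L by auto
      then show ?thesis ..
    qed
  qed
  have inf: "\<exists>s. greatest L s (Lower L {x, y})" if xy: "x \<in> carrier L" "y \<in> carrier L" for x y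
  proof -
    consider "x \<subseteq> y" | "y \<subseteq> x" | "x \<in> A" "y \<in> A" "x \<noteq> y"
      using xy bt bt' unfolding L by blast
    then show ?thesis
    proof cases
      case 1
      then have "greatest L x (Lower L {x, y})"
        using xy unfolding greatest_def Lower_def L by auto
      then show ?thesis ..
    next
      case 2
      then have "greatest L y (Lower L {x, y})"
        using xy unfolding greatest_def Lower_def L by auto
      then show ?thesis ..
    next
      case 3
      have ext: "z = b" if z: "z \<in> {b, t} \<union> A" "z \<subseteq> x" "z \<subseteq> y" for z
        using z(1)
      proof (elim UnE insertE emptyE)
        assume "z = t"
        with bt(2)[OF 3(1)] z(2) show ?thesis by blast
      next
        assume "z \<in> A"
        with antichain[OF this 3(1) z(2)] antichain[OF this 3(2) z(3)] 3(3) show ?thesis by simp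
      qed
      have U: "Lower L {x, y} = {z. z \<in> {b, t} \<union> A \<and> z \<subseteq> x \<and> z \<subseteq> y}"
        using xy unfolding Lower_def L by auto
      have m: "b \<in> {z. z \<in> {b, t} \<union> A \<and> z \<subseteq> x \<and> z \<subseteq> y}"
        using bt(1)[OF 3(1)] bt(1)[OF 3(2)] by auto
      have "Lower L {x, y} = {b}"
        unfolding U
      proof (intro subset_antisym subsetI)
        fix z assume "z \<in> {z. z \<in> {b, t} \<union> A \<and> z \<subseteq> x \<and> z \<subseteq> y}"
        then have "z = b" by (intro ext) auto
        then show "z \<in> {b}" by simp
      qed (use m in simp)
      then have "greatest L b (Lower L {x, y})"
        unfolding greatest_def L by auto
      then show ?thesis ..
    qed
  qed
  interpret bounded_lattice L
    using sup inf least greatest by unfold_locales auto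
  have bot: "\<bottom>\<^bsub>L\<^esub> = b"
    by (rule bottom_eq[symmetric]) (use bt bt' in \<open>auto simp: L\<close>)
  have top: "\<top>\<^bsub>L\<^esub> = t"
    by (rule top_eq[symmetric]) (use bt bt' in \<open>auto simp: L\<close>)
  show atoms: "atoms L = A"
  proof (intro subset_antisym subsetI)
    fix x assume x: "x \<in> A"
    have "\<not> (b \<noteq> y \<and> y \<subseteq> x \<and> y \<noteq> x)" if "y \<in> {b, t} \<union> A" for y
      using that bt(2)[OF x] antichain[OF _ x, of y] by auto
    then show "x \<in> atoms L"
      unfolding atoms_def bot lless_def L using bt(1)[OF x] x by auto
  next
    fix x assume x: "x \<in> atoms L"
    from \<open>A \<noteq> {}\<close> obtain y where y: "y \<in> A" by auto
    have "x \<noteq> t"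
    proof
      assume "x = t"
      then have "\<not> (y \<in> carrier L \<and> b \<subset> y \<and> y \<subset> x)"
        using x unfolding atoms_def bot lless_def L by blast
      then show False using y bt \<open>x = t\<close> by (auto simp: L)
    qed
    moreover have "x \<noteq> b" "x \<in> carrier L"
      using x unfolding atoms_def bot lless_def L by auto
    ultimately show "x \<in> A" by (auto simp: L)
  qed
  show "quasi_antichain L w"
    unfolding quasi_antichain_def atoms bot top
    using assms(2,3) bounded_lattice_axioms by (auto simp: L)
qed

section \<open>The Chermak-Delgado lattice of a group of class two\<close>

definition perp :: "('v \<Rightarrow> 'v \<Rightarrow> bool) \<Rightarrow> 'v set \<Rightarrow> 'v set \<Rightarrow> 'v set"
  where "perp B V U = {v \<in> V. \<forall>u\<in>U. B v u}"

text \<open>A finite group given by the commutation relation \<open>B\<close> that it induces on its central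
  quotient, written additively as \<open>V\<close>.\<close>

locale class_two_group = group G for G :: "('a, 'b) monoid_scheme" (structure) +
  fixes p :: nat and \<pi> :: "'a \<Rightarrow> 'v :: comm_ring_1" and V :: "'v set" and B :: "'v \<Rightarrow> 'v \<Rightarrow> bool"
  assumes finite_G: "finite (carrier G)"
    and prime_p: "Factorial_Ring.prime p"
    and V: "V = \<pi> ` carrier G"
    and pi_mult: "x \<in> carrier G \<Longrightarrow> y \<in> carrier G \<Longrightarrow> \<pi> (x \<otimes> y) = \<pi> x + \<pi> y"
    and commute_iff: "x \<in> carrier G \<Longrightarrow> y \<in> carrier G \<Longrightarrow> x \<otimes> y = y \<otimes> x \<longleftrightarrow> B (\<pi> x) (\<pi> y)"
    and char_V: "v \<in> V \<Longrightarrow> of_nat p * v = 0"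
    and exponent_kernel: "x \<in> carrier G \<Longrightarrow> \<pi> x = 0 \<Longrightarrow> x [^] p = \<one>"
    and nondegenerate: "perp B V V = {0}"
begin

definition pre :: "'v set \<Rightarrow> 'a set"
  where "pre U = {x \<in> carrier G. \<pi> x \<in> U}"

lemma pi_in_V: "x \<in> carrier G \<Longrightarrow> \<pi> x \<in> V"
  by (simp add: V)

lemma pi_one: "\<pi> \<one> = 0"
  using pi_mult[of \<one> \<one>] by simp

lemma pi_inv: "x \<in> carrier G \<Longrightarrow> \<pi> (inv x) = - \<pi> x"
  using pi_mult[of x "inv x"] by (simp add: pi_one eq_neg_iff_add_eq_0 add.commute)

lemma pi_pow: "x \<in> carrier G \<Longrightarrow> \<pi> (x [^] k) = of_nat k * \<pi> x" for k :: nat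
  by (induction k) (simp_all add: pi_one pi_mult algebra_simps)

lemma pi_int_pow: "x \<in> carrier G \<Longrightarrow> \<pi> (x [^] k) = of_int k * \<pi> x" for k :: int
  by (cases k rule: int_cases2) (simp_all add: int_pow_int int_pow_neg pi_inv pi_pow)

lemma finite_V: "finite V"
  using finite_G by (simp add: V)

lemma add_subgroup_pi:
  assumes "subgroup H G"
  shows "add_subgroup (\<pi> ` H)"
  unfolding add_subgroup_def
proof (intro conjI ballI)
  show "0 \<in> \<pi> ` H"
    using subgroup.one_closed[OF assms] pi_one by (metis imageI)
next
  fix u v assume "u \<in> \<pi> ` H" "v \<in> \<pi> ` H"
  then obtain x y where "u = \<pi> x" "v = \<pi> y" "x \<in> H" "y \<in> H" by auto
  then show "u + v \<in> \<pi> ` H"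
    using subgroup.m_closed[OF assms, of x y] subgroup.mem_carrier[OF assms] pi_mult
    by (metis imageI)
next
  fix u assume "u \<in> \<pi> ` H"
  then obtain x where "u = \<pi> x" "x \<in> H" by auto
  then show "- u \<in> \<pi> ` H"
    using subgroup.m_inv_closed[OF assms, of x] subgroup.mem_carrier[OF assms] pi_inv
    by (metis imageI)
qed

lemma add_subgroup_V: "add_subgroup V"
  using add_subgroup_pi[OF subgroup_self] by (simp add: V)

lemma zero_V: "0 \<in> V"
  using add_subgroupD(1)[OF add_subgroup_V] .

lemma subgroup_pre: "add_subgroup U \<Longrightarrow> subgroup (pre U) G"
  unfolding pre_def
  by (rule subgroup.intro) (auto simp: pi_inv pi_mult pi_one intro: add_subgroupD)

lemma pi_pre: "U \<subseteq> V \<Longrightarrow> \<pi> ` pre U = U"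
  by (auto simp: pre_def V)

lemma pre_V: "pre V = carrier G"
  by (auto simp: pre_def V)

section \<open>The central quotient described inside \<open>V\<close>\<close>

lemma center_eq: "center G = pre {0}"
proof -
  have "x \<in> center G \<longleftrightarrow> x \<in> carrier G \<and> \<pi> x \<in> perp B V V" for x
    unfolding center_def centralizer_def perp_def V using commute_iff by auto
  then show ?thesis unfolding nondegenerate by (auto simp: pre_def)
qed

lemma centralizer_eq: "H \<subseteq> carrier G \<Longrightarrow> centralizer G H = pre (perp B V (\<pi> ` H))"
  unfolding centralizer_def perp_def pre_def V using commute_iff by auto

text \<open>The cosets of the center are the fibres of \<open>\<pi>\<close>, so the central quotient
  can be handled through elements of \<open>V\<close>.\<close>

lemma coset_center: "x \<in> carrier G \<Longrightarrow> center G #> x = pre {\<pi> x}"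
proof (intro subset_antisym subsetI)
  fix y assume x: "x \<in> carrier G" and "y \<in> center G #> x"
  then show "y \<in> pre {\<pi> x}"
    unfolding center_eq r_coset_def by (auto simp: pre_def pi_mult)
next
  fix y assume x: "x \<in> carrier G" and y: "y \<in> pre {\<pi> x}"
  then have "y = (y \<otimes> inv x) \<otimes> x" "y \<otimes> inv x \<in> pre {0}"
    by (auto simp: pre_def m_assoc pi_mult pi_inv)
  then show "y \<in> center G #> x"
    unfolding center_eq r_coset_def by blast
qed

lemma pre_mult:
  assumes "u \<in> V" "v \<in> V"
  shows "pre {u} <#> pre {v} = pre {u + v}"
proof (intro subset_antisym subsetI)
  fix z assume z: "z \<in> pre {u + v}"
  obtain x where x: "x \<in> carrier G" "\<pi> x = u" using assms V by auto
  have "z = x \<otimes> (inv x \<otimes> z)" "x \<in> pre {u}" "inv x \<otimes> z \<in> pre {v}"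
    using x z by (auto simp: pre_def pi_mult pi_inv simp flip: m_assoc)
  then show "z \<in> pre {u} <#> pre {v}"
    unfolding set_mult_def by blast
qed (auto simp: set_mult_def pre_def pi_mult)

lemma pre_singleton_inject: "u \<in> V \<Longrightarrow> pre {u} = pre {v} \<Longrightarrow> u = v"
  by (auto simp: pre_def V)

lemma card_pre:
  assumes "U \<subseteq> V"
  shows "card (pre U) = card (center G) * card U"
proof -
  have fin: "finite U" using assms finite_V by (rule finite_subset)
  have "pre U = (\<Union>u\<in>U. pre {u})" by (auto simp: pre_def)
  also have "card \<dots> = (\<Sum>u\<in>U. card (pre {u}))"
    using fin finite_G by (intro card_UN_disjoint) (auto simp: pre_def)
  also have "\<dots> = (\<Sum>u\<in>U. card (center G))"
  proof (rule sum.cong)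
    fix u assume "u \<in> U"
    then obtain x where x: "x \<in> carrier G" "\<pi> x = u" using assms V by auto
    show "card (pre {u}) = card (center G)"
    proof -
      have "center G #> x \<in> rcosets center G" using x unfolding RCOSETS_def by blast
      moreover have "center G \<subseteq> carrier G" by (auto simp: center_eq pre_def)
      ultimately show ?thesis using card_rcosets_equal coset_center[OF x(1)] x(2) by metis
    qed
  qed simp
  finally show ?thesis by simp
qed

lemma carrier_mod_center: "U \<subseteq> V \<Longrightarrow> carrier (mod_center G (pre U)) = (\<lambda>u. pre {u}) ` U"
proof -
  assume U: "U \<subseteq> V"
  have "carrier (mod_center G (pre U)) = (\<lambda>x. center G #> x) ` pre U"
    unfolding mod_center_def FactGroup_def RCOSETS_def r_coset_def by auto
  also have "\<dots> = (\<lambda>u. pre {u}) ` \<pi> ` pre U"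
    unfolding image_image by (rule image_cong) (auto simp: coset_center pre_def)
  finally show ?thesis using pi_pre[OF U] by simp
qed

lemma mult_mod_center: "monoid.mult (mod_center G M) = set_mult G"
  by (auto simp: mod_center_def FactGroup_def set_mult_def fun_eq_iff)

lemma one_mod_center: "\<one>\<^bsub>mod_center G M\<^esub> = pre {0}"
  by (simp add: mod_center_def FactGroup_def center_eq)

lemma Mod_center_eq: "G Mod center G = mod_center G (carrier G)"
  by (simp add: mod_center_def)

lemma order_mod_center: "U \<subseteq> V \<Longrightarrow> order (mod_center G (pre U)) = card U"
  unfolding order_def carrier_mod_center
  by (rule card_image) (auto intro!: inj_onI dest: pre_singleton_inject)

lemma comm_group_mod_center:
  assumes U: "add_subgroup U" "U \<subseteq> V"
  shows "comm_group (mod_center G (pre U))"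
proof -
  note simps = carrier_mod_center[OF U(2)] mult_mod_center one_mod_center
  have mult: "pre {u} <#> pre {v} = pre {u + v}" if "u \<in> U" "v \<in> U" for u v
    using pre_mult that U(2) by blast
  note sub = add_subgroupD[OF U(1)]
  show ?thesis
  proof (rule comm_groupI, unfold simps)
    fix x y z
    assume "x \<in> (\<lambda>u. pre {u}) ` U" "y \<in> (\<lambda>u. pre {u}) ` U" "z \<in> (\<lambda>u. pre {u}) ` U"
    then obtain u v w where *: "x = pre {u}" "y = pre {v}" "z = pre {w}" "u \<in> U" "v \<in> U" "w \<in> U"
      by auto
    show "x <#> y \<in> (\<lambda>u. pre {u}) ` U"
      using * sub by (auto simp: mult)
    show "x <#> y <#> z = x <#> (y <#> z)"
      using * sub by (simp add: mult add.assoc)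
    show "x <#> y = y <#> x"
      using * by (simp add: mult add.commute)
    show "pre {0} <#> x = x"
      using * sub by (simp add: mult)
    have "pre {- u} <#> x = pre {0}" using * sub by (simp add: mult)
    then show "\<exists>y\<in>(\<lambda>u. pre {u}) ` U. y <#> x = pre {0}"
      using * sub by blast
  qed (use sub in auto)
qed

lemma pow_mod_center:
  fixes k :: nat
  assumes "U \<subseteq> V" "add_subgroup U" "u \<in> U"
  shows "pre {u} [^]\<^bsub>mod_center G M\<^esub> k = pre {of_nat k * u}"
proof (induction k)
  case 0
  then show ?case by (simp add: one_mod_center)
next
  case (Suc k)
  have "of_nat k * u \<in> V" using add_subgroup_of_nat[OF assms(2,3)] assms(1) by auto
  then show ?case
    using Suc assms by (subst Group.nat_pow_Suc) (auto simp: mult_mod_center pre_mult algebra_simps)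
qed

lemma elementary_abelian_mod_center:
  assumes "add_subgroup U" "U \<subseteq> V"
  shows "elementary_abelian p (mod_center G (pre U))"
  unfolding elementary_abelian_def carrier_mod_center[OF assms(2)] one_mod_center
  using comm_group_mod_center[OF assms] assms char_V by (auto simp: pow_mod_center)

lemma derived_subset: "derived G (carrier G) \<subseteq> center G"
proof -
  have sub: "subgroup (center G) G"
    unfolding center_eq by (rule subgroup_pre) (simp add: add_subgroup_def)
  have "derived_set G (carrier G) \<subseteq> center G"
    unfolding center_eq by (auto simp: pre_def pi_mult pi_inv)
  then show ?thesis
    unfolding derived_def using generate_subgroup_incl[OF _ sub] by blast
qed

lemma property_P1: "property_P1 p G"
  unfolding property_P1_def
proof
  show "elementary_abelian p (G Mod center G)"
    using elementary_abelian_mod_center[OF add_subgroup_V] by (simp add: Mod_center_eq pre_V)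
  let ?D = "derived G (carrier G)"
  have sub: "subgroup ?D G"
    by (rule derived_is_subgroup) simp
  then interpret D: group "G\<lparr>carrier := ?D\<rparr>"
    by (rule subgroup_imp_group)
  have "comm_group (G\<lparr>carrier := ?D\<rparr>)"
  proof (rule D.group_comm_groupI)
    fix x y assume "x \<in> carrier (G\<lparr>carrier := ?D\<rparr>)" "y \<in> carrier (G\<lparr>carrier := ?D\<rparr>)"
    then have "x \<in> center G" "y \<in> carrier G"
      using derived_subset subgroup.mem_carrier[OF sub] by auto
    then show "x \<otimes>\<^bsub>G\<lparr>carrier := ?D\<rparr>\<^esub> y = y \<otimes>\<^bsub>G\<lparr>carrier := ?D\<rparr>\<^esub> x"
      by (auto simp: center_def centralizer_def)
  qed
  moreover have "x [^]\<^bsub>G\<lparr>carrier := ?D\<rparr>\<^esub> p = \<one>\<^bsub>G\<lparr>carrier := ?D\<rparr>\<^esub>" if "x \<in> ?D" for x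
    using that derived_subset exponent_kernel
    by (auto simp: center_eq pre_def simp flip: nat_pow_consistent)
  ultimately show "elementary_abelian p (G\<lparr>carrier := ?D\<rparr>)"
    by (simp add: elementary_abelian_def)
qed

lemma internal_direct_product_mod_center:
  assumes "add_subgroup L" "L \<subseteq> V" "add_subgroup M" "M \<subseteq> V"
    and "L \<inter> M = {0}" "\<And>v. v \<in> V \<Longrightarrow> \<exists>x\<in>L. \<exists>y\<in>M. v = x + y"
  shows "internal_direct_product (G Mod center G)
    (carrier (mod_center G (pre L))) (carrier (mod_center G (pre M)))"
proof -
  let ?Q = "mod_center G (carrier G)"
  interpret Q: comm_group ?Q
    using comm_group_mod_center[OF add_subgroup_V] by (simp add: pre_V)
  have carrier_Q: "carrier ?Q = (\<lambda>u. pre {u}) ` V"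
    using carrier_mod_center[of V] by (simp add: pre_V)
  have normal: "(\<lambda>u. pre {u}) ` U \<lhd> ?Q" if U: "add_subgroup U" "U \<subseteq> V" for U
  proof (rule Q.subgroup_imp_normal, rule Q.subgroupI)
    show "(\<lambda>u. pre {u}) ` U \<subseteq> carrier ?Q" "(\<lambda>u. pre {u}) ` U \<noteq> {}"
      using U add_subgroupD(1)[OF U(1)] by (auto simp: carrier_Q)
  next
    fix x assume "x \<in> (\<lambda>u. pre {u}) ` U"
    then obtain u where u: "x = pre {u}" "u \<in> U" by auto
    have "inv\<^bsub>?Q\<^esub> x = pre {- u}"
      using u U(2) add_subgroupD(3)[OF U(1)]
      by (intro Q.inv_equality) (auto simp: carrier_Q mult_mod_center one_mod_center pre_mult subset_iff)
    then show "inv\<^bsub>?Q\<^esub> x \<in> (\<lambda>u. pre {u}) ` U"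
      using u add_subgroupD(3)[OF U(1)] by blast
  next
    fix x y assume "x \<in> (\<lambda>u. pre {u}) ` U" "y \<in> (\<lambda>u. pre {u}) ` U"
    then obtain u v where "x = pre {u}" "u \<in> U" "y = pre {v}" "v \<in> U" by auto
    then show "x \<otimes>\<^bsub>?Q\<^esub> y \<in> (\<lambda>u. pre {u}) ` U"
      using U(2) add_subgroupD(2)[OF U(1)] by (auto simp: mult_mod_center pre_mult subset_iff)
  qed
  have "(\<lambda>u. pre {u}) ` L \<inter> (\<lambda>u. pre {u}) ` M = {pre {0}}"
  proof -
    have "u = 0" if "u \<in> L" "v \<in> M" "pre {u} = pre {v}" for u v
      using that pre_singleton_inject[of u v] assms(2,5) by auto
    then show ?thesis
      using add_subgroupD(1)[OF assms(1)] add_subgroupD(1)[OF assms(3)] by blast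
  qed
  moreover have "(\<lambda>u. pre {u}) ` L <#>\<^bsub>?Q\<^esub> (\<lambda>u. pre {u}) ` M = (\<lambda>u. pre {u}) ` V"
  proof -
    have "(\<lambda>u. pre {u}) ` L <#>\<^bsub>?Q\<^esub> (\<lambda>u. pre {u}) ` M = (\<lambda>(u, v). pre {u} <#> pre {v}) ` (L \<times> M)"
      unfolding set_mult_def[of ?Q] mult_mod_center by force
    also have "\<dots> = (\<lambda>(u, v). pre {u + v}) ` (L \<times> M)"
      using assms(2,4) by (intro image_cong) (auto simp: pre_mult subset_iff)
    also have "\<dots> = (\<lambda>u. pre {u}) ` (\<lambda>(u, v). u + v) ` (L \<times> M)"
      by (simp add: image_image case_prod_unfold)
    also have "(\<lambda>(u, v). u + v) ` (L \<times> M) = V"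
      using assms add_subgroupD(2)[OF add_subgroup_V] by (force simp: image_iff)
    finally show ?thesis .
  qed
  ultimately show ?thesis
    unfolding internal_direct_product_def Mod_center_eq carrier_mod_center[OF assms(2)]
      carrier_mod_center[OF assms(4)] carrier_Q one_mod_center
    using normal[OF assms(1,2)] normal[OF assms(3,4)] by simp
qed

lemma mod_center_iso:
  assumes "L \<subseteq> V" "M \<subseteq> V" "bij_betw \<phi> L M"
    and "\<And>x y. x \<in> L \<Longrightarrow> y \<in> L \<Longrightarrow> \<phi> (x + y) = \<phi> x + \<phi> y" and "add_subgroup L"
  shows "mod_center G (pre L) \<cong> mod_center G (pre M)"
proof -
  \<comment> \<open>All elements of a fibre have the same image under \<open>\<pi>\<close>, and
    \<open>the_elem\<close> recovers it from the coset.\<close>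
  define h where "h = (\<lambda>S. pre {\<phi> (the_elem (\<pi> ` S))})"
  have h: "h (pre {u}) = pre {\<phi> u}" if "u \<in> L" for u
    using that assms(1) pi_pre[of "{u}"] unfolding h_def by auto
  have \<phi>: "\<phi> u \<in> M" if "u \<in> L" for u using assms(3) that by (auto simp: bij_betw_def)
  have "h \<in> hom (mod_center G (pre L)) (mod_center G (pre M))"
  proof (rule homI; unfold carrier_mod_center[OF assms(1)] carrier_mod_center[OF assms(2)] mult_mod_center)
    fix x assume "x \<in> (\<lambda>u. pre {u}) ` L"
    then show "h x \<in> (\<lambda>u. pre {u}) ` M" using h \<phi> by auto
    fix y assume "y \<in> (\<lambda>u. pre {u}) ` L"
    with \<open>x \<in> _\<close> obtain u v where *: "x = pre {u}" "y = pre {v}" "u \<in> L" "v \<in> L" by auto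
    have "u \<in> V" "v \<in> V" "\<phi> u \<in> V" "\<phi> v \<in> V" using * \<phi> assms(1,2) by auto
    moreover have "u + v \<in> L" using * add_subgroupD(2)[OF assms(5)] by simp
    ultimately show "h (x <#> y) = h x <#> h y"
      using * by (simp add: h pre_mult assms(4))
  qed
  moreover have "bij_betw h ((\<lambda>u. pre {u}) ` L) ((\<lambda>u. pre {u}) ` M)"
    unfolding bij_betw_def
  proof
    show "h ` (\<lambda>u. pre {u}) ` L = (\<lambda>u. pre {u}) ` M"
    proof -
      have "h ` (\<lambda>u. pre {u}) ` L = (\<lambda>u. pre {\<phi> u}) ` L"
        unfolding image_image by (rule image_cong) (simp_all add: h)
      also have "\<dots> = (\<lambda>u. pre {u}) ` \<phi> ` L" by (simp add: image_image)
      finally show ?thesis using assms(3) by (simp add: bij_betw_def)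
    qed
    show "inj_on h ((\<lambda>u. pre {u}) ` L)"
    proof (rule inj_onI)
      fix x y assume "x \<in> (\<lambda>u. pre {u}) ` L" "y \<in> (\<lambda>u. pre {u}) ` L" "h x = h y"
      then obtain u v where *: "x = pre {u}" "y = pre {v}" "u \<in> L" "v \<in> L" "pre {\<phi> u} = pre {\<phi> v}"
        using h by auto
      then have "\<phi> u = \<phi> v" using \<phi>[of u] assms(2) pre_singleton_inject by blast
      then show "x = y" using * assms(3) by (auto simp: bij_betw_def dest: inj_onD)
    qed
  qed
  ultimately show ?thesis
    unfolding is_iso_def iso_def carrier_mod_center[OF assms(1)] carrier_mod_center[OF assms(2)] by blast
qed

section \<open>Generation modulo the center\<close>

lemma pi_generate:
  assumes "finite I" "x ` I \<subseteq> carrier G" "y \<in> generate G (x ` I)"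
  shows "\<pi> y \<in> int_span I (\<lambda>i. \<pi> (x i))"
  using assms(3)
proof induction
  case one
  then show ?case using add_subgroupD(1)[OF add_subgroup_int_span] by (simp add: pi_one)
next
  case (incl h)
  then show ?case using int_span_incl[OF assms(1)] by auto
next
  case (inv h)
  then obtain i where "i \<in> I" "h = x i" by auto
  then show ?case
    using add_subgroupD(3)[OF add_subgroup_int_span int_span_incl[OF assms(1)], of i "\<lambda>i. \<pi> (x i)"] assms(2)
    by (auto simp: pi_inv)
next
  case (eng h1 h2)
  then show ?case
    using add_subgroupD(2)[OF add_subgroup_int_span] generate_incl[OF assms(2)]
    by (auto simp: pi_mult subset_iff)
qed

lemma ordered_prod_closed_pi:
  assumes "f ` {1..n} \<subseteq> carrier G"
  shows "ordered_prod G n f \<in> carrier G \<and> \<pi> (ordered_prod G n f) = (\<Sum>i\<in>{1..n}. \<pi> (f i))"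
proof -
  have "foldr (\<otimes>) (map f xs) \<one> \<in> carrier G \<and> \<pi> (foldr (\<otimes>) (map f xs) \<one>) = (\<Sum>i\<leftarrow>xs. \<pi> (f i))"
    if "f ` set xs \<subseteq> carrier G" for xs
    using that by (induction xs) (auto simp: pi_one pi_mult)
  from this[of "[1..<Suc n]"] show ?thesis
    using assms by (simp add: ordered_prod_def interv_sum_list_conv_sum_set_nat
      atLeastLessThanSuc_atLeastAtMost del: upt_Suc)
qed

lemma ordered_prod_in_subgroup:
  assumes "subgroup H G" "f ` {1..n} \<subseteq> H"
  shows "ordered_prod G n f \<in> H"
proof -
  have "foldr (\<otimes>) (map f xs) \<one> \<in> H" if "f ` set xs \<subseteq> H" for xs
    using that by (induction xs) (auto simp: subgroup.one_closed[OF assms(1)] subgroup.m_closed[OF assms(1)])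
  from this[of "[1..<Suc n]"] show ?thesis
    using assms by (simp add: ordered_prod_def atLeastLessThanSuc_atLeastAtMost del: upt_Suc)
qed

text \<open>This turns the generation statements of (P3) into linear algebra over the prime
  field.\<close>

lemma generates_mod_center_iff:
  assumes "U \<subseteq> V"
  shows "generates_mod_center G n x (pre U) \<longleftrightarrow>
    x ` {1..n} \<subseteq> carrier G \<and> int_span {1..n} (\<lambda>i. \<pi> (x i)) = U"
proof -
  have "generate G (x ` {1..n}) <#> center G = pre (int_span {1..n} (\<lambda>i. \<pi> (x i)))"
    if x: "x ` {1..n} \<subseteq> carrier G"
  proof (intro subset_antisym subsetI)
    fix z assume "z \<in> generate G (x ` {1..n}) <#> center G"
    then obtain g c where "z = g \<otimes> c" "g \<in> generate G (x ` {1..n})" "c \<in> pre {0}"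
      unfolding set_mult_def center_eq by auto
    then show "z \<in> pre (int_span {1..n} (\<lambda>i. \<pi> (x i)))"
      using pi_generate[OF _ x] generate_incl[OF x] by (auto simp: pre_def pi_mult subset_iff)
  next
    fix z assume z: "z \<in> pre (int_span {1..n} (\<lambda>i. \<pi> (x i)))"
    then obtain c where c: "\<pi> z = (\<Sum>i\<in>{1..n}. of_int (c i) * \<pi> (x i))"
      by (auto simp: pre_def int_span_def)
    \<comment> \<open>A lift of the linear combination. It has the same image as \<open>z\<close>
      under \<open>\<pi>\<close>, so the two differ by a central factor, whatever the order of
      multiplication.\<close>
    define g where "g = ordered_prod G n (\<lambda>i. x i [^] (c i :: int))"
    have xi: "x i \<in> carrier G" if "i \<in> {1..n}" for i using x that by auto
    have "(\<lambda>i. x i [^] (c i :: int)) ` {1..n} \<subseteq> carrier G" using xi by auto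
    from ordered_prod_closed_pi[OF this]
    have g: "g \<in> carrier G" "\<pi> g = \<pi> z"
      using xi unfolding g_def c by (auto simp: pi_int_pow)
    have "g \<in> generate G (x ` {1..n})"
      unfolding g_def
    proof (rule ordered_prod_in_subgroup[OF generate_is_subgroup[OF x]])
      have "x i [^] c i \<in> generate G (x ` {1..n})" if "i \<in> {1..n}" for i
        by (rule subgroup_int_pow_closed[OF generate_is_subgroup[OF x] generate.incl]) (use that in simp)
      then show "(\<lambda>i. x i [^] c i) ` {1..n} \<subseteq> generate G (x ` {1..n})" by blast
    qed
    moreover have "z = g \<otimes> (inv g \<otimes> z)" "inv g \<otimes> z \<in> pre {0}"
      using g z by (auto simp: pre_def pi_mult pi_inv simp flip: m_assoc)
    ultimately show "z \<in> generate G (x ` {1..n}) <#> center G"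
      unfolding set_mult_def center_eq by blast
  qed
  moreover have "int_span {1..n} (\<lambda>i. \<pi> (x i)) \<subseteq> V" if "x ` {1..n} \<subseteq> carrier G"
    by (rule int_span_subset[OF add_subgroup_V], rule pi_in_V) (use that in blast)
  ultimately show ?thesis
    unfolding generates_mod_center_def using pi_pre assms by metis
qed

end

text \<open>The interface between the group and the form: \<open>perp_bound\<close> and
  \<open>perp_eq\<close> control the extremal additive subgroups, and the remaining conditions say
  that \<open>A\<close> consists of pairwise complementary, mutually isomorphic subgroups of order
  \<open>p ^ n\<close>. The lattice, (P2) and (P3) are derived from this.\<close>

locale cd_family = class_two_group G p \<pi> V B
  for G :: "('a, 'b) monoid_scheme" (structure) and p \<pi> and V :: "'v :: comm_ring_1 set" and B +
  fixes n w :: nat and A :: "'v set set"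
  assumes n_pos: "n > 0"
    and card_V: "card V = p ^ (2 * n)"
    and card_A: "card A = w" "w \<ge> 3"
    and perp_bound: "add_subgroup U \<Longrightarrow> U \<subseteq> V \<Longrightarrow> card U * card (perp B V U) \<le> card V"
    and perp_eq: "add_subgroup U \<Longrightarrow> U \<subseteq> V \<Longrightarrow> card U * card (perp B V U) = card V \<Longrightarrow>
      U \<in> {{0}, V} \<union> A"
    and A_sub: "L \<in> A \<Longrightarrow> add_subgroup L" "L \<in> A \<Longrightarrow> L \<subseteq> V"
    and A_card: "L \<in> A \<Longrightarrow> card L = p ^ n" "L \<in> A \<Longrightarrow> card (perp B V L) = p ^ n"
    and A_compl: "L \<in> A \<Longrightarrow> M \<in> A \<Longrightarrow> L \<noteq> M \<Longrightarrow> L \<inter> M = {0}"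
      "L \<in> A \<Longrightarrow> M \<in> A \<Longrightarrow> L \<noteq> M \<Longrightarrow> v \<in> V \<Longrightarrow> \<exists>x\<in>L. \<exists>y\<in>M. v = x + y"
    and A_iso: "L \<in> A \<Longrightarrow> M \<in> A \<Longrightarrow>
      \<exists>\<phi>. bij_betw \<phi> L M \<and> (\<forall>x\<in>L. \<forall>y\<in>L. \<phi> (x + y) = \<phi> x + \<phi> y)"
begin

section \<open>The Chermak-Delgado lattice of such a group\<close>

lemma p_gt_1: "p > 1"
  using prime_p by (rule prime_gt_1_nat)

lemma perp_zero: "perp B V {0} = V"
  unfolding perp_def V using commute_iff[of _ \<one>] pi_one by auto

lemma card_center_pos: "card (center G) > 0"
  using finite_G pi_one by (auto simp: center_eq pre_def card_gt_0_iff)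

lemma card_V_pos: "card V > 0"
  using p_gt_1 by (simp add: card_V)

lemma perp_subset: "perp B V U \<subseteq> V"
  by (auto simp: perp_def)

lemma cd_measure_eq:
  assumes "subgroup H G"
  shows "cd_measure G H = card H * (card (center G) * card (perp B V (\<pi> ` H)))"
  unfolding cd_measure_def centralizer_eq[OF subgroup.subset[OF assms]] card_pre[OF perp_subset] ..

lemma cd_measure_pre:
  assumes "add_subgroup U" "U \<subseteq> V"
  shows "cd_measure G (pre U) = card (center G) ^ 2 * (card U * card (perp B V U))"
  unfolding cd_measure_eq[OF subgroup_pre[OF assms(1)]] pi_pre[OF assms(2)] card_pre[OF assms(2)]
  by (simp add: power2_eq_square)

lemma subset_pre_pi: "H \<subseteq> carrier G \<Longrightarrow> H \<subseteq> pre (\<pi> ` H)"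
  by (auto simp: pre_def)

lemma pi_subset_V: "subgroup H G \<Longrightarrow> \<pi> ` H \<subseteq> V"
  using subgroup.subset[of H G] by (auto simp: V)

lemma finite_pre: "finite (pre U)"
  using finite_G by (simp add: pre_def)

lemma card_subgroup_le:
  assumes "subgroup H G"
  shows "card H \<le> card (center G) * card (\<pi> ` H)"
  using card_mono[OF finite_pre subset_pre_pi[OF subgroup.subset[OF assms]]]
    card_pre[OF pi_subset_V[OF assms]] by simp

lemma cd_measure_le:
  assumes "subgroup H G"
  shows "cd_measure G H \<le> card (center G) ^ 2 * card V"
proof -
  have "cd_measure G H \<le> (card (center G) * card (\<pi> ` H)) * (card (center G) * card (perp B V (\<pi> ` H)))"
    unfolding cd_measure_eq[OF assms] using card_subgroup_le[OF assms] by (rule mult_right_mono) simp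
  also have "\<dots> = card (center G) ^ 2 * (card (\<pi> ` H) * card (perp B V (\<pi> ` H)))"
    by (simp add: power2_eq_square)
  also have "\<dots> \<le> card (center G) ^ 2 * card V"
    using perp_bound[OF add_subgroup_pi[OF assms] pi_subset_V[OF assms]] by simp
  finally show ?thesis .
qed

lemma max_cd_measure_eq: "max_cd_measure G = card (center G) ^ 2 * card V"
  unfolding max_cd_measure_def
proof (rule Max_eqI)
  have "{cd_measure G H |H. subgroup H G} \<subseteq> cd_measure G ` Pow (carrier G)"
    using subgroup.subset by blast
  then show "finite {cd_measure G H |H. subgroup H G}"
    by (rule finite_subset) (simp add: finite_G)
  show "x \<le> card (center G) ^ 2 * card V" if "x \<in> {cd_measure G H |H. subgroup H G}" for x
    using that cd_measure_le by auto
  have "cd_measure G (pre V) = card (center G) ^ 2 * card V"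
    using cd_measure_pre[OF add_subgroup_V] by (simp add: nondegenerate)
  then show "card (center G) ^ 2 * card V \<in> {cd_measure G H |H. subgroup H G}"
    using subgroup_pre[OF add_subgroup_V] by (metis (mono_tags, lifting) mem_Collect_eq)
qed

lemma add_subgroup_zero: "add_subgroup {0 :: 'v}"
  by (simp add: add_subgroup_def)

lemma cd_carrier:
  "{H. subgroup H G \<and> cd_measure G H = max_cd_measure G} = {pre {0}, pre V} \<union> pre ` A"
proof (intro subset_antisym subsetI)
  fix H assume "H \<in> {H. subgroup H G \<and> cd_measure G H = max_cd_measure G}"
  then have H: "subgroup H G" and eq: "cd_measure G H = card (center G) ^ 2 * card V"
    by (auto simp: max_cd_measure_eq)
  define U where "U = \<pi> ` H"
  define z u k h where "z = card (center G)" and "u = card U" and "k = card (perp B V U)" and "h = card H"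
  have z: "z > 0" using card_center_pos by (simp add: z_def)
  have U: "add_subgroup U" "U \<subseteq> V"
    using add_subgroup_pi[OF H] pi_subset_V[OF H] by (auto simp: U_def)
  have 1: "h \<le> z * u" using card_subgroup_le[OF H] by (simp add: h_def z_def u_def U_def)
  have 2: "u * k \<le> card V" using perp_bound[OF U] by (simp add: u_def k_def)
  have 3: "h * (z * k) = z ^ 2 * card V"
    using eq unfolding cd_measure_eq[OF H] by (simp add: z_def k_def h_def U_def)
  have "h * (z * k) \<le> z * u * (z * k)" using 1 by (rule mult_right_mono) simp
  then have "z ^ 2 * card V \<le> z ^ 2 * (u * k)" unfolding 3 by (simp add: power2_eq_square mult_ac)
  then have uk: "u * k = card V" using 2 z by simp
  then have k: "k > 0" using card_V_pos by (cases k) auto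
  have "h * (z * k) = z * u * (z * k)" using 3 uk[symmetric] by (simp add: power2_eq_square mult_ac)
  then have "h = z * u" using z k by simp
  then have "card H = card (pre U)" using card_pre[OF U(2)] by (simp add: h_def z_def u_def)
  then have "H = pre U"
    using card_subset_eq[OF finite_pre subset_pre_pi[OF subgroup.subset[OF H]]] by (simp add: U_def)
  moreover have "U \<in> {{0}, V} \<union> A"
    using perp_eq[OF U] uk by (simp add: u_def k_def)
  ultimately show "H \<in> {pre {0}, pre V} \<union> pre ` A" by auto
next
  fix H assume "H \<in> {pre {0}, pre V} \<union> pre ` A"
  then obtain U where U: "H = pre U" "U \<in> {{0}, V} \<union> A" by auto
  then have *: "add_subgroup U" "U \<subseteq> V" "card U * card (perp B V U) = card V"
    using add_subgroup_V add_subgroup_zero zero_V A_sub perp_zero nondegenerate A_card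
    by (auto simp: card_V power_mult mult.commute[of 2] power2_eq_square)
  then show "H \<in> {H. subgroup H G \<and> cd_measure G H = max_cd_measure G}"
    using U(1) subgroup_pre cd_measure_pre max_cd_measure_eq by simp
qed

lemma pre_subset_iff: "U \<subseteq> V \<Longrightarrow> pre U \<subseteq> pre W \<longleftrightarrow> U \<subseteq> W"
  using pi_pre[of U] by (fastforce simp: pre_def V)

lemma inj_on_pre: "inj_on pre A"
  using pi_pre A_sub(2) by (metis inj_onI)

lemma A_subset_eq:
  assumes "L \<in> A" "M \<in> A" "L \<subseteq> M"
  shows "L = M"
  using assms A_card(1) A_sub(2) finite_V by (metis card_subset_eq finite_subset)

lemma cd_lattice_quasi_antichain: "quasi_antichain (cd_lattice G) w"
  and cd_atoms_eq: "cd_atoms G = pre ` A"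
proof -
  have cd: "cd_lattice G = \<lparr>carrier = {pre {0}, pre V} \<union> pre ` A, eq = (=), le = (\<subseteq>)\<rparr>"
    unfolding cd_lattice_def cd_carrier ..
  have fin: "finite (pre ` A)" using card_A by (metis card.infinite finite_imageI not_numeral_le_zero)
  have card: "card (pre ` A) = w" using card_image[OF inj_on_pre] card_A by simp
  have 1: "pre {0} \<subset> x" if x: "x \<in> pre ` A" for x
  proof -
    obtain L where L: "x = pre L" "L \<in> A" using x by auto
    have "{0} \<noteq> L"
      using A_card(1)[OF L(2)] p_gt_1 n_pos by (metis card.empty card_insert_disjoint empty_iff
        finite.emptyI less_not_refl one_less_power One_nat_def)
    moreover have "{0} \<subseteq> L" using add_subgroupD(1)[OF A_sub(1)[OF L(2)]] by simp
    moreover have "{0} \<subseteq> V" "L \<subseteq> V" using A_sub(2)[OF L(2)] zero_V by auto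
    ultimately show ?thesis
      unfolding L(1) psubset_eq using pre_subset_iff[of "{0}" L] pi_pre by metis
  qed
  have 2: "x \<subset> pre V" if x: "x \<in> pre ` A" for x
  proof -
    obtain L where L: "x = pre L" "L \<in> A" using x by auto
    have "p ^ n < p ^ (2 * n)" using p_gt_1 n_pos by simp
    then have "L \<noteq> V" using A_card(1)[OF L(2)] card_V by auto
    moreover have "L \<subseteq> V" by (rule A_sub(2)[OF L(2)])
    ultimately show ?thesis
      unfolding L(1) psubset_eq using pre_subset_iff[of L V] pi_pre by (metis subset_refl)
  qed
  have 3: "x = y" if xy: "x \<in> pre ` A" "y \<in> pre ` A" "x \<subseteq> y" for x y
  proof -
    obtain L M where LM: "x = pre L" "L \<in> A" "y = pre M" "M \<in> A" using xy by auto
    then have "L = M" using xy(3) pre_subset_iff[of L M] A_sub(2) A_subset_eq by auto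
    then show ?thesis using LM by simp
  qed
  show "quasi_antichain (cd_lattice G) w"
    unfolding cd by (rule quasi_antichainI[OF fin card card_A(2) 1 2 3])
  show "cd_atoms G = pre ` A"
    unfolding cd_atoms_def cd by (rule quasi_antichainI[OF fin card card_A(2) 1 2 3])
qed

section \<open>Abelian atoms and the properties (P2) and (P3)\<close>

lemma property_P2: "property_P2 G"
  unfolding property_P2_def cd_atoms_eq
proof (intro ballI impI)
  fix X1 X2 assume "X1 \<in> pre ` A" "X2 \<in> pre ` A" "X1 \<noteq> X2"
  then obtain L M where LM: "X1 = pre L" "X2 = pre M" "L \<in> A" "M \<in> A" "L \<noteq> M" by auto
  obtain \<phi> where "bij_betw \<phi> L M" "\<forall>x\<in>L. \<forall>y\<in>L. \<phi> (x + y) = \<phi> x + \<phi> y"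
    using A_iso[OF LM(3,4)] by auto
  then have "mod_center G X1 \<cong> mod_center G X2"
    unfolding LM using LM A_sub by (intro mod_center_iso[where \<phi> = \<phi>]) auto
  moreover have "internal_direct_product (G Mod center G)
      (carrier (mod_center G X1)) (carrier (mod_center G X2))"
    unfolding LM using LM A_sub A_compl by (intro internal_direct_product_mod_center) auto
  ultimately show "mod_center G X1 \<cong> mod_center G X2 \<and>
    internal_direct_product (G Mod center G)
      (carrier (mod_center G X1)) (carrier (mod_center G X2))" ..
qed

lemma abelian_cd_atoms_eq: "abelian_cd_atoms G = pre ` {L \<in> A. \<forall>x\<in>L. \<forall>y\<in>L. B x y}"
proof -
  have "comm_group (G\<lparr>carrier := pre L\<rparr>) \<longleftrightarrow> (\<forall>x\<in>L. \<forall>y\<in>L. B x y)" if L: "L \<in> A" for L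
  proof
    assume "comm_group (G\<lparr>carrier := pre L\<rparr>)"
    then interpret C: comm_group "G\<lparr>carrier := pre L\<rparr>" .
    have "x \<otimes> y = y \<otimes> x" if "x \<in> pre L" "y \<in> pre L" for x y
      using C.m_comm[of x y] that by simp
    then have "B (\<pi> x) (\<pi> y)" if "x \<in> pre L" "y \<in> pre L" for x y
      using that commute_iff by (auto simp: pre_def)
    then have "\<forall>x\<in>\<pi> ` pre L. \<forall>y\<in>\<pi> ` pre L. B x y" by blast
    then show "\<forall>x\<in>L. \<forall>y\<in>L. B x y" unfolding pi_pre[OF A_sub(2)[OF L]] .
  next
    assume "\<forall>x\<in>L. \<forall>y\<in>L. B x y"
    then have comm: "x \<otimes> y = y \<otimes> x" if "x \<in> pre L" "y \<in> pre L" for x y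
      using that commute_iff by (auto simp: pre_def)
    interpret H: group "G\<lparr>carrier := pre L\<rparr>"
      by (rule subgroup_imp_group[OF subgroup_pre[OF A_sub(1)[OF L]]])
    show "comm_group (G\<lparr>carrier := pre L\<rparr>)"
      by (rule H.group_comm_groupI) (simp add: comm)
  qed
  then show ?thesis
    unfolding abelian_cd_atoms_def cd_atoms_eq by auto
qed

lemma card_abelian_cd_atoms:
  "card (abelian_cd_atoms G) = card {L \<in> A. \<forall>x\<in>L. \<forall>y\<in>L. B x y}"
  unfolding abelian_cd_atoms_eq by (rule card_image) (rule inj_on_subset[OF inj_on_pre], auto)

text \<open>Decompose each \<open>x\<^sub>i\<close> along \<open>V = L\<^sub>k \<oplus> L\<^sub>2\<close>.\<close>

lemma atom_generators:
  assumes L: "L1 \<in> A" "L2 \<in> A" "Lk \<in> A" "Lk \<noteq> L1" "Lk \<noteq> L2" "L1 \<noteq> L2"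
    and u: "int_span {1..n} u = L1"
  obtains v where "int_span {1..n} v = L2" "int_span {1..n} (\<lambda>i. u i + v i) = Lk"
proof -
  let ?I = "{1..n}"
  note sub = A_sub(1)[OF L(1)] A_sub(1)[OF L(2)] A_sub(1)[OF L(3)]
  have uL: "u i \<in> L1" if "i \<in> ?I" for i
    using int_span_incl[of ?I i u] that u by auto
  have "\<exists>v. v \<in> L2 \<and> u i + v \<in> Lk" if "i \<in> ?I" for i
  proof -
    have "u i \<in> V" using uL[OF that] A_sub(2)[OF L(1)] by auto
    then obtain x y where "x \<in> Lk" "y \<in> L2" "u i = x + y"
      using A_compl(2)[OF L(3,2,5)] by blast
    then show ?thesis using add_subgroupD(3)[OF sub(2)] by (intro exI[of _ "- y"]) auto
  qed
  then obtain v where v: "\<And>i. i \<in> ?I \<Longrightarrow> v i \<in> L2" "\<And>i. i \<in> ?I \<Longrightarrow> u i + v i \<in> Lk"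
    by metis
  have sum: "(\<Sum>i\<in>?I. of_int (c i) * (u i + v i)) =
      (\<Sum>i\<in>?I. of_int (c i) * u i) + (\<Sum>i\<in>?I. of_int (c i) * v i)" for c
    by (simp add: distrib_left sum.distrib)
  have mem: "(\<Sum>i\<in>?I. of_int (c i) * v i) \<in> L2" "(\<Sum>i\<in>?I. of_int (c i) * (u i + v i)) \<in> Lk" for c
    using v by (auto intro!: add_subgroup_sum add_subgroup_of_int sub)
  have "int_span ?I v = L2"
  proof (intro subset_antisym subsetI)
    fix y assume y: "y \<in> L2"
    then have "y \<in> V" using A_sub(2)[OF L(2)] by auto
    then obtain l m where lm: "l \<in> Lk" "m \<in> L1" "y = l + m"
      using A_compl(2)[OF L(3,1,4)] by blast
    from lm(2) u obtain c where c: "m = (\<Sum>i\<in>?I. of_int (c i) * u i)"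
      unfolding int_span_def by auto
    let ?v = "\<Sum>i\<in>?I. of_int (c i) * v i"
    \<comment> \<open>Adding \<open>?v\<close> completes the terms of \<open>m\<close> to multiples
      of \<open>u i + v i\<close>, which lie in \<open>Lk\<close>. Thus \<open>y + ?v\<close> lies
      in both \<open>Lk\<close> and \<open>L2\<close>.\<close>
    have "y + ?v = l + (\<Sum>i\<in>?I. of_int (c i) * (u i + v i))"
      unfolding sum lm(3) c by simp
    then have "y + ?v \<in> Lk" using lm(1) mem(2) add_subgroupD(2)[OF sub(3)] by metis
    moreover have "y + ?v \<in> L2" using y mem(1) add_subgroupD(2)[OF sub(2)] by metis
    ultimately have "y + ?v = 0" using A_compl(1)[OF L(3,2,5)] by blast
    then have "y = - ?v" by (simp add: eq_neg_iff_add_eq_0)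
    then show "y \<in> int_span ?I v"
      using add_subgroupD(3)[OF add_subgroup_int_span int_spanI[OF refl]] by metis
  qed (use mem(1) in \<open>auto simp: int_span_def\<close>)
  moreover have "int_span ?I (\<lambda>i. u i + v i) = Lk"
  proof (intro subset_antisym subsetI)
    fix y assume y: "y \<in> Lk"
    then have "y \<in> V" using A_sub(2)[OF L(3)] by auto
    then obtain l m where lm: "l \<in> L1" "m \<in> L2" "y = l + m"
      using A_compl(2)[OF L(1,2,6)] by blast
    from lm(1) u obtain c where c: "l = (\<Sum>i\<in>?I. of_int (c i) * u i)"
      unfolding int_span_def by auto
    let ?v = "\<Sum>i\<in>?I. of_int (c i) * v i" and ?w = "\<Sum>i\<in>?I. of_int (c i) * (u i + v i)"
    \<comment> \<open>The left side lies in \<open>Lk\<close> and the right side in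
      \<open>L2\<close>, so both vanish.\<close>
    have "y - ?w = m - ?v"
      unfolding sum lm(3) c by simp
    moreover have "y - ?w \<in> Lk" using y mem(2) add_subgroupD(4)[OF sub(3)] by metis
    moreover have "m - ?v \<in> L2" using lm(2) mem(1) add_subgroupD(4)[OF sub(2)] by metis
    ultimately have "y - ?w \<in> Lk \<inter> L2" by simp
    then have "y - ?w = 0" unfolding A_compl(1)[OF L(3,2,5)] by simp
    then have "y = ?w" by (simp only: right_minus_eq)
    then show "y \<in> int_span ?I (\<lambda>i. u i + v i)"
      by (rule int_spanI)
  qed (use mem(2) in \<open>auto simp: int_span_def\<close>)
  ultimately show thesis using that by blast
qed

text \<open>The elements \<open>y'\<close> lift the components found in
  \<open>atom_generators\<close>. Both \<open>y\<close> and \<open>y'\<close> then give bases of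
  \<open>L2\<close>, and the matrix is the change of basis between them.\<close>

lemma property_P3: "property_P3 p n G"
  unfolding property_P3_def cd_atoms_eq
proof (intro allI impI conjI ballI)
  let ?w = "card (pre ` A)"
  have w: "?w = w" using card_image[OF inj_on_pre] card_A by simp
  fix M assume M: "bij_betw M {1..?w} (pre ` A)"
  have atom: "\<exists>L\<in>A. M i = pre L" if "i \<in> {1..?w}" for i
    using bij_betwE[OF M] that by blast
  have i12: "1 \<in> {1..?w}" "2 \<in> {1..?w}" using card_A w by auto
  {
    fix i :: nat assume "i \<in> {1, 2}"
    then obtain L where L: "L \<in> A" "M i = pre L" using atom i12 by blast
    show "elementary_abelian p (mod_center G (M i))"
      using L elementary_abelian_mod_center A_sub by simp
    show "order (mod_center G (M i)) = p ^ n"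
      using L order_mod_center A_sub A_card(1) by simp
  }
  fix x y k
  assume xy: "generates_mod_center G n x (M 1) \<and> generates_mod_center G n y (M 2)"
    and k: "k \<in> {3..?w}"
  obtain L1 L2 Lk where L: "L1 \<in> A" "L2 \<in> A" "Lk \<in> A" "M 1 = pre L1" "M 2 = pre L2" "M k = pre Lk"
    using atom[OF i12(1)] atom[OF i12(2)] atom[of k] k by auto
  have inj: "i = j" if "M i = M j" "i \<in> {1..?w}" "j \<in> {1..?w}" for i j
    using M that by (auto simp: bij_betw_def dest: inj_onD)
  have ne: "Lk \<noteq> L1" "Lk \<noteq> L2" "L1 \<noteq> L2"
    using inj[of k 1] inj[of k 2] inj[of 1 2] L i12 k by auto
  have x: "x ` {1..n} \<subseteq> carrier G" "int_span {1..n} (\<lambda>i. \<pi> (x i)) = L1"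
    using xy L generates_mod_center_iff[OF A_sub(2)[OF L(1)]] by auto
  have y: "y ` {1..n} \<subseteq> carrier G" "int_span {1..n} (\<lambda>i. \<pi> (y i)) = L2"
    using xy L generates_mod_center_iff[OF A_sub(2)[OF L(2)]] by auto
  obtain v where v: "int_span {1..n} v = L2" "int_span {1..n} (\<lambda>i. \<pi> (x i) + v i) = Lk"
    using atom_generators[OF L(1-3) ne x(2)] .
  have vV: "v i \<in> V" if "i \<in> {1..n}" for i
    using int_span_incl[of "{1..n}" i v] that v(1) A_sub(2)[OF L(2)] by auto
  then have "\<exists>g. g \<in> carrier G \<and> \<pi> g = v i" if "i \<in> {1..n}" for i
    using that V by (metis imageE)
  then obtain y' where y': "\<And>i. i \<in> {1..n} \<Longrightarrow> y' i \<in> carrier G" "\<And>i. i \<in> {1..n} \<Longrightarrow> \<pi> (y' i) = v i"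
    by metis
  have xi: "x i \<in> carrier G" and yi: "y i \<in> carrier G" if "i \<in> {1..n}" for i
    using x(1) y(1) that by auto
  have span_cong: "int_span I f = int_span I g" if "\<And>i. i \<in> I \<Longrightarrow> f i = g i" for I and f g :: "nat \<Rightarrow> 'v"
    unfolding int_span_def using that by (intro image_cong refl sum.cong) auto
  have y'span: "int_span {1..n} (\<lambda>i. \<pi> (y' i)) = L2"
    using span_cong[of "{1..n}" "\<lambda>i. \<pi> (y' i)" v] y'(2) v(1) by simp
  have "generates_mod_center G n y' (M 2)"
    unfolding L generates_mod_center_iff[OF A_sub(2)[OF L(2)]] using y'span y'(1) by auto
  moreover have "generates_mod_center G n (\<lambda>i. x i \<otimes> y' i) (M k)"
    unfolding L generates_mod_center_iff[OF A_sub(2)[OF L(3)]]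
  proof
    show "(\<lambda>i. x i \<otimes> y' i) ` {1..n} \<subseteq> carrier G" using xi y'(1) by auto
    show "int_span {1..n} (\<lambda>i. \<pi> (x i \<otimes> y' i)) = Lk"
      using span_cong[of "{1..n}" "\<lambda>i. \<pi> (x i \<otimes> y' i)" "\<lambda>i. \<pi> (x i) + v i"] v(2) xi y' pi_mult
      by simp
  qed
  moreover obtain c where c: "invertible_matrix (residue_ring (int p)) n c"
      "\<And>j. j \<in> {1..n} \<Longrightarrow> \<pi> (y' j) = (\<Sum>i\<in>{1..n}. of_int (c i j) * \<pi> (y i))"
  proof (rule int_span_change_of_basis[OF prime_p, of n "\<lambda>i. \<pi> (y i)" "\<lambda>i. \<pi> (y' i)"])
    show "card (int_span {1..n} (\<lambda>i. \<pi> (y i))) = p ^ n"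
      using y(2) A_card(1)[OF L(2)] by simp
  qed (use y'(1) yi char_V pi_in_V y(2) y'span in auto)
  moreover have "center G #> y' j = center G #> ordered_prod G n (\<lambda>i. y i [^] (c i j :: int))"
    if j: "j \<in> {1..n}" for j
  proof -
    have "(\<lambda>i. y i [^] (c i j :: int)) ` {1..n} \<subseteq> carrier G" using yi by auto
    from ordered_prod_closed_pi[OF this]
    have "ordered_prod G n (\<lambda>i. y i [^] (c i j :: int)) \<in> carrier G"
      "\<pi> (ordered_prod G n (\<lambda>i. y i [^] (c i j :: int))) = \<pi> (y' j)"
      using yi j by (auto simp: c(2) pi_int_pow)
    then show ?thesis using coset_center y'(1)[OF j] by simp
  qed
  ultimately show "\<exists>y'. generates_mod_center G n y' (M 2) \<and>
      generates_mod_center G n (\<lambda>i. x i \<otimes> y' i) (M k) \<and>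
      (\<exists>c. invertible_matrix (residue_ring (int p)) n c \<and>
        (\<forall>j\<in>{1..n}. center G #> y' j =
          center G #> ordered_prod G n (\<lambda>i. y i [^] (c i j :: int))))"
    by blast
qed

lemma order_Mod_center: "order (G Mod center G) = p ^ (2 * n)"
  using order_mod_center[of V] by (simp add: Mod_center_eq pre_V card_V)

end

section \<open>The alternating form\<close>

context finite_subfield
begin

abbreviation (input) q :: nat where "q \<equiv> p ^ a"

lemma p_gt_0: "p > 0"
  using prime_p by (simp add: prime_gt_0_nat)

lemma q_gt_1: "q > 1"
  by (rule one_less_power[OF prime_gt_1_nat[OF prime_p] a_pos])

lemma finite_F: "finite F"
proof (rule ccontr)
  assume "infinite F"
  then have "p ^ a = 0" using card_F by simp
  then show False using q_gt_1 by linarith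
qed

lemma e_nonzero: "e \<noteq> 0"
proof
  assume "e = 0"
  then have "F \<subseteq> {0}" using e_mult by auto
  then have "card F \<le> 1" using card_mono[of "{0 :: 'k}" F] by simp
  then show False using card_F q_gt_1 by simp
qed

lemma mult_e: "x \<in> F \<Longrightarrow> x * e = x"
  using e_mult[of x] by (simp add: mult.commute[of x e])

lemma diff_F: "x \<in> F \<Longrightarrow> y \<in> F \<Longrightarrow> x - y \<in> F"
  using add_F[of x "- y"] uminus_F[of y] by simp

lemma mult_zero_F: "x \<in> F \<Longrightarrow> y \<in> F \<Longrightarrow> x * y = 0 \<Longrightarrow> x \<noteq> 0 \<Longrightarrow> y = 0"
  using inverse_F[of x] e_mult[of y] by (metis mult.assoc mult.commute mult_zero_right)

text \<open>Extension by zero, rather than by \<open>undefined\<close>, makes these functions closed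
  under the pointwise operations of the function type.\<close>

definition fvec :: "'i set \<Rightarrow> ('i \<Rightarrow> 'k) set"
  where "fvec S = {f. \<forall>i. if i \<in> S then f i \<in> F else f i = 0}"

lemma fvecD: "f \<in> fvec S \<Longrightarrow> f i \<in> F"
  using zero_F unfolding fvec_def by (metis (mono_tags, lifting) mem_Collect_eq)

lemma fvec_outside: "f \<in> fvec S \<Longrightarrow> i \<notin> S \<Longrightarrow> f i = 0"
  unfolding fvec_def by auto

lemma fvecI: "(\<And>i. i \<in> S \<Longrightarrow> f i \<in> F) \<Longrightarrow> (\<And>i. i \<notin> S \<Longrightarrow> f i = 0) \<Longrightarrow> f \<in> fvec S"
  unfolding fvec_def by auto

lemma fvec_zero: "0 \<in> fvec S"
  by (rule fvecI) (simp_all add: zero_F)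

lemma fvec_add: "f \<in> fvec S \<Longrightarrow> g \<in> fvec S \<Longrightarrow> f + g \<in> fvec S"
  by (rule fvecI) (simp_all add: add_F fvecD fvec_outside)

lemma fvec_uminus: "f \<in> fvec S \<Longrightarrow> - f \<in> fvec S"
  by (rule fvecI) (simp_all add: uminus_F fvecD fvec_outside)

lemma add_subgroup_fvec: "add_subgroup (fvec S)"
  by (simp add: add_subgroup_def fvec_zero fvec_add fvec_uminus)

lemma fvec_char: "f \<in> fvec S \<Longrightarrow> of_nat p * f = 0" for f :: "'i \<Rightarrow> 'k"
proof
  fix i :: 'i assume "f \<in> fvec S"
  then have "of_nat p * f i = 0" by (rule char_F[OF fvecD])
  moreover have "(of_nat k :: 'i \<Rightarrow> 'k) i = of_nat k" for k by (induction k) auto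
  ultimately show "(of_nat p * f) i = 0 i" by simp
qed

lemma bij_betw_fvec: "bij_betw (\<lambda>f. restrict f S) (fvec S) (PiE S (\<lambda>_. F))"
  by (rule bij_betw_byWitness[where f' = "\<lambda>g i. if i \<in> S then g i else 0"])
    (auto simp: fvec_def fun_eq_iff split: if_splits intro!: PiE_I dest: PiE_mem)

lemma card_fvec: "finite S \<Longrightarrow> card (fvec S) = q ^ card S"
  using bij_betw_same_card[OF bij_betw_fvec[of S]] by (simp add: card_PiE card_F)

lemma finite_fvec: "finite S \<Longrightarrow> finite (fvec S)"
  using bij_betw_finite[OF bij_betw_fvec[of S]] by (simp add: finite_PiE finite_F)

end

section \<open>The form and its values on pure tensors\<close>

locale alternating_form = finite_subfield F e p a
  for F :: "'k :: comm_ring_1 set" and e p a +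
  fixes r :: nat
  assumes r: "r \<ge> 3"
begin

text \<open>The diagonal coefficient of \<open>S\<close>. In characteristic 2 the hyperbolic form is
  alternating, which would make every line isotropic; with the additional term \<open>e\<close> the
  value \<open>S(s, s)\<close> is the square of the first coordinate of \<open>s\<close>, and only
  the line of \<open>(0, e)\<close> is isotropic.\<close>

definition eps :: 'k where "eps = (if p = 2 then e else 0)"

definition vecs :: "(nat \<Rightarrow> 'k) set" where "vecs = fvec {..<r}"

definition V :: "(bool \<times> nat \<Rightarrow> 'k) set" where "V = fvec (UNIV \<times> {..<r})"

abbreviation (input) fst_part :: "(bool \<times> nat \<Rightarrow> 'k) \<Rightarrow> nat \<Rightarrow> 'k"
  where "fst_part x \<equiv> (\<lambda>i. x (False, i))"

abbreviation (input) snd_part :: "(bool \<times> nat \<Rightarrow> 'k) \<Rightarrow> nat \<Rightarrow> 'k"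
  where "snd_part x \<equiv> (\<lambda>i. x (True, i))"

text \<open>The vanishing of \<open>u \<and> v\<close>, expressed by its \<open>2 \<times> 2\<close>
  minors.\<close>

definition par :: "(nat \<Rightarrow> 'k) \<Rightarrow> (nat \<Rightarrow> 'k) \<Rightarrow> bool"
  where "par u v \<longleftrightarrow> (\<forall>i j. u i * v j = u j * v i)"

text \<open>The vanishing of \<open>x\<^sub>1 \<and> y\<^sub>2 + x\<^sub>2 \<and> y\<^sub>1 + \<epsilon> x\<^sub>1 \<and> y\<^sub>1\<close> for \<open>x = (x\<^sub>1, x\<^sub>2)\<close> and
  \<open>y = (y\<^sub>1, y\<^sub>2)\<close>.\<close>

definition B :: "(bool \<times> nat \<Rightarrow> 'k) \<Rightarrow> (bool \<times> nat \<Rightarrow> 'k) \<Rightarrow> bool"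
  where "B x y \<longleftrightarrow> (\<forall>i j.
    x (False, i) * y (True, j) - x (False, j) * y (True, i) +
    (x (True, i) * y (False, j) - x (True, j) * y (False, i)) +
    eps * (x (False, i) * y (False, j) - x (False, j) * y (False, i)) = 0)"

text \<open>The pure tensor of \<open>(s, t)\<close> and \<open>u\<close>, as a
  \<open>2 \<times> r\<close> matrix whose rows are indexed by \<open>False\<close> and
  \<open>True\<close>.\<close>

definition tens :: "'k \<Rightarrow> 'k \<Rightarrow> (nat \<Rightarrow> 'k) \<Rightarrow> bool \<times> nat \<Rightarrow> 'k"
  where "tens s t u = (\<lambda>(b, i). if b then t * u i else s * u i)"

definition L :: "'k \<Rightarrow> 'k \<Rightarrow> (bool \<times> nat \<Rightarrow> 'k) set"
  where "L s t = tens s t ` vecs"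

text \<open>Normalised representatives of the points of the projective line over
  \<open>F\<close>.\<close>

definition P :: "('k \<times> 'k) set"
  where "P = Pair e ` F \<union> {(0, e)}"

text \<open>The contraction of \<open>y\<close> with the linear form \<open>S((s, t), _)\<close>. It
  reduces orthogonality to a pure tensor over \<open>u\<close> to the vanishing of the wedge product
  of \<open>u\<close> and \<open>ell s t y\<close>; see \<open>B_tens\<close>.\<close>

definition ell :: "'k \<Rightarrow> 'k \<Rightarrow> (bool \<times> nat \<Rightarrow> 'k) \<Rightarrow> nat \<Rightarrow> 'k"
  where "ell s t y = (\<lambda>i. s * y (True, i) + (t + eps * s) * y (False, i))"

definition line :: "(nat \<Rightarrow> 'k) \<Rightarrow> (nat \<Rightarrow> 'k) set"
  where "line u = (\<lambda>c i. c * u i) ` F"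

lemma eps_F: "eps \<in> F"
  by (simp add: eps_def e_F zero_F)

lemma P_F: "(s, t) \<in> P \<Longrightarrow> s \<in> F \<and> t \<in> F"
  unfolding P_def using e_F zero_F by auto

lemma P_cases:
  assumes "(s, t) \<in> P"
  obtains "s = e" "t \<in> F" | "s = 0" "t = e"
  using assms unfolding P_def by auto

lemma vecs_D: "u \<in> vecs \<Longrightarrow> u i \<in> F"
  unfolding vecs_def by (rule fvecD)

lemma V_D: "x \<in> V \<Longrightarrow> x bi \<in> F"
  unfolding V_def by (rule fvecD)

lemma V_iff: "x \<in> V \<longleftrightarrow> fst_part x \<in> vecs \<and> snd_part x \<in> vecs"
  unfolding V_def vecs_def fvec_def by (auto split: if_splits) (metis (full_types))+

lemma V_parts: "x \<in> V \<Longrightarrow> fst_part x \<in> vecs" "x \<in> V \<Longrightarrow> snd_part x \<in> vecs"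
  by (simp_all add: V_iff)

lemma parts_ext: "fst_part x = fst_part y \<Longrightarrow> snd_part x = snd_part y \<Longrightarrow> x = y"
proof (rule ext)
  fix bi assume "fst_part x = fst_part y" "snd_part x = snd_part y"
  then show "x bi = y bi" by (cases bi; cases "fst bi") (auto dest: fun_cong)
qed

lemma vecs_lin: "u \<in> vecs \<Longrightarrow> v \<in> vecs \<Longrightarrow> c \<in> F \<Longrightarrow> d \<in> F \<Longrightarrow> (\<lambda>i. c * u i + d * v i) \<in> vecs"
  unfolding vecs_def by (rule fvecI) (simp_all add: add_F mult_F fvecD fvec_outside)

lemma vecs_smult: "u \<in> vecs \<Longrightarrow> c \<in> F \<Longrightarrow> (\<lambda>i. c * u i) \<in> vecs"
  unfolding vecs_def by (rule fvecI) (simp_all add: mult_F fvecD fvec_outside)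

lemma tens_simps [simp]: "tens s t u (False, i) = s * u i" "tens s t u (True, i) = t * u i"
  by (simp_all add: tens_def)

lemma tens_V: "(s, t) \<in> P \<Longrightarrow> u \<in> vecs \<Longrightarrow> tens s t u \<in> V"
  using P_F by (simp add: V_iff vecs_smult)

lemma tens_add: "tens s t (u + v) = tens s t u + tens s t v"
  by (auto simp: tens_def fun_eq_iff distrib_left)

lemma tens_zero [simp]: "tens s t 0 = 0"
  by (auto simp: tens_def fun_eq_iff)

lemma tens_inj:
  assumes "(s, t) \<in> P" "u \<in> vecs" "v \<in> vecs" "tens s t u = tens s t v"
  shows "u = v"
proof
  fix i
  have "s * u i = s * v i" "t * u i = t * v i"
    using assms(4) by (metis tens_simps(1), metis tens_simps(2))
  then show "u i = v i"
    using assms(1-3) by (cases rule: P_cases[OF assms(1)]) (simp_all add: e_mult vecs_D)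
qed

lemma ell_vecs: "(s, t) \<in> P \<Longrightarrow> y \<in> V \<Longrightarrow> ell s t y \<in> vecs"
  unfolding ell_def using P_F[of s t] by (intro vecs_lin V_parts) (auto simp: add_F mult_F eps_F)

lemma ell_e: "y \<in> V \<Longrightarrow> ell e t y = (\<lambda>i. y (True, i) + (t + eps) * y (False, i))"
  unfolding ell_def by (simp add: e_mult mult_e V_D eps_F)

lemma ell_0: "y \<in> V \<Longrightarrow> ell 0 e y = (\<lambda>i. y (False, i))"
  unfolding ell_def by (simp add: e_mult V_D)

lemma B_sym: "B x y \<longleftrightarrow> B y x"
proof -
  have "B y x" if "B x y" for x y
    unfolding B_def
  proof (intro allI)
    fix i j
    have "y (False, i) * x (True, j) - y (False, j) * x (True, i) +
      (y (True, i) * x (False, j) - y (True, j) * x (False, i)) +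
      eps * (y (False, i) * x (False, j) - y (False, j) * x (False, i)) =
      - (x (False, i) * y (True, j) - x (False, j) * y (True, i) +
      (x (True, i) * y (False, j) - x (True, j) * y (False, i)) +
      eps * (x (False, i) * y (False, j) - x (False, j) * y (False, i)))"
      by (simp add: algebra_simps)
    also have "\<dots> = 0" using that unfolding B_def by simp
    finally show "y (False, i) * x (True, j) - y (False, j) * x (True, i) +
      (y (True, i) * x (False, j) - y (True, j) * x (False, i)) +
      eps * (y (False, i) * x (False, j) - y (False, j) * x (False, i)) = 0" .
  qed
  then show ?thesis by blast
qed

lemma B_add: "B x z \<Longrightarrow> B y z \<Longrightarrow> B (x + y) z"
proof -
  assume *: "B x z" "B y z"
  show "B (x + y) z"
    unfolding B_def
  proof (intro allI)
    fix i j
    let ?f = "\<lambda>x. x (False, i) * z (True, j) - x (False, j) * z (True, i) +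
      (x (True, i) * z (False, j) - x (True, j) * z (False, i)) +
      eps * (x (False, i) * z (False, j) - x (False, j) * z (False, i))"
    have "?f (x + y) = ?f x + ?f y" by (simp add: algebra_simps)
    also have "\<dots> = 0" using * unfolding B_def by simp
    finally show "?f (x + y) = 0" .
  qed
qed

lemma B_tens: "B (tens s t u) y \<longleftrightarrow> par u (ell s t y)"
proof -
  have "tens s t u (False, i) * y (True, j) - tens s t u (False, j) * y (True, i) +
    (tens s t u (True, i) * y (False, j) - tens s t u (True, j) * y (False, i)) +
    eps * (tens s t u (False, i) * y (False, j) - tens s t u (False, j) * y (False, i)) =
    u i * ell s t y j - u j * ell s t y i" for i j
    by (simp add: ell_def algebra_simps)
  then show ?thesis unfolding B_def par_def by simp
qed

lemma par_line:
  assumes "u \<in> vecs" "v \<in> vecs" "u \<noteq> 0" "par u v"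
  shows "v \<in> line u"
proof -
  obtain i where i: "u i \<noteq> 0" using assms(3) by (auto simp: fun_eq_iff)
  obtain d where d: "d \<in> F" "u i * d = e" using inverse_F[OF vecs_D[OF assms(1)] i] by auto
  have "v j = d * v i * u j" for j
  proof -
    have "v j = u i * d * v j" using d assms(2) by (simp add: e_mult vecs_D)
    also have "\<dots> = d * (u i * v j)" by (simp add: mult_ac)
    also have "u i * v j = u j * v i" using assms(4) by (simp add: par_def)
    finally show ?thesis by (simp add: mult_ac)
  qed
  then have "v = (\<lambda>j. d * v i * u j)" by (rule ext)
  moreover have "d * v i \<in> F" using d(1) assms(2) by (simp add: mult_F vecs_D)
  ultimately show ?thesis unfolding line_def by (rule image_eqI)
qed

lemma line_vecs: "u \<in> vecs \<Longrightarrow> line u \<subseteq> vecs"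
  by (auto simp: line_def vecs_smult)

lemma finite_line: "finite (line u)"
  by (simp add: line_def finite_F)

lemma card_line: "card (line u) \<le> q"
  unfolding line_def using card_image_le[OF finite_F] card_F by metis

lemma line_trans: "v \<in> line u \<Longrightarrow> w \<in> line v \<Longrightarrow> w \<in> line u"
  unfolding line_def by (auto simp: mult_F simp flip: mult.assoc intro!: image_eqI)

lemma zero_line: "0 \<in> line u"
  unfolding line_def using zero_F by (auto intro!: image_eqI[of _ _ 0])

lemma line_sym:
  assumes "u \<in> vecs" "v \<in> line u" "v \<noteq> 0"
  shows "u \<in> line v"
proof (rule par_line)
  show "v \<in> vecs" using line_vecs assms by blast
  show "par v u" using assms(2) by (auto simp: line_def par_def mult_ac)
qed (use assms in auto)

lemma finite_vecs: "finite vecs" and card_vecs: "card vecs = q ^ r"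
  by (simp_all add: vecs_def finite_fvec card_fvec)

lemma finite_V: "finite V" and card_V: "card V = q ^ (2 * r)"
  by (simp_all add: V_def finite_fvec card_fvec card_cartesian_product UNIV_bool mult_2)

section \<open>The subspaces attached to the lines and their orthogonal spaces\<close>

lemma card_L:
  assumes "(s, t) \<in> P"
  shows "card (L s t) = q ^ r"
proof -
  have "inj_on (tens s t) vecs" using tens_inj[OF assms] by (intro inj_onI)
  then show ?thesis by (simp add: L_def card_image card_vecs)
qed

lemma L_V: "(s, t) \<in> P \<Longrightarrow> L s t \<subseteq> V"
  by (auto simp: L_def tens_V)

lemma add_subgroup_L: "add_subgroup (L s t)"
  unfolding add_subgroup_def L_def vecs_def
proof (intro conjI ballI)
  show "0 \<in> tens s t ` fvec {..<r}"
    using fvec_zero tens_zero by (metis image_eqI)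
next
  fix x y assume "x \<in> tens s t ` fvec {..<r}" "y \<in> tens s t ` fvec {..<r}"
  then obtain u v where "x = tens s t u" "u \<in> fvec {..<r}" "y = tens s t v" "v \<in> fvec {..<r}" by auto
  then show "x + y \<in> tens s t ` fvec {..<r}"
    using fvec_add by (auto simp flip: tens_add)
next
  fix x assume "x \<in> tens s t ` fvec {..<r}"
  then obtain u where u: "x = tens s t u" "u \<in> fvec {..<r}" by auto
  have "- x = tens s t (- u)" unfolding u by (auto simp: tens_def fun_eq_iff)
  then show "- x \<in> tens s t ` fvec {..<r}"
    using fvec_uminus[OF u(2)] by (rule image_eqI)
qed

text \<open>The map \<open>ell s t\<close> is one coordinate of a linear bijection \<open>V \<cong> vecs \<times> vecs\<close>.\<close>

lemma card_ell_vimage: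
  assumes "(s, t) \<in> P" "S \<subseteq> vecs"
  shows "card {y \<in> V. ell s t y \<in> S} \<le> card S * q ^ r"
proof -
  \<comment> \<open>For \<open>s = e\<close> the contraction determines the second row once the
    first is known; for \<open>s = 0\<close> it is the first row itself.\<close>
  define c where "c = (\<lambda>y. (ell s t y, if s = 0 then snd_part y else fst_part y))"
  have "inj_on c {y \<in> V. ell s t y \<in> S}"
  proof (rule inj_onI)
    fix x y assume x: "x \<in> {y \<in> V. ell s t y \<in> S}" and y: "y \<in> {y \<in> V. ell s t y \<in> S}" and c: "c x = c y"
    from assms(1) show "x = y"
    proof (cases rule: P_cases)
      case 1
      have f: "fst_part x = fst_part y" using c 1 e_nonzero by (simp add: c_def)
      moreover have "snd_part x = snd_part y"
      proof
        fix i
        have "ell e t x i = ell e t y i" using c 1 by (simp add: c_def)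
        then show "x (True, i) = y (True, i)"
          using x y fun_cong[OF f, of i] by (simp add: ell_e)
      qed
      ultimately show ?thesis by (rule parts_ext)
    next
      case 2
      then show ?thesis using c x y by (intro parts_ext) (auto simp: c_def ell_0)
    qed
  qed
  moreover have "c ` {y \<in> V. ell s t y \<in> S} \<subseteq> S \<times> vecs"
    using V_parts by (auto simp: c_def)
  moreover have "finite (S \<times> vecs)" using finite_subset[OF assms(2) finite_vecs] finite_vecs by simp
  ultimately have "card {y \<in> V. ell s t y \<in> S} \<le> card (S \<times> vecs)"
    by (rule card_inj_on_le)
  then show ?thesis by (simp add: card_cartesian_product card_vecs)
qed

lemma det_nonzero:
  assumes "(s, t) \<in> P" "(s', t') \<in> P" "(s, t) \<noteq> (s', t')"
  shows "s * t' - s' * t \<in> F" "s * t' - s' * t \<noteq> 0"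
proof -
  show "s * t' - s' * t \<in> F" using P_F[OF assms(1)] P_F[OF assms(2)] by (simp add: diff_F mult_F)
  show "s * t' - s' * t \<noteq> 0"
    using assms e_nonzero e_F
    by (cases rule: P_cases[OF assms(1)]; cases rule: P_cases[OF assms(2)]) (auto simp: e_mult)
qed

text \<open>The rows of a sum of two pure tensors are combinations of \<open>u\<close> and
  \<open>v\<close>, so its \<open>2 \<times> 2\<close> minors are those of \<open>u\<close> and
  \<open>v\<close> times the determinant \<open>s * t' - s' * t\<close>.\<close>

lemma par_of_sum:
  assumes "(s, t) \<in> P" "(s', t') \<in> P" "(s, t) \<noteq> (s', t')" "u \<in> vecs" "v \<in> vecs"
    and "par (\<lambda>i. s * u i + s' * v i) (\<lambda>i. t * u i + t' * v i)"
  shows "par u v"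
  unfolding par_def
proof (intro allI)
  fix i j
  have "(s * t' - s' * t) * (u i * v j - u j * v i) =
    (s * u i + s' * v i) * (t * u j + t' * v j) - (s * u j + s' * v j) * (t * u i + t' * v i)"
    by (simp add: algebra_simps)
  also have "\<dots> = 0" using assms(6) by (simp add: par_def)
  finally have z: "(s * t' - s' * t) * (u i * v j - u j * v i) = 0" .
  have "u i * v j - u j * v i = 0"
    by (rule mult_zero_F[OF det_nonzero(1)[OF assms(1-3)] _ z det_nonzero(2)[OF assms(1-3)]])
      (use assms(4,5) in \<open>simp add: diff_F mult_F vecs_D\<close>)
  then show "u i * v j = u j * v i" by simp
qed

lemma L_inter:
  assumes "(s, t) \<in> P" "(s', t') \<in> P" "(s, t) \<noteq> (s', t')"
  shows "L s t \<inter> L s' t' = {0}"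
proof -
  have "x = 0" if x: "x \<in> L s t" "x \<in> L s' t'" for x
  proof -
    obtain u v where uv: "x = tens s t u" "u \<in> vecs" "x = tens s' t' v" "v \<in> vecs"
      using x unfolding L_def by blast
    have "u i = 0" for i
    proof -
      have eq: "s * u i = s' * v i" "t * u i = t' * v i"
        using uv(1,3) by (metis tens_simps(1), metis tens_simps(2))
      have "(s * t' - s' * t) * u i = t' * (s * u i) - s' * (t * u i)" by (simp add: algebra_simps)
      also have "\<dots> = 0" unfolding eq by (simp add: algebra_simps)
      finally show ?thesis
        using mult_zero_F[OF det_nonzero(1)[OF assms] _ _ det_nonzero(2)[OF assms]] vecs_D[OF uv(2)]
        by blast
    qed
    then have "u = 0" by (simp add: fun_eq_iff)
    then show ?thesis using uv(1) by simp
  qed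
  moreover have "0 \<in> L s t" "0 \<in> L s' t'"
    using add_subgroupD(1)[OF add_subgroup_L] by auto
  ultimately show ?thesis by blast
qed

lemma L_sum:
  assumes "(s, t) \<in> P" "(s', t') \<in> P" "(s, t) \<noteq> (s', t')" "v \<in> V"
  shows "\<exists>x\<in>L s t. \<exists>y\<in>L s' t'. v = x + y"
proof -
  obtain d where d: "d \<in> F" "(s * t' - s' * t) * d = e"
    using inverse_F[OF det_nonzero[OF assms(1-3)]] by auto
  note F = P_F[OF assms(1)] P_F[OF assms(2)]
  \<comment> \<open>The coefficients are those of the inverse matrix, by Cramer's rule.\<close>
  define u where "u = (\<lambda>i. d * t' * v (False, i) + d * (- s') * v (True, i))"
  define w where "w = (\<lambda>i. d * (- t) * v (False, i) + d * s * v (True, i))"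
  have c: "d * t' \<in> F" "d * (- s') \<in> F" "d * (- t) \<in> F" "d * s \<in> F"
    using F d(1) by (simp_all add: mult_F uminus_F)
  have "u \<in> vecs" "w \<in> vecs"
    unfolding u_def w_def
    using vecs_lin[OF V_parts(1)[OF assms(4)] V_parts(2)[OF assms(4)]] c by blast+
  moreover have "v = tens s t u + tens s' t' w"
  proof (rule parts_ext; rule ext)
    fix i
    have "(tens s t u + tens s' t' w) (False, i) = (s * t' - s' * t) * d * v (False, i)"
      by (simp add: u_def w_def algebra_simps)
    then show "v (False, i) = (tens s t u + tens s' t' w) (False, i)"
      using d assms(4) by (simp add: e_mult V_D)
    have "(tens s t u + tens s' t' w) (True, i) = (s * t' - s' * t) * d * v (True, i)"
      by (simp add: u_def w_def algebra_simps)
    then show "v (True, i) = (tens s t u + tens s' t' w) (True, i)"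
      using d assms(4) by (simp add: e_mult V_D)
  qed
  ultimately show ?thesis unfolding L_def by blast
qed

lemma L_iso:
  assumes "(s, t) \<in> P" "(s', t') \<in> P"
  shows "\<exists>\<phi>. bij_betw \<phi> (L s t) (L s' t') \<and> (\<forall>x\<in>L s t. \<forall>y\<in>L s t. \<phi> (x + y) = \<phi> x + \<phi> y)"
proof -
  have inj: "inj_on (tens s t) vecs" "inj_on (tens s' t') vecs"
    using tens_inj assms by (auto intro!: inj_onI)
  define \<phi> where "\<phi> = (\<lambda>x. tens s' t' (inv_into vecs (tens s t) x))"
  have \<phi>: "\<phi> (tens s t u) = tens s' t' u" if "u \<in> vecs" for u
    using inj(1) that by (simp add: \<phi>_def)
  have "bij_betw \<phi> (L s t) (L s' t')"
    unfolding bij_betw_def L_def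
  proof
    show "inj_on \<phi> (tens s t ` vecs)"
      using \<phi> inj(2) by (auto intro!: inj_onI dest: inj_onD)
    show "\<phi> ` tens s t ` vecs = tens s' t' ` vecs"
      unfolding image_image using \<phi> by (intro image_cong) auto
  qed
  moreover have "\<phi> (x + y) = \<phi> x + \<phi> y" if xy: "x \<in> L s t" "y \<in> L s t" for x y
  proof -
    obtain u v where uv: "x = tens s t u" "u \<in> vecs" "y = tens s t v" "v \<in> vecs"
      using xy by (auto simp: L_def)
    have "u + v \<in> vecs" using uv fvec_add by (simp add: vecs_def)
    then show ?thesis using uv \<phi> by (simp flip: tens_add)
  qed
  ultimately show ?thesis by blast
qed

lemma par_all_zero:
  assumes "w \<in> vecs" "\<And>u. u \<in> vecs \<Longrightarrow> par u w"
  shows "w = 0"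
proof
  fix k :: nat
  \<comment> \<open>Any index below \<open>r\<close> other than \<open>k\<close> serves; the
    standard basis vector at \<open>j\<close> then detects the coordinate
    \<open>w k\<close>.\<close>
  define j where "j = (if k = 0 then 1 else 0 :: nat)"
  define u where "u = (\<lambda>i. if i = j then e else 0)"
  have "j < r" "j \<noteq> k" using r by (auto simp: j_def)
  then have "u \<in> vecs" unfolding vecs_def by (intro fvecI) (auto simp: u_def e_F zero_F)
  then have "u j * w k = u k * w j" using assms(2) by (auto simp: par_def)
  then show "w k = 0 k" using \<open>j \<noteq> k\<close> assms(1) by (simp add: u_def e_mult vecs_D)
qed

lemma perp_mem: "y \<in> perp B V U \<longleftrightarrow> y \<in> V \<and> (\<forall>u\<in>U. B u y)"
  unfolding perp_def using B_sym by blast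

lemma perp_L_ell:
  assumes "(s, t) \<in> P"
  shows "perp B V (L s t) = {y \<in> V. ell s t y = 0}"
  using par_all_zero[OF ell_vecs[OF assms]]
  by (auto simp: perp_mem L_def B_tens par_def)

text \<open>The slope solves \<open>S((e, t), (e, t')) = t' + t + eps = 0\<close>.\<close>

lemma perp_L_e:
  assumes "t \<in> F"
  shows "perp B V (L e t) = L e (- (t + eps))"
proof -
  have "- (t + eps) \<in> F" using assms by (intro uminus_F add_F eps_F)
  then have P: "(e, t) \<in> P" "(e, - (t + eps)) \<in> P"
    using assms unfolding P_def by blast+
  have "y \<in> V \<and> ell e t y = 0 \<longleftrightarrow> y \<in> L e (- (t + eps))" for y
  proof
    assume y: "y \<in> V \<and> ell e t y = 0"
    have "y (True, i) = - (t + eps) * y (False, i)" for i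
    proof -
      have "y (True, i) + (t + eps) * y (False, i) = 0"
        using y fun_cong[OF ell_e[of y t], of i] by simp
      then show ?thesis by (metis eq_neg_iff_add_eq_0 mult_minus_left)
    qed
    then have "y = tens e (- (t + eps)) (fst_part y)"
      using y by (intro parts_ext) (simp_all add: e_mult V_D)
    then show "y \<in> L e (- (t + eps))"
      unfolding L_def using y V_parts(1) by blast
  next
    assume "y \<in> L e (- (t + eps))"
    then obtain u where u: "y = tens e (- (t + eps)) u" "u \<in> vecs" by (auto simp: L_def)
    then have "y \<in> V" using tens_V[OF P(2)] by simp
    moreover have "ell e t y = 0"
    proof -
      have "ell e t y = (\<lambda>i. y (True, i) + (t + eps) * y (False, i))" by (rule ell_e) fact
      also have "\<dots> = 0" unfolding u(1) using u(2) by (simp add: fun_eq_iff e_mult vecs_D algebra_simps)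
      finally show ?thesis .
    qed
    ultimately show "y \<in> V \<and> ell e t y = 0" ..
  qed
  then show ?thesis unfolding perp_L_ell[OF P(1)] by blast
qed

lemma perp_L_0: "perp B V (L 0 e) = L 0 e"
proof -
  have P: "(0, e) \<in> P" by (simp add: P_def)
  have "y \<in> V \<and> ell 0 e y = 0 \<longleftrightarrow> y \<in> L 0 e" for y
  proof
    assume y: "y \<in> V \<and> ell 0 e y = 0"
    then have "y = tens 0 e (snd_part y)"
      by (intro parts_ext) (auto simp: ell_0 e_mult V_D fun_eq_iff)
    then show "y \<in> L 0 e" unfolding L_def using y V_parts(2) by blast
  next
    assume "y \<in> L 0 e"
    then obtain u where u: "y = tens 0 e u" "u \<in> vecs" by (auto simp: L_def)
    then have "y \<in> V" using tens_V[OF P] by simp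
    moreover have "ell 0 e y = 0"
    proof -
      have "ell 0 e y = (\<lambda>i. y (False, i))" by (rule ell_0) fact
      also have "\<dots> = 0" unfolding u(1) by (simp add: fun_eq_iff)
      finally show ?thesis .
    qed
    ultimately show "y \<in> V \<and> ell 0 e y = 0" ..
  qed
  then show ?thesis unfolding perp_L_ell[OF P] by blast
qed

lemma perp_L:
  assumes "(s, t) \<in> P"
  obtains s' t' where "(s', t') \<in> P" "perp B V (L s t) = L s' t'"
  using assms
proof (cases rule: P_cases)
  case 1
  have "- (t + eps) \<in> F" using 1(2) by (intro uminus_F add_F eps_F)
  then have "(e, - (t + eps)) \<in> P" unfolding P_def by blast
  with that show thesis using perp_L_e[OF 1(2)] 1 by blast
next
  case 2
  with that[of 0 e] show thesis using perp_L_0 by (simp add: P_def)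
qed

lemma perp_V: "perp B V V = {0}"
proof -
  have "y = 0" if y: "y \<in> perp B V V" for y
  proof -
    \<comment> \<open>The contractions with these two lines determine both rows of
      \<open>y\<close>.\<close>
    have P: "(0, e) \<in> P" "(e, 0) \<in> P" by (auto simp: P_def zero_F)
    have "y \<in> perp B V (L 0 e)" "y \<in> perp B V (L e 0)"
      using y L_V[OF P(1)] L_V[OF P(2)] by (auto simp: perp_mem)
    then have "y \<in> V" "ell 0 e y = 0" "ell e 0 y = 0"
      using perp_L_ell P by auto
    then show ?thesis by (intro parts_ext) (auto simp: ell_0 ell_e fun_eq_iff)
  qed
  moreover have "0 \<in> perp B V V"
    by (auto simp: perp_def B_def V_def fvec_zero)
  ultimately show ?thesis by blast
qed

section \<open>Rank and the cardinality bounds\<close>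

definition degenerate :: "(bool \<times> nat \<Rightarrow> 'k) \<Rightarrow> bool"
  where "degenerate x \<longleftrightarrow> par (fst_part x) (snd_part x)"

text \<open>A matrix of rank at most one is a pure tensor. If the first row vanishes the line is
  that of \<open>(0, e)\<close>; otherwise the second row is \<open>c\<close> times the first and
  the line is that of \<open>(e, c)\<close>.\<close>

lemma degenerate_tens:
  assumes "x \<in> V" "degenerate x"
  obtains s t u where "(s, t) \<in> P" "u \<in> vecs" "x = tens s t u"
proof (cases "fst_part x = 0")
  case True
  have "x = tens 0 e (snd_part x)"
    using True assms(1) by (intro parts_ext) (auto simp: e_mult V_D fun_eq_iff)
  then show thesis using that[of 0 e "snd_part x"] assms(1) by (simp add: P_def V_parts)
next
  case False
  have "snd_part x \<in> line (fst_part x)"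
    using assms False V_parts by (intro par_line) (auto simp: degenerate_def)
  then obtain c where c: "c \<in> F" "snd_part x = (\<lambda>i. c * x (False, i))"
    by (auto simp: line_def)
  have "x = tens e c (fst_part x)"
    using c(2) assms(1) by (intro parts_ext) (auto simp: e_mult V_D fun_eq_iff)
  then show thesis using that[of e c "fst_part x"] c(1) assms(1) by (simp add: P_def V_parts)
qed

text \<open>Cartan's lemma: if \<open>x\<^sub>1\<close>, \<open>x\<^sub>2\<close> are independent, the vectors orthogonal to \<open>x\<close> are given
  by symmetric \<open>2 \<times> 2\<close> matrices, with entries \<open>\<alpha>\<close>, \<open>\<beta>\<close>, \<open>\<gamma>\<close> here.\<close>

definition symm :: "(bool \<times> nat \<Rightarrow> 'k) \<Rightarrow> 'k \<Rightarrow> 'k \<Rightarrow> 'k \<Rightarrow> bool \<times> nat \<Rightarrow> 'k"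
  where "symm x \<alpha> \<beta> \<gamma> = (\<lambda>(b, i).
    if b then \<alpha> * x (False, i) + \<beta> * x (True, i) - eps * (\<beta> * x (False, i) + \<gamma> * x (True, i))
    else \<beta> * x (False, i) + \<gamma> * x (True, i))"

lemma nondegenerate_perp:
  assumes "x \<in> V" "\<not> degenerate x" "y \<in> V" "B x y"
  shows "y \<in> (\<lambda>(\<alpha>, \<beta>, \<gamma>). symm x \<alpha> \<beta> \<gamma>) ` (F \<times> F \<times> F)"
proof -
  \<comment> \<open>Adding \<open>eps * b\<close> to the second row of \<open>y\<close> absorbs the
    diagonal term: \<open>B x y\<close> becomes \<open>x1 \<and> c + x2 \<and> b = 0\<close>, whose
    coordinates are the values of \<open>E\<close>.\<close>
  define x1 x2 b c where "x1 = fst_part x" and "x2 = snd_part x" and "b = fst_part y"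
    and "c = (\<lambda>i. y (True, i) + eps * b i)"
  have F: "x1 i \<in> F" "x2 i \<in> F" "b i \<in> F" "c i \<in> F" for i
    using assms V_D by (auto simp: x1_def x2_def b_def c_def add_F mult_F eps_F)
  obtain i j where ij: "x1 i * x2 j - x1 j * x2 i \<noteq> 0"
    using assms(2) unfolding degenerate_def par_def x1_def x2_def by auto
  define D where "D = x1 i * x2 j - x1 j * x2 i"
  have "D \<in> F" using F by (simp add: D_def diff_F mult_F)
  then obtain d where d: "d \<in> F" "D * d = e" using inverse_F[of D] ij by (auto simp: D_def)
  define E where "E = (\<lambda>i j. x1 i * c j - x1 j * c i + (x2 i * b j - x2 j * b i))"
  have E: "E i j = 0" for i j
  proof -
    have "E i j = x (False, i) * y (True, j) - x (False, j) * y (True, i) +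
      (x (True, i) * y (False, j) - x (True, j) * y (False, i)) +
      eps * (x (False, i) * y (False, j) - x (False, j) * y (False, i))"
      by (simp add: E_def x1_def x2_def b_def c_def algebra_simps)
    then show ?thesis using assms(4) by (simp add: B_def)
  qed
  \<comment> \<open>Cramer's rule for expanding \<open>b\<close> and \<open>c\<close> in
    \<open>x1\<close> and \<open>x2\<close>, with the nonzero minor \<open>D\<close> as
    determinant.\<close>
  define \<alpha> \<beta> \<gamma> where "\<alpha> = d * (x2 j * c i - x2 i * c j)"
    and "\<beta> = d * (x2 j * b i - x2 i * b j)" and "\<gamma> = d * (x1 i * b j - x1 j * b i)"
  \<comment> \<open>The relation \<open>E i j = 0\<close> equates the two off-diagonal coefficients,
    which is the symmetry of the matrix.\<close>
  have \<beta>': "\<beta> = d * (x1 i * c j - x1 j * c i)"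
  proof -
    have "x1 i * c j - x1 j * c i = x2 j * b i - x2 i * b j + E i j"
      by (simp add: E_def)
    then show ?thesis by (simp add: \<beta>_def E)
  qed
  have Dd: "z = d * (D * z)" if "z \<in> F" for z
    using d(2) e_mult[OF that] by (metis mult.assoc mult.commute)
  have c: "c k = \<alpha> * x1 k + \<beta> * x2 k" for k
  proof -
    have "c k = d * (D * c k)" by (rule Dd[OF F(4)])
    also have "D * c k = x1 k * (x2 j * c i - x2 i * c j) + x2 k * (x2 j * b i - x2 i * b j)
        + (x2 j * E i k - x2 i * E j k)"
      by (simp add: D_def E_def algebra_simps)
    finally show ?thesis by (simp add: E \<alpha>_def \<beta>_def algebra_simps)
  qed
  have b: "b k = \<beta> * x1 k + \<gamma> * x2 k" for k
  proof -
    have "b k = d * (D * b k)" by (rule Dd[OF F(3)])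
    also have "D * b k = x1 k * (x1 i * c j - x1 j * c i) + x2 k * (x1 i * b j - x1 j * b i)
        + (x1 i * E j k - x1 j * E i k)"
      by (simp add: D_def E_def algebra_simps)
    finally show ?thesis by (simp add: E \<beta>' \<gamma>_def algebra_simps)
  qed
  have "y = symm x \<alpha> \<beta> \<gamma>"
  proof (rule parts_ext; rule ext)
    fix k
    show "y (False, k) = symm x \<alpha> \<beta> \<gamma> (False, k)"
      using b[of k] by (simp add: symm_def x1_def x2_def b_def)
    have "y (True, k) = c k - eps * b k" by (simp add: c_def)
    then show "y (True, k) = symm x \<alpha> \<beta> \<gamma> (True, k)"
      unfolding b[of k] c[of k] by (simp add: symm_def x1_def x2_def)
  qed
  moreover have "(\<alpha>, \<beta>, \<gamma>) \<in> F \<times> F \<times> F"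
    using F d(1) by (simp add: \<alpha>_def \<beta>_def \<gamma>_def diff_F mult_F)
  ultimately show ?thesis by force
qed

lemma card_symm: "card ((\<lambda>(\<alpha>, \<beta>, \<gamma>). symm x \<alpha> \<beta> \<gamma>) ` (F \<times> F \<times> F)) \<le> q ^ 3"
proof -
  have "card (F \<times> F \<times> F) = q ^ 3"
    by (simp add: card_cartesian_product card_F power3_eq_cube)
  then show ?thesis using card_image_le[of "F \<times> F \<times> F"] finite_F by (metis finite_cartesian_product)
qed

lemma finite_symm: "finite ((\<lambda>(\<alpha>, \<beta>, \<gamma>). symm x \<alpha> \<beta> \<gamma>) ` (F \<times> F \<times> F))"
  using finite_F by simp

lemma card_two_lines:
  assumes "S \<subseteq> V" "\<And>y. y \<in> S \<Longrightarrow> fst_part y \<in> line u" "\<And>y. y \<in> S \<Longrightarrow> snd_part y \<in> line v"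
  shows "card S \<le> q ^ 2"
proof -
  have "inj_on (\<lambda>y. (fst_part y, snd_part y)) S"
    using parts_ext by (intro inj_onI) blast
  moreover have "(\<lambda>y. (fst_part y, snd_part y)) ` S \<subseteq> line u \<times> line v"
    using assms by auto
  ultimately have "card S \<le> card (line u \<times> line v)"
    by (rule card_inj_on_le) (simp add: finite_line)
  also have "\<dots> \<le> q * q"
    unfolding card_cartesian_product by (intro mult_le_mono card_line)
  finally show ?thesis by (simp add: power2_eq_square)
qed

lemma q_pow_less: "m < 2 * r \<Longrightarrow> q ^ m < q ^ (2 * r)"
  using q_gt_1 by (intro power_strict_increasing)

text \<open>Both factors are at most \<open>q ^ 3\<close>, and
  \<open>q ^ 6 \<le> q ^ (2 * r)\<close>. Strictness needs an argument: if \<open>U\<close> has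
  \<open>q ^ 3\<close> elements, it is everything orthogonal to \<open>k\<close>, hence contains
  rank-one elements over each row of \<open>k\<close> that cut its orthogonal space down to
  \<open>q ^ 2\<close>.\<close>

lemma card_bound_nondegenerate:
  assumes U: "U \<subseteq> V" and x: "x \<in> U" "\<not> degenerate x"
    and k: "k \<in> perp B V U" "\<not> degenerate k"
  shows "card U * card (perp B V U) < q ^ (2 * r)"
proof -
  let ?T = "\<lambda>x. (\<lambda>(\<alpha>, \<beta>, \<gamma>). symm x \<alpha> \<beta> \<gamma>) ` (F \<times> F \<times> F)"
  have kV: "k \<in> V" using k(1) by (simp add: perp_mem)
  have UT: "U \<subseteq> ?T k"
  proof
    fix y assume "y \<in> U"
    then show "y \<in> ?T k"
      using nondegenerate_perp[OF kV k(2), of y] U k(1) by (auto simp: perp_def)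
  qed
  have "perp B V U \<subseteq> ?T x"
  proof
    fix y assume "y \<in> perp B V U"
    then show "y \<in> ?T x"
      using nondegenerate_perp[of x y] U x by (auto simp: perp_mem)
  qed
  then have K: "card (perp B V U) \<le> q ^ 3"
    using card_mono[OF finite_symm] card_symm[of x] by (meson le_trans)
  have Uq: "card U \<le> q ^ 3"
    using card_mono[OF finite_symm UT] card_symm[of k] by (meson le_trans)
  have six: "q ^ 6 \<le> q ^ (2 * r)"
    using r q_gt_1 by (intro power_increasing) auto
  show ?thesis
  proof (cases "card U = q ^ 3")
    case False
    then have "card U < q ^ 3" using Uq by simp
    then have "card U * q ^ 3 < q ^ 3 * q ^ 3"
      using p_gt_0 by (intro mult_strict_right_mono) auto
    moreover have "card U * card (perp B V U) \<le> card U * q ^ 3"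
      using K by (rule mult_le_mono2)
    ultimately have "card U * card (perp B V U) < q ^ 3 * q ^ 3" by linarith
    then show ?thesis using six by (simp flip: power_add)
  next
    case True
    then have "U = ?T k"
      using card_symm[of k] by (intro card_seteq[OF finite_symm UT]) simp
    have mem: "symm k \<alpha> \<beta> \<gamma> \<in> U" if "\<alpha> \<in> F" "\<beta> \<in> F" "\<gamma> \<in> F" for \<alpha> \<beta> \<gamma>
      unfolding \<open>U = ?T k\<close> using that by force
    have k1: "tens 0 e (fst_part k) \<in> U"
    proof -
      have "symm k e 0 0 = tens 0 e (fst_part k)"
        by (auto simp: symm_def tens_def fun_eq_iff)
      then show ?thesis using mem[of e 0 0] e_F zero_F by simp
    qed
    \<comment> \<open>The slope \<open>- eps\<close> cancels the \<open>eps\<close> in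
      \<open>ell\<close>, so the contraction with this line is exactly the second row.\<close>
    have k2: "tens e (- eps) (snd_part k) \<in> U"
    proof -
      have "symm k 0 0 e = tens e (- eps) (snd_part k)"
        using e_mult[OF V_D[OF kV]] by (auto simp: symm_def tens_def fun_eq_iff)
      then show ?thesis using mem[of 0 0 e] e_F zero_F by simp
    qed
    have nz: "fst_part k \<noteq> 0" "snd_part k \<noteq> 0"
    proof -
      obtain i j where "k (False, i) * k (True, j) \<noteq> k (False, j) * k (True, i)"
        using k(2) unfolding degenerate_def par_def by blast
      then show "fst_part k \<noteq> 0" "snd_part k \<noteq> 0"
        by (metis mult_zero_left zero_fun_apply, metis mult_zero_right zero_fun_apply)
    qed
    have "card (perp B V U) \<le> q ^ 2"
    proof (rule card_two_lines)
      fix y assume "y \<in> perp B V U"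
      then have y: "y \<in> V" "B (tens 0 e (fst_part k)) y" "B (tens e (- eps) (snd_part k)) y"
        using k1 k2 by (auto simp: perp_mem)
      then have "par (fst_part k) (fst_part y)" "par (snd_part k) (snd_part y)"
        by (simp_all add: B_tens ell_0 ell_e)
      then show "fst_part y \<in> line (fst_part k)" "snd_part y \<in> line (snd_part k)"
        using kV y(1) nz V_parts par_line by blast+
    qed (auto simp: perp_def)
    then have "card U * card (perp B V U) \<le> q ^ 3 * q ^ 2"
      using Uq by (rule mult_le_mono[rotated])
    also have "\<dots> < q ^ (2 * r)"
      using q_pow_less[of 5] r by (simp flip: power_add)
    finally show ?thesis .
  qed
qed

text \<open>Pure tensors over different lines have a degenerate sum only if their vectors are
  parallel. The cases below are: two lines, one direction; one line, one direction; one line, two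
  directions. The bounds are \<open>q ^ 4\<close>, \<open>q ^ (r + 2)\<close> and a proper subset of
  \<open>L s t\<close> against \<open>q ^ r\<close>.\<close>

lemma card_bound_degenerate:
  assumes U: "add_subgroup U" "U \<subseteq> V" "U \<noteq> {0}" and deg: "\<And>x. x \<in> U \<Longrightarrow> degenerate x"
    and notL: "\<And>s t. (s, t) \<in> P \<Longrightarrow> U \<noteq> L s t"
  shows "card U * card (perp B V U) < q ^ (2 * r)"
proof -
  obtain x where x: "x \<in> U" "x \<noteq> 0"
    using U(3) add_subgroupD(1)[OF U(1)] by blast
  obtain s t u where u: "(s, t) \<in> P" "u \<in> vecs" "x = tens s t u"
    using degenerate_tens[of x] U(2) x(1) deg by blast
  have u0: "u \<noteq> 0" using u x(2) by auto
  have cross: "v \<in> line u"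
    if "(s, t) \<in> P" "(s', t') \<in> P" "(s, t) \<noteq> (s', t')" "u \<in> vecs" "v \<in> vecs"
      "tens s t u \<in> U" "tens s' t' v \<in> U" "u \<noteq> 0" for s t s' t' u v
  proof -
    have "degenerate (tens s t u + tens s' t' v)"
      using that by (intro deg add_subgroupD(2)[OF U(1)])
    then have "par u v"
      using that by (intro par_of_sum[OF that(1-5)]) (simp add: degenerate_def)
    then show ?thesis using that by (intro par_line)
  qed
  have perp1: "ell s t y \<in> line u"
    if "(s, t) \<in> P" "u \<in> vecs" "tens s t u \<in> U" "u \<noteq> 0" "y \<in> perp B V U" for s t u y
  proof (rule par_line)
    have "B (tens s t u) y" using that by (simp add: perp_mem)
    then show "par u (ell s t y)" by (simp add: B_tens)
    show "ell s t y \<in> vecs" using that by (simp add: ell_vecs perp_mem)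
  qed (use that in auto)
  show ?thesis
  proof (cases "U \<subseteq> L s t")
    case False
    then obtain x' where x': "x' \<in> U" "x' \<notin> L s t" by blast
    obtain s' t' v where v: "(s', t') \<in> P" "v \<in> vecs" "x' = tens s' t' v"
      using degenerate_tens[of x'] U(2) x'(1) deg by blast
    have ne: "(s, t) \<noteq> (s', t')" using x' v by (auto simp: L_def)
    have v0: "v \<noteq> 0"
      using x'(2) v(3) add_subgroupD(1)[OF add_subgroup_L] by auto
    have vu: "v \<in> line u" using cross[OF u(1) v(1) ne u(2) v(2)] u v x x' u0 by simp
    \<comment> \<open>Comparison with \<open>x\<close> or \<open>x'\<close> through
      \<open>cross\<close> shows that every element of \<open>U\<close> is a pure tensor over a
      multiple of \<open>u\<close>.\<close>
    have "card U \<le> q ^ 2"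
    proof (rule card_two_lines[OF U(2)])
      fix y assume y: "y \<in> U"
      obtain s'' t'' w where w: "(s'', t'') \<in> P" "w \<in> vecs" "y = tens s'' t'' w"
        using degenerate_tens[of y] U(2) y deg by blast
      have "w \<in> line u"
      proof (cases "(s, t) = (s'', t'')")
        case False
        then show ?thesis using cross[OF u(1) w(1) _ u(2) w(2)] u w x y u0 by simp
      next
        case True
        \<comment> \<open>An element on the line of \<open>x\<close> has to be compared with
          \<open>x'\<close>, which lies on another line.\<close>
        then have "(s', t') \<noteq> (s'', t'')" using ne by metis
        then have "w \<in> line v" using cross[OF v(1) w(1) _ v(2) w(2)] v w x' y v0 by simp
        then show ?thesis using vu line_trans by blast
      qed
      then obtain c where "c \<in> F" "w = (\<lambda>i. c * u i)" by (auto simp: line_def)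
      then show "fst_part y \<in> line u" "snd_part y \<in> line u"
        unfolding line_def w(3) using P_F[OF w(1)]
        by (auto simp: mult_F simp flip: mult.assoc intro!: image_eqI)
    qed
    moreover have "card (perp B V U) \<le> q ^ 2"
    proof -
      \<comment> \<open>Contractions with two distinct lines determine \<open>y\<close>: a
        difference killed by both is orthogonal to two subspaces that together span
        \<open>V\<close>. Each contraction is confined to a line.\<close>
      define c where "c = (\<lambda>y. (ell s t y, ell s' t' y))"
      have "inj_on c (perp B V U)"
      proof (rule inj_onI)
        fix y z assume yz: "y \<in> perp B V U" "z \<in> perp B V U" "c y = c z"
        then have V: "y \<in> V" "z \<in> V" by (auto simp: perp_mem)
        define d where "d = y - z"
        have dV: "d \<in> V"
          using V add_subgroupD(4)[OF add_subgroup_fvec] unfolding V_def d_def by blast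
        have "ell s t d = ell s t y - ell s t z" "ell s' t' d = ell s' t' y - ell s' t' z"
          by (auto simp: ell_def d_def fun_eq_iff algebra_simps)
        then have "d \<in> perp B V (L s t)" "d \<in> perp B V (L s' t')"
          using yz(3) dV perp_L_ell[OF u(1)] perp_L_ell[OF v(1)] by (auto simp: c_def)
        have "d \<in> perp B V V"
        proof -
          have "B w d" if w: "w \<in> V" for w
          proof -
            obtain w1 w2 where "w1 \<in> L s t" "w2 \<in> L s' t'" "w = w1 + w2"
              using L_sum[OF u(1) v(1) ne w] by blast
            then show ?thesis
              using \<open>d \<in> perp B V (L s t)\<close> \<open>d \<in> perp B V (L s' t')\<close> by (auto simp: perp_mem intro: B_add)
          qed
          then show ?thesis using dV by (simp add: perp_mem)
        qed
        then show "y = z" unfolding perp_V by (simp add: d_def)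
      qed
      moreover have "c ` perp B V U \<subseteq> line u \<times> line v"
        using perp1[OF u(1,2)] perp1[OF v(1,2)] u v x x' u0 v0 by (auto simp: c_def)
      ultimately have "card (perp B V U) \<le> card (line u \<times> line v)"
        by (rule card_inj_on_le) (simp add: finite_line)
      also have "\<dots> \<le> q * q"
        unfolding card_cartesian_product by (intro mult_le_mono card_line)
      finally show ?thesis by (simp add: power2_eq_square)
    qed
    ultimately have "card U * card (perp B V U) \<le> q ^ 2 * q ^ 2"
      by (rule mult_le_mono)
    also have "\<dots> < q ^ (2 * r)"
      using q_pow_less[of 4] r by (simp flip: power_add)
    finally show ?thesis .
  next
    case True
    show ?thesis
    proof (cases "U \<subseteq> tens s t ` line u")
      case True
      have "card U \<le> q"
        using card_mono[OF _ True] card_image_le[OF finite_line] card_line finite_line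
        by (meson finite_imageI le_trans)
      moreover have "card (perp B V U) \<le> card (line u) * q ^ r"
      proof -
        have "perp B V U \<subseteq> {y \<in> V. ell s t y \<in> line u}"
          using perp1[OF u(1,2)] u x u0 by (auto simp: perp_mem)
        then have "card (perp B V U) \<le> card {y \<in> V. ell s t y \<in> line u}"
          using finite_V by (intro card_mono) auto
        also have "\<dots> \<le> card (line u) * q ^ r"
          by (rule card_ell_vimage[OF u(1) line_vecs[OF u(2)]])
        finally show ?thesis .
      qed
      then have "card (perp B V U) \<le> q * q ^ r"
        using card_line[of u] by (meson le_trans mult_le_mono1)
      ultimately have "card U * card (perp B V U) \<le> q * (q * q ^ r)"
        by (rule mult_le_mono)
      \<comment> \<open>The inequality \<open>r + 2 < 2 * r\<close> uses
        \<open>r \<ge> 3\<close>.\<close>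
      also have "\<dots> < q ^ (2 * r)"
        using q_pow_less[of "r + 2"] r by simp
      finally show ?thesis .
    next
      case False
      then obtain x' where x': "x' \<in> U" "x' \<notin> tens s t ` line u" by blast
      then obtain v where v: "v \<in> vecs" "x' = tens s t v" using \<open>U \<subseteq> L s t\<close> by (auto simp: L_def)
      have vu: "v \<notin> line u" using v x' by auto
      then have v0: "v \<noteq> 0" using zero_line by auto
      \<comment> \<open>The contraction is a multiple of both \<open>u\<close> and \<open>v\<close>,
        which are not parallel, so it vanishes.\<close>
      have "perp B V U \<subseteq> {y \<in> V. ell s t y \<in> {0}}"
      proof
        fix y assume y: "y \<in> perp B V U"
        have 1: "ell s t y \<in> line u" using perp1[OF u(1,2) _ u0 y] u x by simp
        have 2: "ell s t y \<in> line v" using perp1[OF u(1) v(1) _ v0 y] v x' by simp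
        have "ell s t y = 0"
        proof (rule ccontr)
          assume "ell s t y \<noteq> 0"
          then have "v \<in> line (ell s t y)" by (rule line_sym[OF v(1) 2])
          then show False using vu line_trans[OF 1] by blast
        qed
        then show "y \<in> {y \<in> V. ell s t y \<in> {0}}" using y by (simp add: perp_mem)
      qed
      then have "card (perp B V U) \<le> card {y \<in> V. ell s t y \<in> {0}}"
        using finite_V by (intro card_mono) auto
      also have "\<dots> \<le> card {0 :: nat \<Rightarrow> 'k} * q ^ r"
        by (rule card_ell_vimage[OF u(1)]) (simp add: vecs_def fvec_zero)
      finally have K: "card (perp B V U) \<le> q ^ r" by simp
      have "U \<subset> L s t" using \<open>U \<subseteq> L s t\<close> notL[OF u(1)] by blast
      then have "card U < q ^ r"
        using psubset_card_mono[of "L s t" U] finite_subset[OF L_V[OF u(1)] finite_V] card_L[OF u(1)]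
        by simp
      then have "card U * q ^ r < q ^ r * q ^ r"
        using p_gt_0 by (intro mult_strict_right_mono) auto
      moreover have "card U * card (perp B V U) \<le> card U * q ^ r"
        using K by (rule mult_le_mono2)
      ultimately have "card U * card (perp B V U) < q ^ r * q ^ r" by linarith
      then show ?thesis by (simp add: mult_2 power_add)
    qed
  qed
qed

lemma add_subgroup_V: "add_subgroup V"
  unfolding V_def by (rule add_subgroup_fvec)

lemma add_subgroup_perp: "add_subgroup (perp B V U)"
proof -
  have 0: "B 0 y" for y by (simp add: B_def)
  have "B (- x) y" if "B x y" for x y
    unfolding B_def
  proof (intro allI)
    fix i j
    have "- (x (False, i) * y (True, j) - x (False, j) * y (True, i) +
      (x (True, i) * y (False, j) - x (True, j) * y (False, i)) +
      eps * (x (False, i) * y (False, j) - x (False, j) * y (False, i))) = 0"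
      using that by (simp add: B_def)
    then show "(- x) (False, i) * y (True, j) - (- x) (False, j) * y (True, i) +
      ((- x) (True, i) * y (False, j) - (- x) (True, j) * y (False, i)) +
      eps * ((- x) (False, i) * y (False, j) - (- x) (False, j) * y (False, i)) = 0"
      by (simp add: algebra_simps)
  qed
  then show ?thesis
    using add_subgroupD[OF add_subgroup_V] 0 B_add
    by (auto simp: add_subgroup_def perp_def)
qed

section \<open>Extremal subgroups and isotropic lines\<close>

definition Ls :: "(bool \<times> nat \<Rightarrow> 'k) set set"
  where "Ls = (\<lambda>(s, t). L s t) ` P"

lemma LsE: "M \<in> Ls \<Longrightarrow> (\<And>s t. (s, t) \<in> P \<Longrightarrow> M = L s t \<Longrightarrow> thesis) \<Longrightarrow> thesis"
  by (auto simp: Ls_def)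

lemma LsI: "(s, t) \<in> P \<Longrightarrow> L s t \<in> Ls"
  by (auto simp: Ls_def)

lemma card_L_perp:
  assumes "M \<in> Ls"
  shows "card M = q ^ r" "card (perp B V M) = q ^ r"
proof -
  obtain s t where st: "(s, t) \<in> P" "M = L s t" using assms by (rule LsE)
  show "card M = q ^ r" using card_L st by simp
  obtain s' t' where "(s', t') \<in> P" "perp B V (L s t) = L s' t'" using perp_L[OF st(1)] .
  then show "card (perp B V M) = q ^ r" using card_L st by simp
qed

text \<open>The degenerate bound can be applied to \<open>U\<close> or to its orthogonal space: as
  \<open>U\<close> lies in its double orthogonal space, a bound for the pair starting from
  \<open>perp B V U\<close> carries over. The strict bounds concern nonzero subgroups outside
  \<open>Ls\<close>, so the exceptions are settled separately.\<close>

lemma card_perp_bound: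
  assumes U: "add_subgroup U" "U \<subseteq> V"
  shows "card U * card (perp B V U) \<le> card V"
    and "card U * card (perp B V U) = card V \<Longrightarrow> U \<in> {{0}, V} \<union> Ls"
proof -
  let ?K = "perp B V U"
  have K: "add_subgroup ?K" "?K \<subseteq> V"
    by (rule add_subgroup_perp) (auto simp: perp_def)
  have fin: "finite U" using U(2) finite_V by (rule finite_subset)
  have sym: "U \<subseteq> perp B V ?K"
    unfolding subset_iff perp_mem using U(2) by (auto simp: perp_def)
  have finK: "finite (perp B V ?K)"
    using finite_V by (simp add: perp_def)
  consider "U = {0}" | "?K = {0}" | M where "M \<in> Ls" "U = M" | "?K \<in> Ls"
    | "U \<noteq> {0}" "?K \<noteq> {0}" "U \<notin> Ls" "?K \<notin> Ls" by blast
  then have "card U * card ?K \<le> card V \<and> (card U * card ?K = card V \<longrightarrow> U \<in> {{0}, V} \<union> Ls)"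
  proof cases
    case 1
    then show ?thesis using card_mono[OF finite_V K(2)] by simp
  next
    case 2
    then show ?thesis
      using card_mono[OF finite_V U(2)] card_subset_eq[OF finite_V U(2)] by simp
  next
    case 3
    then show ?thesis using card_L_perp[of U] by (simp add: card_V mult_2 power_add)
  next
    case 4
    then have c: "card ?K = q ^ r" "card (perp B V ?K) = q ^ r" using card_L_perp by auto
    then have "card U \<le> q ^ r" using card_mono[OF finK sym] by simp
    then have "card U * card ?K \<le> card V" using c by (simp add: card_V mult_2 power_add)
    moreover have "U \<in> Ls" if "card U * card ?K = card V"
    proof -
      have "card U * q ^ r = q ^ r * q ^ r"
        using that c by (simp add: card_V mult_2 power_add)
      then have "card U = q ^ r" using p_gt_0 by simp
      \<comment> \<open>Equality of orders identifies \<open>U\<close> with its double orthogonal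
        space, and orthogonal spaces of members of \<open>Ls\<close> are again in
        \<open>Ls\<close>.\<close>
      then have "U = perp B V ?K" using card_subset_eq[OF finK sym] c by simp
      moreover obtain s t where "(s, t) \<in> P" "?K = L s t" using 4 by (rule LsE)
      ultimately show ?thesis using perp_L LsI by metis
    qed
    ultimately show ?thesis by simp
  next
    case 5
    have "card U * card ?K < q ^ (2 * r)"
    proof (cases "\<forall>x\<in>U. degenerate x")
      case True
      then show ?thesis using 5 LsI by (intro card_bound_degenerate U) auto
    next
      case False
      then obtain x where x: "x \<in> U" "\<not> degenerate x" by auto
      show ?thesis
      proof (cases "\<forall>k\<in>?K. degenerate k")
        case True
        then have "card ?K * card (perp B V ?K) < q ^ (2 * r)"
          using 5 LsI by (intro card_bound_degenerate K) auto
        moreover have "card U * card ?K \<le> card ?K * card (perp B V ?K)"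
          using mult_le_mono1[OF card_mono[OF finK sym], of "card ?K"] by (simp only: mult.commute)
        ultimately show ?thesis by linarith
      next
        case False
        then show ?thesis using card_bound_nondegenerate[OF U(2) x] by auto
      qed
    qed
    then show ?thesis by (simp add: card_V)
  qed
  then show "card U * card ?K \<le> card V" "card U * card ?K = card V \<Longrightarrow> U \<in> {{0}, V} \<union> Ls"
    by auto
qed

lemma L_inject:
  assumes "(s, t) \<in> P" "(s', t') \<in> P" "L s t = L s' t'"
  shows "(s, t) = (s', t')"
proof (rule ccontr)
  assume "(s, t) \<noteq> (s', t')"
  then have "L s t = {0}" using L_inter[OF assms(1,2)] assms(3) by simp
  then have "q ^ r = 1" using card_L[OF assms(1)] by simp
  moreover have "1 < q ^ r" using r by (intro one_less_power[OF q_gt_1]) simp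
  ultimately show False by linarith
qed

lemma card_Ls: "card Ls = q + 1"
proof -
  have "inj_on (\<lambda>(s, t). L s t) P"
    using L_inject by (auto intro!: inj_onI)
  then have "card Ls = card P" by (simp add: Ls_def card_image)
  also have "card P = card (Pair e ` F) + 1"
    unfolding P_def using finite_F e_nonzero by (subst card_Un_disjoint) auto
  also have "card (Pair e ` F) = q"
    by (simp add: card_image inj_on_def card_F)
  finally show ?thesis .
qed

text \<open>By equality of orders, an isotropic \<open>L s t\<close> equals its own orthogonal
  space. For the line of \<open>(e, t)\<close> this means \<open>t + t + eps = 0\<close>, which
  reads \<open>e = 0\<close> if \<open>p = 2\<close> and \<open>t = 0\<close> otherwise. The line of
  \<open>(0, e)\<close> is always isotropic.\<close>

lemma card_isotropic:
  "card {M \<in> Ls. \<forall>x\<in>M. \<forall>y\<in>M. B x y} = (if p = 2 then 1 else 2)"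
proof -
  have iso: "(\<forall>x\<in>L s t. \<forall>y\<in>L s t. B x y) \<longleftrightarrow> L s t = perp B V (L s t)" if st: "(s, t) \<in> P" for s t
  proof
    assume "\<forall>x\<in>L s t. \<forall>y\<in>L s t. B x y"
    then have "L s t \<subseteq> perp B V (L s t)" using L_V[OF st] by (auto simp: perp_def)
    moreover have "finite (perp B V (L s t))" using finite_V by (simp add: perp_def)
    ultimately show "L s t = perp B V (L s t)"
      using card_L_perp[OF LsI[OF st]] by (intro card_subset_eq) auto
  next
    assume "L s t = perp B V (L s t)"
    then show "\<forall>x\<in>L s t. \<forall>y\<in>L s t. B x y" unfolding perp_def by blast
  qed
  have e_iso: "L e t = perp B V (L e t) \<longleftrightarrow> p \<noteq> 2 \<and> t = 0" if t: "t \<in> F" for t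
  proof -
    have "- (t + eps) \<in> F" using t by (intro uminus_F add_F eps_F)
    then have "(e, t) \<in> P" "(e, - (t + eps)) \<in> P" using t unfolding P_def by blast+
    then have "L e t = perp B V (L e t) \<longleftrightarrow> t = - (t + eps)"
      unfolding perp_L_e[OF t] using L_inject[of e t e "- (t + eps)"] by (metis prod.inject)
    also have "\<dots> \<longleftrightarrow> t + t + eps = 0"
      by (simp only: eq_neg_iff_add_eq_0 add.assoc)
    also have "\<dots> \<longleftrightarrow> p \<noteq> 2 \<and> t = 0"
    proof (cases "p = 2")
      case True
      then have "t + t = 0" using char_F[OF t] by simp
      moreover have "eps = e" unfolding eps_def using True by simp
      ultimately show ?thesis using True e_nonzero by auto
    next
      case False
      then have "odd p" using prime_p prime_odd_nat prime_gt_1_nat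
        by (metis primes_dvd_imp_eq two_is_prime_nat)
      then obtain m where "p = 2 * m + 1" by (rule oddE)
      \<comment> \<open>As \<open>2 * m + 1\<close> annihilates \<open>t\<close>, the element
        \<open>t\<close> is a multiple of \<open>t + t\<close>.\<close>
      then have "t = - (of_nat m * (t + t))"
        using char_F[OF t] by (simp add: algebra_simps eq_neg_iff_add_eq_0)
      then have "t + t = 0 \<longleftrightarrow> t = 0" by auto
      then show ?thesis using False by (simp add: eps_def)
    qed
    finally show ?thesis .
  qed
  have P: "(e, 0) \<in> P" "(0, e) \<in> P" by (auto simp: P_def zero_F)
  have "{M \<in> Ls. \<forall>x\<in>M. \<forall>y\<in>M. B x y} = (if p = 2 then {L 0 e} else {L 0 e, L e 0})"
  proof (intro subset_antisym subsetI)
    fix M assume M: "M \<in> {M \<in> Ls. \<forall>x\<in>M. \<forall>y\<in>M. B x y}"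
    then obtain s t where st: "(s, t) \<in> P" "M = L s t" by (auto elim: LsE)
    from st(1) show "M \<in> (if p = 2 then {L 0 e} else {L 0 e, L e 0})"
      using iso[OF st(1)] M st(2) e_iso[of t] by (cases rule: P_cases) auto
  next
    fix M assume M: "M \<in> (if p = 2 then {L 0 e} else {L 0 e, L e 0})"
    then have "M = L 0 e \<or> M = L e 0 \<and> p \<noteq> 2" by (auto split: if_splits)
    then show "M \<in> {M \<in> Ls. \<forall>x\<in>M. \<forall>y\<in>M. B x y}"
      using iso[OF P(1)] iso[OF P(2)] e_iso[OF zero_F] perp_L_0 P LsI by auto
  qed
  moreover have "L 0 e \<noteq> L e 0" using L_inject[OF P(2,1)] e_nonzero by auto
  ultimately show ?thesis by simp
qed

end

section \<open>The group\<close>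

context alternating_form
begin

text \<open>All square matrices, not only the alternating ones, because the values of
  \<open>cocycle\<close> are not alternating.\<close>

definition W :: "(nat \<times> nat \<Rightarrow> 'k) set"
  where "W = fvec ({..<r} \<times> {..<r})"

text \<open>Bilinear, hence a 2-cocycle. As \<open>S\<close> is symmetric, exchanging the arguments
  transposes the matrix, so commutators are the antisymmetrised values, which are tested by
  \<open>B\<close>.\<close>

definition cocycle :: "(bool \<times> nat \<Rightarrow> 'k) \<Rightarrow> (bool \<times> nat \<Rightarrow> 'k) \<Rightarrow> nat \<times> nat \<Rightarrow> 'k"
  where "cocycle x y = (\<lambda>(i, j). x (False, i) * y (True, j) + x (True, i) * y (False, j) +
    eps * (x (False, i) * y (False, j)))"

definition ext_group :: "((bool \<times> nat \<Rightarrow> 'k) \<times> (nat \<times> nat \<Rightarrow> 'k)) monoid"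
  where "ext_group = \<lparr>carrier = V \<times> W,
    monoid.mult = (\<lambda>(x, w) (y, z). (x + y, w + z + cocycle x y)), one = (0, 0)\<rparr>"

lemma ext_simps [simp]:
  "carrier ext_group = V \<times> W"
  "(x, w) \<otimes>\<^bsub>ext_group\<^esub> (y, z) = (x + y, w + z + cocycle x y)"
  "\<one>\<^bsub>ext_group\<^esub> = (0, 0)"
  by (simp_all add: ext_group_def)

lemma cocycle_W:
  assumes "x \<in> V" "y \<in> V"
  shows "cocycle x y \<in> W"
  unfolding W_def
proof (rule fvecI)
  fix ij :: "nat \<times> nat"
  obtain i j where ij: "ij = (i, j)" by (cases ij)
  show "cocycle x y ij \<in> F"
    using assms by (simp add: ij cocycle_def V_D add_F mult_F eps_F)
  show "cocycle x y ij = 0" if "ij \<notin> {..<r} \<times> {..<r}"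
  proof -
    have "i \<notin> {..<r} \<or> j \<notin> {..<r}" using that by (auto simp: ij)
    then have "(\<forall>b. x (b, i) = 0) \<or> (\<forall>b. y (b, j) = 0)"
      using assms fvec_outside unfolding V_def by fastforce
    then show ?thesis by (auto simp: ij cocycle_def)
  qed
qed

lemma group_ext: "group ext_group"
proof (rule groupI)
  fix g h k
  assume "g \<in> carrier ext_group" "h \<in> carrier ext_group" "k \<in> carrier ext_group"
  then obtain x w y z u v where *: "g = (x, w)" "h = (y, z)" "k = (u, v)"
    "x \<in> V" "w \<in> W" "y \<in> V" "z \<in> W" "u \<in> V" "v \<in> W" by auto
  have WV: "add_subgroup W" unfolding W_def by (rule add_subgroup_fvec)
  show "g \<otimes>\<^bsub>ext_group\<^esub> h \<in> carrier ext_group"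
    using * cocycle_W add_subgroupD(2)[OF add_subgroup_V] add_subgroupD(2)[OF WV] by simp
  show "g \<otimes>\<^bsub>ext_group\<^esub> h \<otimes>\<^bsub>ext_group\<^esub> k = g \<otimes>\<^bsub>ext_group\<^esub> (h \<otimes>\<^bsub>ext_group\<^esub> k)"
    unfolding * by (auto simp: cocycle_def fun_eq_iff algebra_simps)
  show "\<one>\<^bsub>ext_group\<^esub> \<otimes>\<^bsub>ext_group\<^esub> g = g"
    unfolding * by (auto simp: cocycle_def fun_eq_iff)
  \<comment> \<open>By bilinearity \<open>cocycle (- x) x = - cocycle x x\<close>, which the second
    component has to compensate.\<close>
  have "(- x, cocycle x x - w) \<otimes>\<^bsub>ext_group\<^esub> g = \<one>\<^bsub>ext_group\<^esub>"
    unfolding * by (auto simp: cocycle_def fun_eq_iff algebra_simps)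
  moreover have "(- x, cocycle x x - w) \<in> carrier ext_group"
    using * cocycle_W add_subgroupD(3)[OF add_subgroup_V] add_subgroupD(4)[OF WV] by simp
  ultimately show "\<exists>h\<in>carrier ext_group. h \<otimes>\<^bsub>ext_group\<^esub> g = \<one>\<^bsub>ext_group\<^esub>" by blast
next
  show "\<one>\<^bsub>ext_group\<^esub> \<in> carrier ext_group"
    by (simp add: V_def W_def fvec_zero)
qed

lemma commute_ext_iff:
  "(x, w) \<otimes>\<^bsub>ext_group\<^esub> (y, z) = (y, z) \<otimes>\<^bsub>ext_group\<^esub> (x, w) \<longleftrightarrow> B x y"
proof -
  have "cocycle x y (i, j) = cocycle y x (i, j) \<longleftrightarrow>
    x (False, i) * y (True, j) - x (False, j) * y (True, i) +
    (x (True, i) * y (False, j) - x (True, j) * y (False, i)) +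
    eps * (x (False, i) * y (False, j) - x (False, j) * y (False, i)) = 0" for i j
    unfolding eq_iff_diff_eq_0[of "cocycle x y (i, j)"]
    by (simp add: cocycle_def algebra_simps)
  then have "cocycle x y = cocycle y x \<longleftrightarrow> B x y"
    unfolding B_def fun_eq_iff by auto
  then show ?thesis by (auto simp: add.commute)
qed

lemma finite_W: "finite W"
  by (simp add: W_def finite_fvec)

text \<open>The finite group is transported to natural numbers along an arbitrary injection;
  \<open>\<pi>\<close> decodes and projects to \<open>V\<close>.\<close>

lemma exists_nat_group:
  fixes n :: nat
  assumes n: "n = a * r"
  shows "\<exists>(G :: nat monoid) \<pi>. finite_p_group p G \<and> cd_family G p \<pi> V B n (p ^ a + 1) Ls"
proof -
  let ?E = "ext_group"
  interpret E: group ?E by (rule group_ext)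
  obtain enc :: "_ \<Rightarrow> nat" where enc: "inj_on enc (V \<times> W)"
    using finite_imp_inj_to_nat_seg[of "V \<times> W"] finite_V finite_W by (metis finite_cartesian_product)
  define dec where "dec = inv_into (V \<times> W) enc"
  have dec: "dec (enc g) = g" if "g \<in> V \<times> W" for g
    using enc that by (simp add: dec_def)
  define G :: "nat monoid" where "G = \<lparr>carrier = enc ` (V \<times> W),
    monoid.mult = (\<lambda>g h. enc (dec g \<otimes>\<^bsub>?E\<^esub> dec h)), one = enc \<one>\<^bsub>?E\<^esub>\<rparr>"
  have G: "carrier G = enc ` (V \<times> W)" "\<one>\<^bsub>G\<^esub> = enc \<one>\<^bsub>?E\<^esub>"
      "\<And>g h. g \<otimes>\<^bsub>G\<^esub> h = enc (dec g \<otimes>\<^bsub>?E\<^esub> dec h)"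
    by (simp_all add: G_def)
  have mem: "g \<otimes>\<^bsub>?E\<^esub> h \<in> V \<times> W" if "g \<in> V \<times> W" "h \<in> V \<times> W" for g h
    using E.m_closed[of g h] that by (simp only: ext_simps)
  have iso: "enc \<in> iso ?E G"
    unfolding iso_def hom_def bij_betw_def using enc mem dec by (auto simp: G simp del: ext_simps(2))
  \<comment> \<open>The image of a group under an isomorphism is obtained with its unit replaced by
    the image of the unit, which changes nothing here.\<close>
  have "G\<lparr>one := enc \<one>\<^bsub>?E\<^esub>\<rparr> = G" by (simp add: G_def)
  then interpret G: group G
    using E.iso_imp_img_group[OF iso] by metis
  have card_W: "card W = q ^ (r * r)"
    by (simp add: W_def card_fvec card_cartesian_product)
  have order_G: "card (carrier G) = p ^ (a * (2 * r + r * r))"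
    unfolding G(1) card_image[OF enc] card_cartesian_product card_V card_W
    by (simp only: power_mult power_add)
  have "finite_p_group p G"
    unfolding finite_p_group_def order_def using G.group_axioms order_G finite_V finite_W
    by (auto simp: G)
  define \<pi> where "\<pi> = (\<lambda>g. fst (dec g))"
  \<comment> \<open>The cocycle vanishes on the kernel of \<open>\<pi>\<close>, so powers there are
    multiples in \<open>W\<close>, which has exponent \<open>p\<close>.\<close>
  have pow: "dec (g [^]\<^bsub>G\<^esub> k) = (0, of_nat k * snd (dec g))"
    if g: "g \<in> carrier G" "\<pi> g = 0" for g and k :: nat
  proof (induction k)
    case 0
    have "(0, 0) \<in> V \<times> W" by (simp add: V_def W_def fvec_zero)
    then have "dec (enc (0, 0)) = (0, 0)" by (rule dec)
    then show ?case by (auto simp: G fun_eq_iff)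
  next
    case (Suc k)
    obtain w where w: "dec g = (0, w)" "w \<in> W"
      using g by (cases "dec g") (auto simp: G \<pi>_def dec)
    have "g [^]\<^bsub>G\<^esub> Suc k = enc (dec (g [^]\<^bsub>G\<^esub> k) \<otimes>\<^bsub>?E\<^esub> dec g)"
      by (simp add: G)
    also have "dec (g [^]\<^bsub>G\<^esub> k) \<otimes>\<^bsub>?E\<^esub> dec g = (0, of_nat (Suc k) * w)"
      unfolding Suc w by (auto simp: cocycle_def fun_eq_iff algebra_simps)
    finally have *: "g [^]\<^bsub>G\<^esub> Suc k = enc (0, of_nat (Suc k) * w)" .
    have "(0, of_nat (Suc k) * w) \<in> V \<times> W"
      using add_subgroup_of_nat[of W w "Suc k", OF _ w(2)]
      by (simp add: V_def W_def fvec_zero add_subgroup_fvec del: of_nat_Suc)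
    then have "dec (enc (0, of_nat (Suc k) * w)) = (0, of_nat (Suc k) * w)" by (rule dec)
    then show ?case by (simp only: * w snd_conv)
  qed
  have "class_two_group G p \<pi> V B"
  proof (intro class_two_group.intro class_two_group_axioms.intro G.group_axioms prime_p perp_V)
    show "finite (carrier G)" using finite_V finite_W by (simp add: G)
    show "V = \<pi> ` carrier G"
    proof -
      have "\<pi> ` carrier G = fst ` (V \<times> W)"
        unfolding G(1) image_image \<pi>_def by (intro image_cong) (simp_all add: dec)
      moreover have "0 \<in> W" by (simp add: W_def fvec_zero)
      ultimately show ?thesis by auto
    qed
    fix g assume g: "g \<in> carrier G"
    then obtain x w where x: "g = enc (x, w)" "x \<in> V" "w \<in> W" by (auto simp: G)
    show "g [^]\<^bsub>G\<^esub> p = \<one>\<^bsub>G\<^esub>" if "\<pi> g = 0"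
    proof -
      have "dec (g [^]\<^bsub>G\<^esub> p) = (0, 0)"
        using pow[OF g that, of p] fvec_char x by (simp add: dec W_def)
      moreover have "g [^]\<^bsub>G\<^esub> p \<in> enc ` (V \<times> W)" using g by (simp flip: G(1))
      ultimately show ?thesis using dec by (auto simp: G)
    qed
    fix h assume "h \<in> carrier G"
    then obtain y z where y: "h = enc (y, z)" "y \<in> V" "z \<in> W" by (auto simp: G)
    show "\<pi> (g \<otimes>\<^bsub>G\<^esub> h) = \<pi> g + \<pi> h"
      using x y mem[of "(x, w)" "(y, z)"] by (simp add: G \<pi>_def dec)
    have "g \<otimes>\<^bsub>G\<^esub> h = h \<otimes>\<^bsub>G\<^esub> g \<longleftrightarrow>
        (x, w) \<otimes>\<^bsub>?E\<^esub> (y, z) = (y, z) \<otimes>\<^bsub>?E\<^esub> (x, w)"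
      using x y mem[of "(x, w)" "(y, z)"] mem[of "(y, z)" "(x, w)"] inj_onD[OF enc]
      by (auto simp: G dec simp del: ext_simps)
    then show "g \<otimes>\<^bsub>G\<^esub> h = h \<otimes>\<^bsub>G\<^esub> g \<longleftrightarrow> B (\<pi> g) (\<pi> h)"
      using x y by (simp only: commute_ext_iff) (simp add: \<pi>_def dec)
  next
    show "of_nat p * v = 0" if "v \<in> V" for v
      using that unfolding V_def by (rule fvec_char)
  qed
  moreover have "cd_family_axioms p V B n (p ^ a + 1) Ls"
  proof
    show "n > 0" using n a_pos r by simp
    show "card V = p ^ (2 * n)" by (simp add: card_V n mult_ac flip: power_mult)
    show "card Ls = p ^ a + 1" by (rule card_Ls)
    show "p ^ a + 1 \<ge> 3" using q_gt_1 by simp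
    show "card U * card (perp B V U) \<le> card V" if "add_subgroup U" "U \<subseteq> V" for U
      using card_perp_bound(1)[OF that] .
    show "U \<in> {{0}, V} \<union> Ls"
      if "add_subgroup U" "U \<subseteq> V" "card U * card (perp B V U) = card V" for U
      using card_perp_bound(2)[OF that] .
    fix M assume M: "M \<in> Ls"
    then obtain s t where st: "(s, t) \<in> P" "M = L s t" by (rule LsE)
    show "add_subgroup M" using st add_subgroup_L by simp
    show "M \<subseteq> V" using st L_V by simp
    show "card M = p ^ n" "card (perp B V M) = p ^ n"
      using card_L_perp[OF M] by (simp_all add: n power_mult)
    fix N assume "N \<in> Ls"
    then obtain s' t' where st': "(s', t') \<in> P" "N = L s' t'" by (rule LsE)
    show "\<exists>\<phi>. bij_betw \<phi> M N \<and> (\<forall>x\<in>M. \<forall>y\<in>M. \<phi> (x + y) = \<phi> x + \<phi> y)"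
      using L_iso[OF st(1) st'(1)] st st' by simp
    assume "M \<noteq> N"
    then have ne: "(s, t) \<noteq> (s', t')" using st st' by auto
    show "M \<inter> N = {0}" using L_inter[OF st(1) st'(1) ne] st st' by simp
    show "\<exists>x\<in>M. \<exists>y\<in>N. v = x + y" if "v \<in> V" for v
      using L_sum[OF st(1) st'(1) ne that] st st' by simp
  qed
  ultimately have "cd_family G p \<pi> V B n (p ^ a + 1) Ls"
    by (rule cd_family.intro)
  then show ?thesis using \<open>finite_p_group p G\<close> by blast
qed

end

theorem theorem8:
  fixes p a r n :: nat
  assumes "Factorial_Ring.prime p"
    and "a > 0" and "r > 0" and "r \<ge> 3"
    and "n = a * r"
  shows "\<exists>G :: nat monoid.
    finite_p_group p G \<and>
    property_P1 p G \<and> property_P2 G \<and> property_P3 p n G \<and>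
    order (G Mod center G) = p ^ (2 * n) \<and>
    quasi_antichain (cd_lattice G) (p ^ a + 1) \<and>
    card (abelian_cd_atoms G) = (if p = 2 then 1 else 2)"
proof -
  obtain F and e :: "((int list \<times> nat) multiset \<Rightarrow> int) cring_prod" where "finite_subfield F e p a"
    using exists_finite_subfield[OF assms(1,2)] by blast
  then interpret alternating_form F e p a r
    using assms(4) by (intro alternating_form.intro alternating_form_axioms.intro)
  obtain G :: "nat monoid" and \<pi> where G: "finite_p_group p G"
      and cd: "cd_family G p \<pi> V B n (p ^ a + 1) Ls"
    using exists_nat_group[OF assms(5)] by blast
  interpret cd_family G p \<pi> V B n "p ^ a + 1" Ls by (rule cd)
  show ?thesis
    using G property_P1 property_P2 property_P3 order_Mod_center cd_lattice_quasi_antichain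
      card_abelian_cd_atoms card_isotropic by auto
qed

end
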